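(* $\mathfrak{C}\subseteq\mathfrak{H}$, where $\mathfrak{C}$ is the Boolean lattice generated by the contractive Schur idempotents in the Boolean lattice $\mathfrak{I}$ of all Schur idempotents.
   Context: $H$ is a separable Hilbert space, $\mathcal{B}(H)$ is the space of bounded linear operators on $H$ with the operator norm, and $\mathcal{D}\subseteq\mathcal{B}(H)$ is a fixed maximal abelian selfadjoint algebra (masa). For a subspace $\mathcal{X}\subseteq\mathcal{B}(H)$ and $T\in\mathcal{B}(H)$, put $\alpha(T,\mathcal{X})=\sup\{\inf_{X\in\mathcal{X}}\|T\xi-X\xi\| : \xi\in H,\ \|\xi\|=1\}$. A Schur multiplier is a weak* continuous $\mathcal{D}$-bimodule (linear) map on $\mathcal{B}(H)$; $\|\Phi\|$ denotes its norm as a linear map on the Banach space $\mathcal{B}(H)$, and Schur multipliers commute under composition. A Schur idempotent is a Schur multiplier $\Phi$ with $\Phi\circ\Phi=\Phi$; $\mathfrak{I}$ is the set of all Schur idempotents, a Boolean lattice under $\Phi\wedge\Psi=\Phi\Psi$, $\Phi\vee\Psi=\Phi+\Psi-\Phi\Psi$ and complementation $\Phi^\perp=\mathrm{id}-\Phi$. Let $\mathfrak{I}_1=\{\Phi\in\mathfrak{I}:\|\Phi\|\leq1\}$, and let $\mathfrak{C}$ be the Boolean lattice generated by $\mathfrak{I}_1$, i.e. the smallest subset of $\mathfrak{I}$ containing $\mathfrak{I}_1$ and closed under $\wedge$, $\vee$ and $\perp$. $\mathfrak{H}$ is the set of $\Phi\in\mathfrak{I}$ for which there is $\lambda>0$ with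 $\|\Phi^\perp(T)\|\leq\lambda\,\alpha(T,\operatorname{Ran}\Phi)$ for all $T\in\mathcal{B}(H)$, where $\operatorname{Ran}\Phi$ is the range of $\Phi$. *)

theory Defs
  imports "HOL-Analysis.Analysis"
begin

section \<open>Complex Hilbert spaces\<close>

class scaleC = scaleR +
  fixes scaleC :: "complex \<Rightarrow> 'a \<Rightarrow> 'a"  (infixr "*\<^sub>C" 75)

class complex_normed_vector = scaleC + real_normed_vector +
  assumes scaleC_add_right: "a *\<^sub>C (x + y) = a *\<^sub>C x + a *\<^sub>C y"
    and scaleC_add_left: "(a + b) *\<^sub>C x = a *\<^sub>C x + b *\<^sub>C x"
    and scaleC_scaleC: "a *\<^sub>C (b *\<^sub>C x) = (a * b) *\<^sub>C x"
    and scaleC_of_real: "complex_of_real r *\<^sub>C x = r *\<^sub>R x"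
    and norm_scaleC: "norm (a *\<^sub>C x) = cmod a * norm x"

text \<open>The inner product is linear in the first and conjugate linear in the second argument.
  The last axiom also gives positive definiteness, since the square root of a negative real is
  negative in HOL.\<close>

class chilbert_space = complex_normed_vector + complete_space +
  fixes cinner :: "'a \<Rightarrow> 'a \<Rightarrow> complex"
  assumes cinner_commute: "cinner x y = cnj (cinner y x)"
    and cinner_add_left: "cinner (x + y) z = cinner x z + cinner y z"
    and cinner_scaleC_left: "cinner (a *\<^sub>C x) y = a * cinner x y"
    and norm_eq_sqrt_cinner: "norm x = sqrt (Re (cinner x x))"

definition clinear :: "('a::complex_normed_vector \<Rightarrow> 'b::complex_normed_vector) \<Rightarrow> bool" where
  "clinear f \<longleftrightarrow> (\<forall>x y. f (x + y) = f x + f y) \<and> (\<forall>c x. f (c *\<^sub>C x) = c *\<^sub>C f x)"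

definition csubspace :: "'a::complex_normed_vector set \<Rightarrow> bool" where
  "csubspace S \<longleftrightarrow> 0 \<in> S \<and> (\<forall>x\<in>S. \<forall>y\<in>S. x + y \<in> S) \<and> (\<forall>c. \<forall>x\<in>S. c *\<^sub>C x \<in> S)"


section \<open>Bounded complex-linear operators with the operator norm\<close>

typedef (overloaded) ('a::complex_normed_vector) bop =
  "{T :: 'a \<Rightarrow>\<^sub>L 'a. clinear (blinfun_apply T)}"
  morphisms blinfun_of_bop Abs_bop
proof
  show "0 \<in> {T :: 'a \<Rightarrow>\<^sub>L 'a. clinear (blinfun_apply T)}"
    using scaleC_add_right[of _ "0::'a" 0] by (simp add: clinear_def)
qed

setup_lifting type_definition_bop

lift_definition bop_apply :: "'a::complex_normed_vector bop \<Rightarrow> 'a \<Rightarrow> 'a"  (infixr "\<cdot>" 75)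
  is blinfun_apply .

lift_definition bop_id :: "'a::complex_normed_vector bop"
  is id_blinfun by (simp add: clinear_def)

lift_definition bop_comp :: "'a::complex_normed_vector bop \<Rightarrow> 'a bop \<Rightarrow> 'a bop"  (infixl "\<odot>" 70)
  is "(o\<^sub>L)" by (simp add: clinear_def)

lemma scaleC_minus_right: "a *\<^sub>C (- x) = - (a *\<^sub>C (x::'a::complex_normed_vector))"
  by (metis scaleC_of_real scaleC_scaleC mult.commute scaleR_minus1_left)

lemma scaleC_diff_right: "a *\<^sub>C (x - y) = a *\<^sub>C x - a *\<^sub>C (y::'a::complex_normed_vector)"
  using scaleC_add_right[of a x "- y"] by (simp add: scaleC_minus_right)

lemma scaleC_one: "1 *\<^sub>C x = (x::'a::complex_normed_vector)"
  using scaleC_of_real[of 1 x] by simp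

instantiation bop :: (complex_normed_vector) complex_normed_vector
begin

lift_definition zero_bop :: "'a bop" is 0
  using scaleC_add_right[of _ "0::'a" 0] by (simp add: clinear_def)

lift_definition plus_bop :: "'a bop \<Rightarrow> 'a bop \<Rightarrow> 'a bop" is "(+)"
  by (simp add: clinear_def plus_blinfun.rep_eq scaleC_add_right)

lift_definition uminus_bop :: "'a bop \<Rightarrow> 'a bop" is uminus
  by (simp add: clinear_def uminus_blinfun.rep_eq scaleC_minus_right)

lift_definition minus_bop :: "'a bop \<Rightarrow> 'a bop \<Rightarrow> 'a bop" is "(-)"
  by (simp add: clinear_def blinfun.diff_left scaleC_diff_right)

lift_definition scaleR_bop :: "real \<Rightarrow> 'a bop \<Rightarrow> 'a bop" is "(*\<^sub>R)"
  by (simp add: clinear_def scaleR_blinfun.rep_eq scaleR_add_right)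
    (metis scaleC_of_real scaleC_scaleC mult.commute)

lift_definition scaleC_bop :: "complex \<Rightarrow> 'a bop \<Rightarrow> 'a bop"
  is "\<lambda>c T. Blinfun (\<lambda>x. c *\<^sub>C blinfun_apply T x)"
proof -
  fix c and T :: "'a \<Rightarrow>\<^sub>L 'a"
  assume T: "clinear (blinfun_apply T)"
  have "bounded_linear (\<lambda>x::'a. c *\<^sub>C x)"
    by (rule bounded_linear_intro[where K = "cmod c"])
      (simp_all add: scaleC_add_right norm_scaleC mult.commute,
       metis scaleC_of_real scaleC_scaleC mult.commute)
  then have "bounded_linear (\<lambda>x. c *\<^sub>C blinfun_apply T x)"
    by (rule bounded_linear_compose) (rule blinfun.bounded_linear_right)
  then show "clinear (blinfun_apply (Blinfun (\<lambda>x. c *\<^sub>C blinfun_apply T x)))"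
    using T by (simp add: bounded_linear_Blinfun_apply clinear_def scaleC_add_right
        scaleC_scaleC mult.commute)
qed

lift_definition norm_bop :: "'a bop \<Rightarrow> real" is norm .

definition dist_bop :: "'a bop \<Rightarrow> 'a bop \<Rightarrow> real"
  where "dist_bop S T = norm (S - T)"

definition sgn_bop :: "'a bop \<Rightarrow> 'a bop"
  where "sgn_bop T = inverse (norm T) *\<^sub>R T"

definition [code del]:
  "(uniformity :: ('a bop \<times> 'a bop) filter) = (INF e\<in>{0 <..}. principal {(S, T). dist S T < e})"

definition open_bop :: "'a bop set \<Rightarrow> bool"
  where [code del]: "open_bop U = (\<forall>S\<in>U. \<forall>\<^sub>F (S', T) in uniformity. S' = S \<longrightarrow> T \<in> U)"

lemma scaleC_bop_apply: "(c *\<^sub>C T) \<cdot> x = c *\<^sub>C (T \<cdot> x)"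
proof transfer
  fix c and T :: "'a \<Rightarrow>\<^sub>L 'a" and x
  have "bounded_linear (\<lambda>x::'a. c *\<^sub>C x)"
    by (rule bounded_linear_intro[where K = "cmod c"])
      (simp_all add: scaleC_add_right norm_scaleC mult.commute,
       metis scaleC_of_real scaleC_scaleC mult.commute)
  then have "bounded_linear (\<lambda>x. c *\<^sub>C blinfun_apply T x)"
    by (rule bounded_linear_compose) (rule blinfun.bounded_linear_right)
  then show "blinfun_apply (Blinfun (\<lambda>x. c *\<^sub>C blinfun_apply T x)) x = c *\<^sub>C blinfun_apply T x"
    by (simp add: bounded_linear_Blinfun_apply)
qed

lemma bop_eqI: "(\<And>x. S \<cdot> x = T \<cdot> x) \<Longrightarrow> S = T"
  by transfer (rule blinfun_eqI)

lemma norm_bop_eq_onorm: "norm T = onorm (bop_apply T)"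
  by transfer (rule norm_blinfun.rep_eq)

lemma plus_bop_apply: "(S + T) \<cdot> x = S \<cdot> x + T \<cdot> x"
  by transfer (simp add: blinfun.add_left)

lemma scaleR_bop_apply: "(r *\<^sub>R T) \<cdot> x = r *\<^sub>R (T \<cdot> x)"
  by transfer (simp add: blinfun.scaleR_left)

instance
proof
  fix S T U :: "'a bop" and r s :: real and a b :: complex
  show "S + T + U = S + (T + U)" by transfer simp
  show "S + T = T + S" by transfer simp
  show "0 + S = S" by transfer simp
  show "- S + S = 0" by transfer simp
  show "S - T = S + - T" by transfer simp
  show "r *\<^sub>R (S + T) = r *\<^sub>R S + r *\<^sub>R T" by transfer (simp add: scaleR_add_right)
  show "(r + s) *\<^sub>R S = r *\<^sub>R S + s *\<^sub>R S" by transfer (simp add: scaleR_add_left)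
  show "r *\<^sub>R s *\<^sub>R S = (r * s) *\<^sub>R S" by transfer simp
  show "1 *\<^sub>R S = S" by transfer simp
  show "dist S T = norm (S - T)" by (rule dist_bop_def)
  show "sgn S = inverse (norm S) *\<^sub>R S" by (rule sgn_bop_def)
  show "(uniformity :: ('a bop \<times> 'a bop) filter)
      = (INF e\<in>{0 <..}. principal {(S, T). dist S T < e})"
    by (rule uniformity_bop_def)
  show "open U = (\<forall>S\<in>U. \<forall>\<^sub>F (S', T) in uniformity. S' = S \<longrightarrow> T \<in> U)" for U :: "'a bop set"
    by (rule open_bop_def)
  show "norm S = 0 \<longleftrightarrow> S = 0" by transfer simp
  show "norm (S + T) \<le> norm S + norm T" by transfer (rule norm_triangle_ineq)
  show "norm (r *\<^sub>R S) = \<bar>r\<bar> * norm S" by transfer simp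
  show "a *\<^sub>C (S + T) = a *\<^sub>C S + a *\<^sub>C T"
    by (rule bop_eqI) (simp add: scaleC_bop_apply plus_bop_apply scaleC_add_right)
  show "(a + b) *\<^sub>C S = a *\<^sub>C S + b *\<^sub>C S"
    by (rule bop_eqI) (simp add: scaleC_bop_apply plus_bop_apply scaleC_add_left)
  show "a *\<^sub>C (b *\<^sub>C S) = (a * b) *\<^sub>C S"
    by (rule bop_eqI) (simp add: scaleC_bop_apply scaleC_scaleC)
  show "complex_of_real r *\<^sub>C S = r *\<^sub>R S"
    by (rule bop_eqI) (simp add: scaleC_bop_apply scaleR_bop_apply scaleC_of_real)
  show "norm (a *\<^sub>C S) = cmod a * norm S"
  proof (rule antisym)
    have le: "norm (c *\<^sub>C T) \<le> cmod c * norm T" for c and T :: "'a bop"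
    proof -
      have "norm (c *\<^sub>C T) = onorm (bop_apply (c *\<^sub>C T))" by (rule norm_bop_eq_onorm)
      also have "\<dots> \<le> cmod c * norm T"
      proof (rule onorm_bound)
        show "norm ((c *\<^sub>C T) \<cdot> x) \<le> cmod c * norm T * norm x" for x
          unfolding scaleC_bop_apply norm_scaleC mult.assoc
          by (rule mult_left_mono, transfer) (simp_all add: norm_blinfun)
        show "0 \<le> cmod c * norm T" by (transfer) simp
      qed
      finally show ?thesis .
    qed
    show "norm (a *\<^sub>C S) \<le> cmod a * norm S" by (rule le)
    show "cmod a * norm S \<le> norm (a *\<^sub>C S)"
    proof (cases "a = 0")
      case True
      then show ?thesis by (transfer) simp
    next
      case False
      have "S = inverse a *\<^sub>C a *\<^sub>C S"
        using False
        by (intro bop_eqI) (simp add: scaleC_bop_apply scaleC_scaleC scaleC_one)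
      then have "norm S \<le> cmod (inverse a) * norm (a *\<^sub>C S)"
        using le[of "inverse a" "a *\<^sub>C S"] by simp
      then show ?thesis
        using False by (simp add: norm_divide field_simps)
    qed
  qed
qed

end


section \<open>Maximal abelian selfadjoint algebras\<close>

definition is_adjoint :: "'h::chilbert_space bop \<Rightarrow> 'h bop \<Rightarrow> bool" where
  "is_adjoint S T \<longleftrightarrow> (\<forall>x y. cinner (T \<cdot> x) y = cinner x (S \<cdot> y))"

definition abelian_selfadjoint_algebra :: "'h::chilbert_space bop set \<Rightarrow> bool" where
  "abelian_selfadjoint_algebra A \<longleftrightarrow>
     csubspace A \<and>
     (\<forall>S\<in>A. \<forall>T\<in>A. S \<odot> T \<in> A) \<and>
     (\<forall>S\<in>A. \<forall>T\<in>A. S \<odot> T = T \<odot> S) \<and>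
     (\<forall>T\<in>A. \<exists>S\<in>A. is_adjoint S T)"

definition masa :: "'h::chilbert_space bop set \<Rightarrow> bool" where
  "masa D \<longleftrightarrow> abelian_selfadjoint_algebra D \<and>
     (\<forall>A. abelian_selfadjoint_algebra A \<and> D \<subseteq> A \<longrightarrow> A = D)"


section \<open>The weak* topology of the bounded operators\<close>

text \<open>The space of bounded operators is the dual of the trace class under the trace pairing.  The
  trace class operators are the sums \<open>\<Sum>n. x n \<otimes> (y n)\<^sup>*\<close> of rank one operators with \<open>x\<close> and \<open>y\<close>
  square summable, and such an operator pairs with \<open>T\<close> to \<open>\<Sum>n. \<langle>T (x n), y n\<rangle>\<close>.\<close>

definition weak_star_functionals :: "('h::chilbert_space bop \<Rightarrow> complex) set" where
  "weak_star_functionals =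
     {\<lambda>T. \<Sum>n. cinner (T \<cdot> x n) (y n) | x y :: nat \<Rightarrow> 'h.
        summable (\<lambda>n. (norm (x n))\<^sup>2) \<and> summable (\<lambda>n. (norm (y n))\<^sup>2)}"

definition weak_star_topology :: "'h::chilbert_space bop topology" where
  "weak_star_topology =
     topology_generated_by {\<omega> -` U | \<omega> U. \<omega> \<in> weak_star_functionals \<and> open U}"


section \<open>Schur multipliers and Schur idempotents\<close>

definition schur_multiplier ::
    "'h::chilbert_space bop set \<Rightarrow> ('h bop \<Rightarrow> 'h bop) \<Rightarrow> bool" where
  "schur_multiplier D \<Phi> \<longleftrightarrow>
     clinear \<Phi> \<and>
     continuous_map weak_star_topology weak_star_topology \<Phi> \<and>
     (\<forall>A\<in>D. \<forall>B\<in>D. \<forall>T. \<Phi> (A \<odot> T \<odot> B) = A \<odot> \<Phi> T \<odot> B)"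

text \<open>The norm of a linear map as an extended nonnegative real, so that no boundedness is
  presupposed (\<open>onorm\<close> is unspecified on unbounded maps).\<close>

definition map_norm :: "('a::real_normed_vector \<Rightarrow> 'b::real_normed_vector) \<Rightarrow> ennreal" where
  "map_norm \<Phi> = (SUP T\<in>{T. norm T \<le> 1}. ennreal (norm (\<Phi> T)))"

definition schur_idempotents :: "'h::chilbert_space bop set \<Rightarrow> ('h bop \<Rightarrow> 'h bop) set" where
  "schur_idempotents D = {\<Phi>. schur_multiplier D \<Phi> \<and> \<Phi> \<circ> \<Phi> = \<Phi>}"

definition contractive_schur_idempotents ::
    "'h::chilbert_space bop set \<Rightarrow> ('h bop \<Rightarrow> 'h bop) set" where
  "contractive_schur_idempotents D = {\<Phi> \<in> schur_idempotents D. map_norm \<Phi> \<le> 1}"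

definition schur_meet :: "('a \<Rightarrow> 'a) \<Rightarrow> ('a \<Rightarrow> 'a) \<Rightarrow> 'a \<Rightarrow> 'a" where
  "schur_meet \<Phi> \<Psi> = \<Phi> \<circ> \<Psi>"

definition schur_join :: "('a::ab_group_add \<Rightarrow> 'a) \<Rightarrow> ('a \<Rightarrow> 'a) \<Rightarrow> 'a \<Rightarrow> 'a" where
  "schur_join \<Phi> \<Psi> = (\<lambda>T. \<Phi> T + \<Psi> T - \<Phi> (\<Psi> T))"

definition schur_compl :: "('a::ab_group_add \<Rightarrow> 'a) \<Rightarrow> 'a \<Rightarrow> 'a" where
  "schur_compl \<Phi> = (\<lambda>T. T - \<Phi> T)"

inductive_set contractive_lattice ::
    "'h::chilbert_space bop set \<Rightarrow> ('h bop \<Rightarrow> 'h bop) set" for D where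
  contractive: "\<Phi> \<in> contractive_schur_idempotents D \<Longrightarrow> \<Phi> \<in> contractive_lattice D"
| meet: "\<Phi> \<in> contractive_lattice D \<Longrightarrow> \<Psi> \<in> contractive_lattice D \<Longrightarrow>
    schur_meet \<Phi> \<Psi> \<in> contractive_lattice D"
| join: "\<Phi> \<in> contractive_lattice D \<Longrightarrow> \<Psi> \<in> contractive_lattice D \<Longrightarrow>
    schur_join \<Phi> \<Psi> \<in> contractive_lattice D"
| compl: "\<Phi> \<in> contractive_lattice D \<Longrightarrow> schur_compl \<Phi> \<in> contractive_lattice D"


section \<open>Hyperreflexive ranges\<close>

text \<open>Values in \<open>ennreal\<close> make the supremum over the empty unit sphere of the zero space \<open>0\<close>.\<close>

definition alpha :: "'a::complex_normed_vector bop \<Rightarrow> 'a bop set \<Rightarrow> ennreal" where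
  "alpha T \<X> = (SUP \<xi>\<in>{\<xi>. norm \<xi> = 1}. INF X\<in>\<X>. ennreal (norm (T \<cdot> \<xi> - X \<cdot> \<xi>)))"

definition hyperreflexive_schur_idempotents ::
    "'h::chilbert_space bop set \<Rightarrow> ('h bop \<Rightarrow> 'h bop) set" where
  "hyperreflexive_schur_idempotents D =
     {\<Phi> \<in> schur_idempotents D. \<exists>l>0. \<forall>T.
        ennreal (norm (schur_compl \<Phi> T)) \<le> ennreal l * alpha T (range \<Phi>)}"

end

theory Submission
  imports Defs
begin

text \<open>In \<open>L\<^sup>2\<close> terms, a Schur idempotent multiplies kernels by a function \<open>\<phi>(s, t) = \<langle>b(t), a(s)\<rangle>\<close>
  with values in \<open>{0, 1}\<close>, where \<open>a, b\<close> are \<open>\<ell>\<^sup>2\<close>-valued: this is what weak* continuity of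
  \<open>T \<mapsto> \<langle>\<Phi>(T)\<xi>, \<eta>\<rangle>\<close> says.  Since \<open>\<ell>\<^sup>2\<close> is separable, up to small sets one can partition so finely
  that \<open>a\<close> and \<open>b\<close> are nearly constant on each cell, hence \<open>\<phi>\<close> is \<open>0\<close> or \<open>1\<close> on each product of
  cells.  This reduces everything to finite \<open>0\<close>-\<open>1\<close> masks.

  A contractive mask contains no \<open>2 \<times> 2\<close> block with exactly one zero, so it is the mask
  \<open>f A = g B\<close> of a labelling of rows and columns.  The compression to the pairs with \<open>f A \<noteq> g B\<close> is
  twice the average, over all sets \<open>S\<close> of labels, of the compressions to the pairs separated by \<open>S\<close>,
  which are block sums of two rectangles.  Iterating, a product of \<open>k\<close> contractive idempotents and
  complements is bounded by \<open>2 ^ k\<close> times its supremum over the rectangles inside its mask.  The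
  complement of an element \<open>\<Theta>\<close> of the lattice is a finite sum of such products, and a rectangle
  \<open>P, Q\<close> on which \<open>\<Theta>\<close> vanishes satisfies \<open>P X Q = 0\<close> for \<open>X \<in> Ran \<Theta>\<close>, whence
  \<open>\<parallel>P T Q\<parallel> \<le> \<alpha>(T, Ran \<Theta>)\<close>.\<close>

section \<open>Operators as an algebra\<close>

text \<open>What makes the last step work is that the sum of products for the complement of
  \<open>\<Theta>\<close> carries no signs. Where a single product is the identity on a pair of
  cells, the complement is a positive multiple of the identity there, so \<open>\<Theta>\<close>,
  which is 0 or the identity on the pair, must be 0. With cancellation a product could live on
  rectangles that \<open>\<Theta>\<close> does not kill, and \<alpha> would say nothing about them.
  The resulting constant, the sum of \<open>2 ^ k\<close> over the products of length
  \<open>k\<close>, does not depend on the partition, and this permits the passage from finite masks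
  to operators. The obstacle is that \<open>D\<close> is an abstract masa, perhaps without minimal
  projections, given without matrix entries or a measure space. Projections of \<open>D\<close>
  serve as sets, and the unbounded functions \<open>a\<close>, \<open>b\<close> are never formed:
  they are present only as vectors, the function applied to a fixed vector. A partition, too, is
  tied to two vectors \<open>\<xi>\<close>, \<open>\<eta>\<close> and an error, and its cells need
  not sum to 1; this is enough because an operator norm is tested on one pair of vectors at a
  time.\<close>

instantiation bop :: (complex_normed_vector) "{real_normed_algebra, monoid_mult}"
begin

definition times_bop :: "'a bop \<Rightarrow> 'a bop \<Rightarrow> 'a bop" where "times_bop S T = S \<odot> T"
definition one_bop :: "'a bop" where "one_bop = bop_id"

lemma bop_times_apply: "(S * T) \<cdot> x = S \<cdot> T \<cdot> x" for S T :: "'a bop"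
  unfolding times_bop_def by transfer simp

lemma bop_one_apply [simp]: "(1 :: 'a bop) \<cdot> x = x"
  unfolding one_bop_def by transfer simp

lemma bop_apply_add: "T \<cdot> (x + y) = T \<cdot> x + T \<cdot> y"
  by transfer (simp add: blinfun.add_right)

lemma bop_apply_scaleR: "T \<cdot> (r *\<^sub>R x) = r *\<^sub>R (T \<cdot> x)"
  by transfer (simp add: blinfun.scaleR_right)

text \<open>The unit gets no norm axiom and is not separated from 0: on the zero space
  \<open>1 = 0\<close>.\<close>

instance
proof
  fix S T U :: "'a bop" and r :: real
  show "S * T * U = S * (T * U)" by (rule bop_eqI) (simp add: bop_times_apply)
  show "(S + T) * U = S * U + T * U" by (rule bop_eqI) (simp add: bop_times_apply plus_bop_apply)
  show "S * (T + U) = S * T + S * U"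
    by (rule bop_eqI) (simp add: bop_times_apply plus_bop_apply bop_apply_add)
  show "r *\<^sub>R S * T = r *\<^sub>R (S * T)" by (rule bop_eqI) (simp add: bop_times_apply scaleR_bop_apply)
  show "S * r *\<^sub>R T = r *\<^sub>R (S * T)"
    by (rule bop_eqI) (simp add: bop_times_apply scaleR_bop_apply bop_apply_scaleR)
  show "1 * S = S" by (rule bop_eqI) (simp add: bop_times_apply)
  show "S * 1 = S" by (rule bop_eqI) (simp add: bop_times_apply)
  show "norm (S * T) \<le> norm S * norm T"
    unfolding times_bop_def by transfer (rule norm_blinfun_compose)
qed

end

lemma bop_comp_eq_times: "S \<odot> T = S * T"
  by (simp add: times_bop_def)

lemma norm_bop_apply_le: "norm (T \<cdot> x) \<le> norm T * norm x"
  by transfer (rule norm_blinfun)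

lemma norm_bop_le:
  assumes "\<And>x. norm (T \<cdot> x) \<le> c * norm x" "0 \<le> c"
  shows "norm T \<le> c"
  unfolding norm_bop_eq_onorm using assms by (intro onorm_bound)

lemma bounded_linear_bop_apply: "bounded_linear (bop_apply T)"
  by transfer (rule blinfun.bounded_linear_right)

lemma bounded_linear_bop_eval: "bounded_linear (\<lambda>T. T \<cdot> x)"
  by (rule bounded_linear_intro[where K = "norm x"])
    (simp_all add: plus_bop_apply scaleR_bop_apply norm_bop_apply_le)

lemma bop_apply_scaleC: "T \<cdot> (c *\<^sub>C x) = c *\<^sub>C (T \<cdot> x)"
  by transfer (simp add: clinear_def)

lemmas bop_apply_diff = linear_diff[OF bounded_linear.linear[OF bounded_linear_bop_apply]]
lemmas bop_apply_minus = linear_neg[OF bounded_linear.linear[OF bounded_linear_bop_apply]]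
lemmas bop_apply_0 = linear_0[OF bounded_linear.linear[OF bounded_linear_bop_apply]]
lemmas bop_apply_sum = linear_sum[OF bounded_linear.linear[OF bounded_linear_bop_apply]]
lemmas minus_bop_apply = linear_diff[OF bounded_linear.linear[OF bounded_linear_bop_eval]]
lemmas uminus_bop_apply = linear_neg[OF bounded_linear.linear[OF bounded_linear_bop_eval]]
lemmas zero_bop_apply = linear_0[OF bounded_linear.linear[OF bounded_linear_bop_eval]]
lemmas sum_bop_apply = linear_sum[OF bounded_linear.linear[OF bounded_linear_bop_eval]]

lemmas bop_simps = bop_times_apply bop_apply_add bop_apply_diff bop_apply_minus bop_apply_0
  bop_apply_scaleC bop_apply_scaleR bop_apply_sum plus_bop_apply minus_bop_apply uminus_bop_apply
  zero_bop_apply sum_bop_apply scaleC_bop_apply scaleR_bop_apply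

lemma scaleC_zero_left [simp]: "0 *\<^sub>C x = (0::'a::complex_normed_vector)"
  using scaleC_of_real[of 0 x] by simp

lemma scaleC_zero_right [simp]: "c *\<^sub>C 0 = (0::'a::complex_normed_vector)"
  using scaleC_diff_right[of c 0 "0::'a"] by simp

lemma scaleC_diff_left: "(a - b) *\<^sub>C x = a *\<^sub>C x - b *\<^sub>C (x::'a::complex_normed_vector)"
  using scaleC_add_left[of "a - b" b x] by simp

lemma scaleC_minus_left: "(- c) *\<^sub>C x = - (c *\<^sub>C (x::'a::complex_normed_vector))"
  using scaleC_diff_left[of 0 c x] by simp

lemma times_scaleC_left: "(c *\<^sub>C S) * T = c *\<^sub>C (S * T)" for S T :: "'a::complex_normed_vector bop"
  by (rule bop_eqI) (simp add: bop_simps)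

lemma times_scaleC_right: "S * (c *\<^sub>C T) = c *\<^sub>C (S * T)" for S T :: "'a::complex_normed_vector bop"
  by (rule bop_eqI) (simp add: bop_simps)

lemma bounded_linear_scaleC: "bounded_linear (\<lambda>x::'a::complex_normed_vector. c *\<^sub>C x)"
  by (rule bounded_linear_intro[where K = "cmod c"])
    (simp_all add: scaleC_add_right norm_scaleC mult.commute,
     metis scaleC_of_real scaleC_scaleC mult.commute)

lemma bop_of_clinear:
  fixes f :: "'a::complex_normed_vector \<Rightarrow> 'a"
  assumes "clinear f" "\<And>x. norm (f x) \<le> K * norm x"
  shows "\<exists>T. bop_apply T = f"
proof -
  have "f (r *\<^sub>R x) = r *\<^sub>R f x" for r x
    using assms(1) unfolding clinear_def by (metis scaleC_of_real)
  then have "bounded_linear f"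
    using assms by (intro bounded_linear_intro[where K = K]) (auto simp: clinear_def mult.commute)
  then have "blinfun_apply (Blinfun f) = f" by (rule bounded_linear_Blinfun_apply)
  then have "bop_apply (Abs_bop (Blinfun f)) = f"
    using assms(1) by (simp add: bop_apply_def Abs_bop_inverse)
  then show ?thesis by blast
qed

section \<open>Hilbert space geometry\<close>

subclass (in chilbert_space) banach ..

text \<open>Complex linearity survives pointwise limits, so completeness carries over from the
  real-linear bounded operators. The absolute value of an operator is later built as such a
  limit.\<close>

instance bop :: (chilbert_space) banach
proof
  fix X :: "nat \<Rightarrow> 'a bop"
  assume X: "Cauchy X"
  have dist_bop_of: "dist (blinfun_of_bop S) (blinfun_of_bop T) = dist S T" for S T :: "'a bop"
    unfolding dist_norm by transfer simp
  have "Cauchy (\<lambda>n. blinfun_of_bop (X n))"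
    using X unfolding Cauchy_def dist_bop_of .
  then obtain L where L: "(\<lambda>n. blinfun_of_bop (X n)) \<longlonglongrightarrow> L"
    using Cauchy_convergent convergent_def by blast
  then have lim: "(\<lambda>n. X n \<cdot> x) \<longlonglongrightarrow> blinfun_apply L x" for x
    unfolding bop_apply.rep_eq by (intro tendsto_intros)
  have "clinear (blinfun_apply L)"
    unfolding clinear_def
  proof (intro conjI allI)
    fix x y c
    show "blinfun_apply L (x + y) = blinfun_apply L x + blinfun_apply L y"
      by (simp add: blinfun.add_right)
    have "(\<lambda>n. X n \<cdot> (c *\<^sub>C x)) \<longlonglongrightarrow> c *\<^sub>C blinfun_apply L x"
      unfolding bop_apply_scaleC by (intro bounded_linear.tendsto[OF bounded_linear_scaleC] lim)
    then show "blinfun_apply L (c *\<^sub>C x) = c *\<^sub>C blinfun_apply L x"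
      by (rule LIMSEQ_unique[OF lim])
  qed
  then have "blinfun_of_bop (Abs_bop L) = L" by (simp add: Abs_bop_inverse)
  then have "X \<longlonglongrightarrow> Abs_bop L"
    using L unfolding tendsto_iff by (simp flip: dist_bop_of)
  then show "convergent X" by (rule convergentI)
qed

lemma cinner_add_right: "cinner x (y + z) = cinner x y + cinner x (z::'h::chilbert_space)"
  by (subst (1 2 3) cinner_commute) (simp add: cinner_add_left)

lemma cinner_scaleC_right: "cinner x (c *\<^sub>C y) = cnj c * cinner x (y::'h::chilbert_space)"
  by (subst (1 2) cinner_commute) (simp add: cinner_scaleC_left)

lemma cinner_scaleR_left: "cinner (r *\<^sub>R x) y = of_real r * cinner x (y::'h::chilbert_space)"
  by (simp flip: scaleC_of_real add: cinner_scaleC_left)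

lemma cinner_scaleR_right: "cinner x (r *\<^sub>R y) = of_real r * cinner x (y::'h::chilbert_space)"
  by (simp flip: scaleC_of_real add: cinner_scaleC_right)

lemma cinner_self: "cinner x x = of_real ((norm x)\<^sup>2)" for x :: "'h::chilbert_space"
proof (rule complex_eqI)
  have "0 \<le> sqrt (Re (cinner x x))" using norm_eq_sqrt_cinner[of x] by (metis norm_ge_zero)
  then show "Re (cinner x x) = Re (of_real ((norm x)\<^sup>2))"
    using norm_eq_sqrt_cinner[of x] by simp
  show "Im (cinner x x) = Im (of_real ((norm x)\<^sup>2))"
    using arg_cong[OF cinner_commute[of x x], of Im] by simp
qed

lemma linear_cinner_left: "linear (\<lambda>x. cinner x (y::'h::chilbert_space))"
  by (rule linearI) (simp_all add: cinner_add_left cinner_scaleR_left scaleR_conv_of_real)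

lemma linear_cinner_right: "linear (\<lambda>y. cinner x (y::'h::chilbert_space))"
  by (rule linearI) (simp_all add: cinner_add_right cinner_scaleR_right scaleR_conv_of_real)

lemmas cinner_diff_left = linear_diff[OF linear_cinner_left]
lemmas cinner_minus_left = linear_neg[OF linear_cinner_left]
lemmas cinner_zero_left = linear_0[OF linear_cinner_left]
lemmas cinner_diff_right = linear_diff[OF linear_cinner_right]
lemmas cinner_minus_right = linear_neg[OF linear_cinner_right]
lemmas cinner_zero_right = linear_0[OF linear_cinner_right]
lemmas cinner_sum_right = linear_sum[OF linear_cinner_right]

lemmas cinner_simps = cinner_add_left cinner_add_right cinner_scaleC_left cinner_scaleC_right
  cinner_diff_left cinner_diff_right cinner_minus_left cinner_minus_right cinner_zero_left cinner_zero_right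

lemma Re_cinner_self: "Re (cinner x x) = (norm (x::'h::chilbert_space))\<^sup>2"
  unfolding cinner_self Re_complex_of_real ..

lemma Re_cinner_commute: "Re (cinner x y) = Re (cinner y (x::'h::chilbert_space))"
  by (subst cinner_commute) simp

lemma norm_add_sq: "(norm (x + y))\<^sup>2 = (norm x)\<^sup>2 + 2 * Re (cinner x y) + (norm (y::'h::chilbert_space))\<^sup>2"
proof -
  have "(norm (x + y))\<^sup>2 = Re (cinner (x + y) (x + y))" by (simp only: cinner_self Re_complex_of_real)
  then show ?thesis
    by (simp add: cinner_add_left cinner_add_right Re_cinner_self Re_cinner_commute[of y x])
qed

lemma norm_diff_sq: "(norm (x - y))\<^sup>2 = (norm x)\<^sup>2 - 2 * Re (cinner x y) + (norm (y::'h::chilbert_space))\<^sup>2"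
  using norm_add_sq[of x "- y"] by (simp add: cinner_minus_right)

lemma parallelogram: "(norm (x + y))\<^sup>2 + (norm (x - y))\<^sup>2 = 2 * (norm x)\<^sup>2 + 2 * (norm (y::'h::chilbert_space))\<^sup>2"
  by (simp add: norm_add_sq norm_diff_sq)

lemma norm_add_orth: "cinner x y = 0 \<Longrightarrow> (norm (x + y))\<^sup>2 = (norm x)\<^sup>2 + (norm (y::'h::chilbert_space))\<^sup>2"
  by (simp add: norm_add_sq)

lemma Re_cinner_le: "Re (cinner x y) \<le> norm x * norm (y::'h::chilbert_space)"
proof -
  have "0 \<le> (norm (norm y *\<^sub>R x - norm x *\<^sub>R y))\<^sup>2" by (rule zero_le_power2)
  then have *: "2 * (norm x * norm y) * Re (cinner x y) \<le> 2 * (norm x * norm y) * (norm x * norm y)"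
    unfolding norm_diff_sq cinner_scaleR_left cinner_scaleR_right
    by (simp add: power2_eq_square algebra_simps)
  show ?thesis
  proof (cases "norm x * norm y = 0")
    case True
    then have "x = 0 \<or> y = 0" by simp
    then show ?thesis by (auto simp: cinner_simps)
  next
    case False
    then have "0 < 2 * (norm x * norm y)" by simp
    from mult_left_le_imp_le[OF * this] show ?thesis .
  qed
qed

lemma cauchy_schwarz: "cmod (cinner x y) \<le> norm x * norm (y::'h::chilbert_space)"
proof -
  obtain c where c: "cmod c = 1" "c * cinner x y = of_real (cmod (cinner x y))"
  proof (cases "cinner x y = 0")
    case True
    then show ?thesis using that[of 1] by simp
  next
    case False
    show ?thesis
    proof (rule that)
      show "cmod (cnj (sgn (cinner x y))) = 1" using False by (simp add: norm_sgn)
      show "cnj (sgn (cinner x y)) * cinner x y = of_real (cmod (cinner x y))"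
        using complex_norm_square[of "cinner x y"] False
        by (simp add: sgn_eq field_simps power2_eq_square)
    qed
  qed
  have "cmod (cinner x y) = Re (cinner (c *\<^sub>C x) y)"
    by (simp add: cinner_scaleC_left c)
  also have "\<dots> \<le> norm (c *\<^sub>C x) * norm y" by (rule Re_cinner_le)
  finally show ?thesis by (simp add: norm_scaleC c)
qed

lemma bounded_linear_cinner_left: "bounded_linear (\<lambda>x. cinner x (y::'h::chilbert_space))"
  by (rule bounded_linear_intro[where K = "norm y"])
    (simp_all add: cinner_add_left linear_scale[OF linear_cinner_left] cauchy_schwarz)

lemma bounded_linear_cinner_right: "bounded_linear (\<lambda>y. cinner (x::'h::chilbert_space) y)"
  by (rule bounded_linear_intro[where K = "norm x"])
    (simp_all add: cinner_add_right linear_scale[OF linear_cinner_right] cauchy_schwarz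
      mult.commute[of _ "norm x"])

lemma norm_le_of_cinner:
  fixes x :: "'h::chilbert_space"
  assumes "\<And>y. cmod (cinner x y) \<le> c * norm y" "0 \<le> c"
  shows "norm x \<le> c"
proof (cases "x = 0")
  case True
  then show ?thesis using assms(2) by simp
next
  case False
  have "norm x * norm x \<le> c * norm x"
    using assms(1)[of x] by (simp add: cinner_self power2_eq_square norm_mult)
  then show ?thesis using False by simp
qed

lemma eq_of_cinner:
  fixes x :: "'h::chilbert_space"
  assumes "\<And>z. cinner x z = cinner y z"
  shows "x = y"
proof -
  have "(norm (x - y))\<^sup>2 = 0"
    using assms[of "x - y"] unfolding Re_cinner_self[symmetric] cinner_diff_left by simp
  then show ?thesis by simp
qed

text \<open>A minimizing sequence is Cauchy by the parallelogram law, since the midpoint of two of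
  its members stays in \<open>K\<close> and its squared distance to \<open>x\<close> is at least the
  infimum \<open>d\<close>.\<close>

lemma nearest_point:
  fixes K :: "'h::chilbert_space set"
  assumes "csubspace K" "closed K"
  obtains k where "k \<in> K" "\<And>z. z \<in> K \<Longrightarrow> norm (x - k) \<le> norm (x - z)"
proof -
  have ne: "K \<noteq> {}" and add: "\<And>y z. y \<in> K \<Longrightarrow> z \<in> K \<Longrightarrow> y + z \<in> K"
    and scale: "\<And>c y. y \<in> K \<Longrightarrow> c *\<^sub>C y \<in> K"
    using assms by (auto simp: csubspace_def)
  define d where "d = Inf ((\<lambda>z. (norm (x - z))\<^sup>2) ` K)"
  have bdd: "bdd_below ((\<lambda>z. (norm (x - z))\<^sup>2) ` K)" by (rule bdd_belowI[of _ 0]) auto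
  have d: "d \<le> (norm (x - z))\<^sup>2" if "z \<in> K" for z
    unfolding d_def using that bdd by (intro cInf_lower) auto
  have "\<exists>z\<in>K. (norm (x - z))\<^sup>2 < d + e" if "0 < e" for e
    using cInf_lessD[of "(\<lambda>z. (norm (x - z))\<^sup>2) ` K" "d + e"] ne that unfolding d_def by auto
  then have "\<exists>z\<in>K. (norm (x - z))\<^sup>2 < d + inverse (real (Suc n))" for n by simp
  then obtain k where k: "\<And>n. k n \<in> K" "\<And>n. (norm (x - k n))\<^sup>2 < d + inverse (real (Suc n))" by metis
  have diff: "(norm (k n - k m))\<^sup>2 \<le> 2 * inverse (real (Suc n)) + 2 * inverse (real (Suc m))" for n m
  proof -
    have "(1/2) *\<^sub>R (k n + k m) \<in> K"
      using scale[OF add[OF k(1) k(1)], of "complex_of_real (1/2)" n m] by (simp only: scaleC_of_real)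
    from d[OF this] have "4 * d \<le> (norm (2 *\<^sub>R (x - (1/2) *\<^sub>R (k n + k m))))\<^sup>2"
      by (simp only: norm_scaleR power_mult_distrib) simp
    also have "2 *\<^sub>R (x - (1/2) *\<^sub>R (k n + k m)) = (x - k n) + (x - k m)"
      by (simp add: algebra_simps scaleR_2)
    finally show ?thesis
      using parallelogram[of "x - k n" "x - k m"] k(2)[of n] k(2)[of m]
      by (simp add: norm_minus_commute)
  qed
  have "Cauchy k"
  proof (rule CauchyI)
    fix e :: real assume "0 < e"
    then obtain N where N: "inverse (real (Suc N)) < e\<^sup>2 / 4"
      using reals_Archimedean[of "e\<^sup>2 / 4"] by auto
    show "\<exists>M. \<forall>m\<ge>M. \<forall>n\<ge>M. norm (k m - k n) < e"
    proof (intro exI allI impI)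
      fix m n assume "N \<le> m" "N \<le> n"
      then have "inverse (real (Suc m)) \<le> inverse (real (Suc N))" "inverse (real (Suc n)) \<le> inverse (real (Suc N))"
        by (auto simp: field_simps)
      then have "(norm (k m - k n))\<^sup>2 < e\<^sup>2" using diff[of m n] N by linarith
      then show "norm (k m - k n) < e" using \<open>0 < e\<close> by (simp add: power2_less_imp_less)
    qed
  qed
  then obtain l where l: "k \<longlonglongrightarrow> l" using Cauchy_convergent convergent_def by blast
  have lK: "l \<in> K" using closed_sequentially[OF assms(2) _ l] k(1) by blast
  have "(\<lambda>n. (norm (x - k n))\<^sup>2) \<longlonglongrightarrow> (norm (x - l))\<^sup>2" by (intro tendsto_intros l)
  moreover have "(\<lambda>n. d + inverse (real (Suc n))) \<longlonglongrightarrow> d + 0"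
    by (intro tendsto_intros LIMSEQ_inverse_real_of_nat)
  ultimately have "(norm (x - l))\<^sup>2 \<le> d + 0"
    by (rule LIMSEQ_le) (use k(2) less_imp_le in blast)
  then have "norm (x - l) \<le> norm (x - z)" if "z \<in> K" for z
    using d[OF that] by (simp add: power2_le_imp_le)
  then show ?thesis using that lK by blast
qed

lemma scaleC_minus_one: "(- 1) *\<^sub>C x = - (x::'a::complex_normed_vector)"
  using scaleC_of_real[of "- 1" x] by simp

lemma csubspace_diff: "csubspace K \<Longrightarrow> x \<in> K \<Longrightarrow> y \<in> K \<Longrightarrow> x - y \<in> K"
  unfolding csubspace_def diff_conv_add_uminus[of x y]
  using scaleC_minus_one[of y] by metis

lemma nearest_point_orth:
  fixes K :: "'h::chilbert_space set"
  assumes K: "csubspace K" and k: "k \<in> K" "\<And>z. z \<in> K \<Longrightarrow> norm (x - k) \<le> norm (x - z)" and z: "z \<in> K"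
  shows "cinner (x - k) z = 0"
proof -
  define c where "c = cinner (x - k) z"
  have le: "0 \<le> - 2 * t * (cmod c)\<^sup>2 + t\<^sup>2 * (cmod c)\<^sup>2 * (norm z)\<^sup>2" for t
  proof -
    have "k + (of_real t * c) *\<^sub>C z \<in> K" using K k z by (simp add: csubspace_def)
    from k(2)[OF this] have "(norm (x - k))\<^sup>2 \<le> (norm ((x - k) - (of_real t * c) *\<^sub>C z))\<^sup>2"
      by (simp add: diff_diff_eq)
    also have "\<dots> = (norm (x - k))\<^sup>2 - 2 * t * (cmod c)\<^sup>2 + t\<^sup>2 * (cmod c)\<^sup>2 * (norm z)\<^sup>2"
    proof -
      have "cinner (x - k) ((of_real t * c) *\<^sub>C z) = of_real (t * (cmod c)\<^sup>2)"
        unfolding cinner_scaleC_right c_def[symmetric]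
        using complex_norm_square[of c] by (simp add: mult_ac)
      then show ?thesis by (simp add: norm_diff_sq norm_scaleC norm_mult power_mult_distrib)
    qed
    finally show ?thesis by simp
  qed
  have "(cmod c)\<^sup>2 = 0"
  proof (rule ccontr)
    assume "(cmod c)\<^sup>2 \<noteq> 0"
    then have pos: "0 < (cmod c)\<^sup>2" by simp
    \<comment> \<open>Any small positive \<open>t\<close> would do; this one gives
      \<open>t * (norm z)\<^sup>2 \<le> 1\<close>, so that the linear term of the variation beats
      the quadratic one.\<close>
    define t where "t = 1 / (1 + (norm z)\<^sup>2)"
    have t: "0 < t" "t * (norm z)\<^sup>2 \<le> 1" unfolding t_def by (auto simp: field_simps add_pos_nonneg)
    have "0 \<le> (cmod c)\<^sup>2 * (t * (t * (norm z)\<^sup>2 - 2))"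
      using le[of t] by (simp add: algebra_simps power2_eq_square)
    moreover have "t * (t * (norm z)\<^sup>2 - 2) < 0" using t by (simp add: mult_pos_neg)
    ultimately show False using mult_pos_neg[OF pos] by force
  qed
  then show ?thesis by (simp add: c_def)
qed

definition orth_proj :: "'h::chilbert_space bop \<Rightarrow> bool" where
  "orth_proj P \<longleftrightarrow> P * P = P \<and> is_adjoint P P"

lemma orth_proj_exists:
  fixes K :: "'h::chilbert_space set"
  assumes K: "csubspace K" "closed K"
  obtains P where "orth_proj P" "\<And>x. P \<cdot> x \<in> K" "\<And>x. x \<in> K \<Longrightarrow> P \<cdot> x = x"
proof -
  have "\<exists>k. k \<in> K \<and> (\<forall>z\<in>K. cinner (x - k) z = 0)" for x
    by (rule nearest_point[OF K, of x]) (metis nearest_point_orth[OF K(1)])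
  then obtain f where f: "\<And>x. f x \<in> K" "\<And>x z. z \<in> K \<Longrightarrow> cinner (x - f x) z = 0" by metis
  \<comment> \<open>Uniqueness of the foot of the perpendicular yields both the linearity of
    \<open>f\<close> and \<open>f x = x\<close> on \<open>K\<close>.\<close>
  have uniq: "f x = k" if "k \<in> K" "\<And>z. z \<in> K \<Longrightarrow> cinner (x - k) z = 0" for x k
  proof -
    have "f x - k \<in> K" by (rule csubspace_diff[OF K(1) f(1) that(1)])
    then have "cinner (f x - k) (f x - k) = 0"
      using f(2)[of "f x - k" x] that(2)[of "f x - k"] by (simp add: cinner_diff_left)
    then show ?thesis by (simp add: cinner_self)
  qed
  have "clinear f"
    unfolding clinear_def
  proof (intro conjI allI)
    fix x y c
    show "f (x + y) = f x + f y"
    proof (rule uniq)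
      show "f x + f y \<in> K" using K(1) f(1) by (simp add: csubspace_def)
      show "cinner (x + y - (f x + f y)) z = 0" if "z \<in> K" for z
        using f(2)[OF that, of x] f(2)[OF that, of y] by (simp add: cinner_simps)
    qed
    show "f (c *\<^sub>C x) = c *\<^sub>C f x"
    proof (rule uniq)
      show "c *\<^sub>C f x \<in> K" using K(1) f(1) by (simp add: csubspace_def)
      show "cinner (c *\<^sub>C x - c *\<^sub>C f x) z = 0" if "z \<in> K" for z
        using f(2)[OF that, of x] by (simp add: cinner_simps)
    qed
  qed
  moreover have "norm (f x) \<le> 1 * norm x" for x
  proof -
    have "(norm x)\<^sup>2 = (norm (x - f x))\<^sup>2 + (norm (f x))\<^sup>2"
      using norm_add_orth[OF f(2)[OF f(1), of x x]] by simp
    then show ?thesis by (simp add: power2_le_imp_le)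
  qed
  ultimately obtain P where P: "bop_apply P = f" using bop_of_clinear by blast
  have id: "f x = x" if "x \<in> K" for x by (rule uniq) (simp_all add: that cinner_simps)
  show ?thesis
  proof (rule that)
    have "P * P = P" by (rule bop_eqI) (simp add: bop_times_apply P id f(1))
    moreover have "is_adjoint P P"
      unfolding is_adjoint_def P
    proof (intro allI)
      fix x y
      have "cinner (f x) (y - f y) = 0" using f(2)[OF f(1)] cinner_commute by (metis complex_cnj_zero)
      then show "cinner (f x) y = cinner x (f y)"
        using f(2)[OF f(1), of x y] by (simp add: cinner_simps)
    qed
    ultimately show "orth_proj P" by (simp add: orth_proj_def)
  qed (simp_all add: P f id)
qed

section \<open>Adjoints, projections and the absolute value\<close>

lemma is_adjointD: "is_adjoint S T \<Longrightarrow> cinner (T \<cdot> x) y = cinner x (S \<cdot> y)"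
  by (simp add: is_adjoint_def)

lemma is_adjoint_sym: "is_adjoint S T \<Longrightarrow> is_adjoint T S"
  unfolding is_adjoint_def by (metis cinner_commute)

lemma is_adjoint_add: "is_adjoint S T \<Longrightarrow> is_adjoint S' T' \<Longrightarrow> is_adjoint (S + S') (T + T')"
  by (simp add: is_adjoint_def bop_simps cinner_simps)

lemma is_adjoint_diff: "is_adjoint S T \<Longrightarrow> is_adjoint S' T' \<Longrightarrow> is_adjoint (S - S') (T - T')"
  by (simp add: is_adjoint_def bop_simps cinner_simps)

lemma is_adjoint_scaleC: "is_adjoint S T \<Longrightarrow> is_adjoint (cnj c *\<^sub>C S) (c *\<^sub>C T)"
  by (simp add: is_adjoint_def bop_simps cinner_simps)

lemma is_adjoint_scaleR: "is_adjoint S T \<Longrightarrow> is_adjoint (r *\<^sub>R S) (r *\<^sub>R T)"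
  by (simp add: is_adjoint_def bop_simps cinner_scaleR_left cinner_scaleR_right)

lemma is_adjoint_times: "is_adjoint S T \<Longrightarrow> is_adjoint S' T' \<Longrightarrow> is_adjoint (S' * S) (T * T')"
  by (simp add: is_adjoint_def bop_simps)

lemma is_adjoint_0: "is_adjoint 0 0"
  by (simp add: is_adjoint_def bop_simps cinner_simps)

lemma is_adjoint_1: "is_adjoint 1 1"
  by (simp add: is_adjoint_def)

text \<open>The absolute value is \<open>1 - Z\<close>, where \<open>Z\<close> is the limit of the iteration
  \<open>Y (n + 1) = (A + Y n\<^sup>2) / 2\<close> for \<open>A = 1 - S\<^sup>2\<close>; its increments are dominated by those of the
  scalar iteration with \<open>A = 1\<close>.\<close>

lemma operator_abs_exists:
  fixes S :: "'h::chilbert_space bop"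
  assumes S: "is_adjoint S S" "norm S \<le> 1"
  obtains G where "is_adjoint G G" "G * G = S * S" "\<And>C. C * S = S * C \<Longrightarrow> C * G = G * C"
    "\<And>x. 0 \<le> Re (cinner (G \<cdot> x) x)"
proof -
  define A where "A = 1 - S * S"
  have A: "norm A \<le> 1"
  proof (rule norm_bop_le)
    fix x
    have "norm (S \<cdot> S \<cdot> x) \<le> norm (S \<cdot> x)"
      using order_trans[OF norm_bop_apply_le mult_right_mono[OF S(2) norm_ge_zero]] by simp
    then have "(norm (S \<cdot> S \<cdot> x))\<^sup>2 \<le> (norm (S \<cdot> x))\<^sup>2" by (simp add: power_mono)
    moreover have "Re (cinner x (S \<cdot> S \<cdot> x)) = (norm (S \<cdot> x))\<^sup>2"
      unfolding is_adjointD[OF S(1), of x "S \<cdot> x", symmetric] by (rule Re_cinner_self)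
    moreover have "(norm (A \<cdot> x))\<^sup>2
        = (norm x)\<^sup>2 - 2 * Re (cinner x (S \<cdot> S \<cdot> x)) + (norm (S \<cdot> S \<cdot> x))\<^sup>2"
      unfolding A_def minus_bop_apply bop_one_apply bop_times_apply by (rule norm_diff_sq)
    ultimately have "(norm (A \<cdot> x))\<^sup>2 \<le> (norm x)\<^sup>2"
      using zero_le_power2[of "norm (S \<cdot> x)"] by linarith
    then have "norm (A \<cdot> x) \<le> norm x" by (rule power2_le_imp_le) simp
    then show "norm (A \<cdot> x) \<le> 1 * norm x" by simp
  qed simp
  define y where "y = rec_nat 0 (\<lambda>_ t::real. (1 + t\<^sup>2) / 2)"
  define Y where "Y = rec_nat 0 (\<lambda>_ Z. (1 / 2) *\<^sub>R (A + Z * Z))"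
  have y: "y 0 = 0" "\<And>n. y (Suc n) = (1 + (y n)\<^sup>2) / 2" by (simp_all add: y_def)
  have Y: "Y 0 = 0" "\<And>n. Y (Suc n) = (1 / 2) *\<^sub>R (A + Y n * Y n)" by (simp_all add: Y_def)
  have y01: "0 \<le> y n \<and> y n \<le> 1" for n
    by (induction n) (auto simp: y power_le_one)
  have comm: "C * A = A * C \<Longrightarrow> C * Y n = Y n * C" for C n
    by (induction n) (simp_all add: Y distrib_left distrib_right, metis mult.assoc)
  have YY: "Y n * Y m = Y m * Y n" for n m using comm by metis
  have Yle: "norm (Y n) \<le> y n" for n
  proof (induction n)
    case (Suc n)
    have "norm (Y n * Y n) \<le> y n * y n"
      by (rule order_trans[OF norm_mult_ineq]) (use Suc y01[of n] in \<open>intro mult_mono, auto\<close>)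
    then have "norm (A + Y n * Y n) \<le> 1 + y n * y n"
      using norm_triangle_ineq[of A "Y n * Y n"] A by linarith
    then show ?case by (simp add: Y y power2_eq_square)
  qed (simp add: Y y)
  have step: "norm (Y (Suc n) - Y n) \<le> y (Suc n) - y n" for n
  proof (induction n)
    case 0
    then show ?case using A by (simp add: Y y)
  next
    case (Suc n)
    have "Y (Suc (Suc n)) - Y (Suc n) = (1/2) *\<^sub>R (Y (Suc n) * Y (Suc n) - Y n * Y n)"
      by (subst (1 2) Y(2)) (simp add: scaleR_diff_right[symmetric])
    \<comment> \<open>The iterates are polynomials in \<open>A\<close> and commute, so the
      difference of squares factors as it does for numbers.\<close>
    also have "Y (Suc n) * Y (Suc n) - Y n * Y n = (Y (Suc n) + Y n) * (Y (Suc n) - Y n)"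
      using YY[of n "Suc n"] by (simp add: algebra_simps)
    finally have "norm (Y (Suc (Suc n)) - Y (Suc n)) \<le> (1/2) * (norm (Y (Suc n) + Y n) * norm (Y (Suc n) - Y n))"
      using norm_mult_ineq[of "Y (Suc n) + Y n" "Y (Suc n) - Y n"] by simp
    also have "\<dots> \<le> (1/2) * ((y (Suc n) + y n) * (y (Suc n) - y n))"
      using Suc Yle[of n] Yle[of "Suc n"] norm_triangle_ineq[of "Y (Suc n)" "Y n"] y01[of n] y01[of "Suc n"]
      by (intro mult_left_mono mult_mono) auto
    also have "\<dots> = y (Suc (Suc n)) - y (Suc n)"
    proof -
      have "y (Suc (Suc n)) - y (Suc n) = (1 + (y (Suc n))\<^sup>2) / 2 - (1 + (y n)\<^sup>2) / 2"
        using y(2)[of "Suc n"] y(2)[of n] by linarith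
      also have "\<dots> = (1/2) * ((y (Suc n) + y n) * (y (Suc n) - y n))"
        by (simp add: power2_eq_square field_simps)
      finally show ?thesis by simp
    qed
    finally show ?case .
  qed
  have le: "norm (Y (n + k) - Y n) \<le> y (n + k) - y n" for n k
  proof (induction k)
    case (Suc k)
    then show ?case
      using step[of "n + k"] norm_triangle_ineq[of "Y (Suc (n + k)) - Y (n + k)" "Y (n + k) - Y n"] by simp
  qed simp
  have "y n \<le> y (Suc n)" for n using order_trans[OF norm_ge_zero step[of n]] by simp
  then have "incseq y" by (rule incseq_SucI)
  then have "Cauchy y"
    using y01 incseq_convergent[of y 1] LIMSEQ_imp_Cauchy by metis
  have "Cauchy Y"
  proof (rule CauchyI')
    fix e :: real assume "0 < e"
    then obtain M where M: "\<And>m n. M \<le> m \<Longrightarrow> M \<le> n \<Longrightarrow> norm (y m - y n) < e"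
      using CauchyD[OF \<open>Cauchy y\<close>] by blast
    have "dist (Y m) (Y n) < e" if "M \<le> m" "m < n" for m n
      using le[of m "n - m"] M[of n m] that by (simp add: dist_norm norm_minus_commute)
    then show "\<exists>M. \<forall>m\<ge>M. \<forall>n>m. dist (Y m) (Y n) < e" by blast
  qed
  then obtain Z where Z: "Y \<longlonglongrightarrow> Z" using Cauchy_convergent convergent_def by blast
  have "(\<lambda>n. Y (Suc n)) \<longlonglongrightarrow> (1/2) *\<^sub>R (A + Z * Z)"
    unfolding Y(2) by (intro tendsto_intros Z)
  then have "Z = (1/2) *\<^sub>R (A + Z * Z)" using LIMSEQ_unique LIMSEQ_Suc[OF Z] by blast
  then have "2 *\<^sub>R Z = A + Z * Z" by (metis scaleR_scaleR scaleR_one field_sum_of_halves mult_2 nonzero_mult_div_cancel_left times_divide_eq_right mult.commute zero_neq_numeral mult_1)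
  \<comment> \<open>As \<open>A = 1 - S * S\<close>, the fixed point equation reads
    \<open>1 - 2 Z + Z * Z = S * S\<close>. The root \<open>1 - Z\<close> is nonnegative because
    \<open>norm Z \<le> 1\<close>.\<close>
  then have sq: "(1 - Z) * (1 - Z) = S * S" by (simp add: A_def algebra_simps scaleR_2)
  have ZC: "C * Z = Z * C" if "C * S = S * C" for C
  proof -
    have "C * A = A * C" using that by (simp add: A_def algebra_simps) (metis mult.assoc)
    have "(\<lambda>n. Y n * C) \<longlonglongrightarrow> Z * C" by (intro tendsto_intros Z)
    then have "(\<lambda>n. C * Y n) \<longlonglongrightarrow> Z * C" by (simp only: comm[OF \<open>C * A = A * C\<close>])
    moreover have "(\<lambda>n. C * Y n) \<longlonglongrightarrow> C * Z" by (intro tendsto_intros Z)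
    ultimately show ?thesis using LIMSEQ_unique by blast
  qed
  have "norm Z \<le> 1"
    using LIMSEQ_le_const2[OF tendsto_norm[OF Z]] Yle y01 order_trans by metis
  have "is_adjoint A A"
    unfolding A_def by (intro is_adjoint_diff is_adjoint_1 is_adjoint_times S)
  then have "is_adjoint (Y n) (Y n)" for n
    by (induction n) (simp_all add: Y is_adjoint_0 is_adjoint_add is_adjoint_scaleR is_adjoint_times)
  then have adjZ: "is_adjoint Z Z"
    unfolding is_adjoint_def
  proof (intro allI)
    fix u v
    have lim: "(\<lambda>n. Y n \<cdot> w) \<longlonglongrightarrow> Z \<cdot> w" for w
      by (rule bounded_linear.tendsto[OF bounded_linear_bop_eval Z])
    assume *: "\<And>n. \<forall>x y. cinner (Y n \<cdot> x) y = cinner x (Y n \<cdot> y)"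
    have "(\<lambda>n. cinner (Y n \<cdot> u) v) \<longlonglongrightarrow> cinner u (Z \<cdot> v)"
      unfolding *[rule_format] by (rule bounded_linear.tendsto[OF bounded_linear_cinner_right lim])
    moreover have "(\<lambda>n. cinner (Y n \<cdot> u) v) \<longlonglongrightarrow> cinner (Z \<cdot> u) v"
      by (rule bounded_linear.tendsto[OF bounded_linear_cinner_left lim])
    ultimately show "cinner (Z \<cdot> u) v = cinner u (Z \<cdot> v)" using LIMSEQ_unique by blast
  qed
  show ?thesis
  proof (rule that)
    show "is_adjoint (1 - Z) (1 - Z)" by (intro is_adjoint_diff is_adjoint_1 adjZ)
    show "(1 - Z) * (1 - Z) = S * S" by (rule sq)
    show "C * (1 - Z) = (1 - Z) * C" if "C * S = S * C" for C
      using ZC[OF that] by (simp add: algebra_simps)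
    show "0 \<le> Re (cinner ((1 - Z) \<cdot> x) x)" for x
    proof -
      have "Re (cinner (Z \<cdot> x) x) \<le> norm (Z \<cdot> x) * norm x" by (rule Re_cinner_le)
      also have "\<dots> \<le> norm x * norm x"
        using order_trans[OF norm_bop_apply_le mult_right_mono[OF \<open>norm Z \<le> 1\<close> norm_ge_zero]]
        by (intro mult_right_mono) auto
      finally show ?thesis by (simp add: bop_simps cinner_simps Re_cinner_self power2_eq_square)
    qed
  qed
qed

lemma orth_proj_apply [simp]: "orth_proj P \<Longrightarrow> P \<cdot> P \<cdot> x = P \<cdot> x"
  unfolding orth_proj_def by (metis bop_times_apply)

lemma orth_projD: "orth_proj P \<Longrightarrow> cinner (P \<cdot> x) y = cinner x (P \<cdot> y)"
  by (simp add: orth_proj_def is_adjoint_def)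

lemma orth_proj_pythagoras:
  assumes "orth_proj P"
  shows "(norm x)\<^sup>2 = (norm (P \<cdot> x))\<^sup>2 + (norm (x - P \<cdot> x))\<^sup>2"
proof -
  have "cinner (P \<cdot> x) (x - P \<cdot> x) = 0"
    by (simp add: orth_projD[OF assms] bop_simps assms cinner_simps)
  from norm_add_orth[OF this] show ?thesis by simp
qed

lemma orth_proj_norm_le: "orth_proj P \<Longrightarrow> norm (P \<cdot> x) \<le> norm x"
  by (rule power2_le_imp_le) (simp_all add: orth_proj_pythagoras[of P x])

lemma orth_proj_1: "orth_proj 1"
  by (simp add: orth_proj_def is_adjoint_1)

lemma orth_proj_0: "orth_proj 0"
  by (simp add: orth_proj_def is_adjoint_0)

lemma orth_proj_compl: "orth_proj P \<Longrightarrow> orth_proj (1 - P)"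
  by (auto simp: orth_proj_def algebra_simps intro!: is_adjoint_diff is_adjoint_1)

lemma orth_proj_times: "orth_proj P \<Longrightarrow> orth_proj Q \<Longrightarrow> P * Q = Q * P \<Longrightarrow> orth_proj (P * Q)"
  unfolding orth_proj_def by (metis is_adjoint_times mult.assoc)

lemma norm_sum_orth:
  fixes f :: "'a \<Rightarrow> 'h::chilbert_space"
  assumes "finite I" "\<And>i j. i \<in> I \<Longrightarrow> j \<in> I \<Longrightarrow> i \<noteq> j \<Longrightarrow> cinner (f i) (f j) = 0"
  shows "(norm (\<Sum>i\<in>I. f i))\<^sup>2 = (\<Sum>i\<in>I. (norm (f i))\<^sup>2)"
  using assms
proof (induction I rule: finite_induct)
  case (insert i I)
  have "cinner (f i) (\<Sum>j\<in>I. f j) = 0"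
    unfolding cinner_sum_right using insert by (intro sum.neutral) auto
  then show ?case using insert by (simp add: norm_add_orth)
qed simp

section \<open>Projections in a masa\<close>

locale masa_algebra =
  fixes D :: "'h::chilbert_space bop set"
  assumes masa: "masa D"
begin

lemma abelian: "abelian_selfadjoint_algebra D"
  using masa by (simp add: masa_def)

lemma D_csubspace: "csubspace D"
  using abelian by (simp add: abelian_selfadjoint_algebra_def)

lemma D_0: "0 \<in> D"
  and D_add: "S \<in> D \<Longrightarrow> T \<in> D \<Longrightarrow> S + T \<in> D"
  and D_scaleC: "S \<in> D \<Longrightarrow> c *\<^sub>C S \<in> D"
  using D_csubspace by (auto simp: csubspace_def)

lemma D_diff: "S \<in> D \<Longrightarrow> T \<in> D \<Longrightarrow> S - T \<in> D"
  by (rule csubspace_diff[OF D_csubspace])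

lemma D_times: "S \<in> D \<Longrightarrow> T \<in> D \<Longrightarrow> S * T \<in> D"
  and D_commute: "S \<in> D \<Longrightarrow> T \<in> D \<Longrightarrow> S * T = T * S"
  and D_adjoint: "T \<in> D \<Longrightarrow> \<exists>S\<in>D. is_adjoint S T"
  using abelian by (auto simp: abelian_selfadjoint_algebra_def bop_comp_eq_times)

lemma D_sum: "(\<And>i. i \<in> I \<Longrightarrow> f i \<in> D) \<Longrightarrow> sum f I \<in> D"
  by (induction I rule: infinite_finite_induct) (auto simp: D_0 D_add)

text \<open>Maximality: the algebra generated by \<open>D\<close> and \<open>P\<close> is still
  abelian and selfadjoint, hence equal to \<open>D\<close>. Its elements have a separate term
  \<open>c *\<^sub>C P\<close> because \<open>D\<close> is not yet known to contain the identity, so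
  that \<open>P\<close> might not be of the form \<open>P * T\<close>. Applied to
  \<open>P = 1\<close>, the lemma provides the identity.\<close>

lemma orth_proj_in_D:
  assumes P: "orth_proj P" and comm: "\<And>T. T \<in> D \<Longrightarrow> P * T = T * P"
  shows "P \<in> D"
proof -
  define A where "A = {S + c *\<^sub>C P + P * T | S c T. S \<in> D \<and> T \<in> D}"
  have AI: "S + c *\<^sub>C P + P * T \<in> A" if "S \<in> D" "T \<in> D" for S c T
    unfolding A_def using that by blast
  have PP: "P * P = P" using P by (simp add: orth_proj_def)
  have PPx: "P * (P * x) = P * x" for x by (metis PP mult.assoc)
  have TP: "T * (P * x) = P * (T * x)" if "T \<in> D" for T x by (metis comm[OF that] mult.assoc)
  have prod: "(S + c *\<^sub>C P + P * T) * (S' + c' *\<^sub>C P + P * T') =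
      S * S' + (c * c') *\<^sub>C P + P * (c *\<^sub>C S' + c *\<^sub>C T' + c' *\<^sub>C S + c' *\<^sub>C T + S * T' + T * S' + T * T')"
    if "S \<in> D" "T \<in> D" "S' \<in> D" "T' \<in> D" for S T S' T' c c'
    using that
    by (simp add: algebra_simps times_scaleC_left times_scaleC_right scaleC_scaleC scaleC_add_right PP PPx TP
        comm[symmetric] D_commute[of S' S])
  have "abelian_selfadjoint_algebra A"
    unfolding abelian_selfadjoint_algebra_def csubspace_def bop_comp_eq_times
  proof (intro conjI ballI allI)
    have "0 + 0 *\<^sub>C P + P * 0 \<in> A" by (rule AI[OF D_0 D_0])
    then show "0 \<in> A" by simp
  next
    fix X Y assume "X \<in> A" "Y \<in> A"
    then obtain S c T S' c' T' where X: "X = S + c *\<^sub>C P + P * T" "S \<in> D" "T \<in> D"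
      and Y: "Y = S' + c' *\<^sub>C P + P * T'" "S' \<in> D" "T' \<in> D" by (auto simp: A_def)
    have "X + Y = (S + S') + (c + c') *\<^sub>C P + P * (T + T')"
      by (simp add: X Y algebra_simps scaleC_add_left)
    moreover have "S + S' \<in> D" "T + T' \<in> D" using X Y by (auto intro: D_add)
    ultimately show "X + Y \<in> A" by (simp only: AI)
    have "X * Y = S * S' + (c * c') *\<^sub>C P
        + P * (c *\<^sub>C S' + c *\<^sub>C T' + c' *\<^sub>C S + c' *\<^sub>C T + S * T' + T * S' + T * T')"
      unfolding X(1) Y(1) using X Y by (intro prod)
    moreover have "S * S' \<in> D" "c *\<^sub>C S' + c *\<^sub>C T' + c' *\<^sub>C S + c' *\<^sub>C T + S * T' + T * S' + T * T' \<in> D"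
      using X Y by (auto intro!: D_add D_times D_scaleC)
    ultimately show "X * Y \<in> A" by (simp only: AI)
    show "X * Y = Y * X"
      unfolding X(1) Y(1) using X Y D_commute
      by (simp add: prod) (simp add: algebra_simps)
  next
    fix a X assume "X \<in> A"
    then obtain S c T where X: "X = S + c *\<^sub>C P + P * T" "S \<in> D" "T \<in> D" by (auto simp: A_def)
    have "a *\<^sub>C X = a *\<^sub>C S + (a * c) *\<^sub>C P + P * (a *\<^sub>C T)"
      by (simp add: X scaleC_add_right scaleC_scaleC times_scaleC_right)
    moreover have "a *\<^sub>C S \<in> D" "a *\<^sub>C T \<in> D" using X by (auto intro: D_scaleC)
    ultimately show "a *\<^sub>C X \<in> A" by (simp only: AI)
  next
    fix X assume "X \<in> A"
    then obtain S c T where X: "X = S + c *\<^sub>C P + P * T" "S \<in> D" "T \<in> D" by (auto simp: A_def)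
    obtain S' T' where adj: "S' \<in> D" "is_adjoint S' S" "T' \<in> D" "is_adjoint T' T" using D_adjoint X by metis
    have "is_adjoint (S' + cnj c *\<^sub>C P + T' * P) X"
      unfolding X using P adj by (intro is_adjoint_add is_adjoint_scaleC is_adjoint_times) (auto simp: orth_proj_def)
    moreover have "S' + cnj c *\<^sub>C P + T' * P \<in> A"
      using AI[OF adj(1,3), of "cnj c"] comm[OF adj(3)] by simp
    ultimately show "\<exists>Y\<in>A. is_adjoint Y X" by blast
  qed
  moreover have "S + 0 *\<^sub>C P + P * 0 \<in> A" if "S \<in> D" for S
    using that by (rule AI[OF _ D_0])
  then have "D \<subseteq> A" by auto
  ultimately have "A = D" using masa by (auto simp: masa_def)
  moreover have "0 + 1 *\<^sub>C P + P * 0 \<in> A" by (rule AI[OF D_0 D_0])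
  ultimately show ?thesis by (simp add: scaleC_one)
qed

definition projs :: "'h bop set" where "projs = {P \<in> D. orth_proj P}"

lemma projs_D: "P \<in> projs \<Longrightarrow> P \<in> D"
  and projs_orth_proj: "P \<in> projs \<Longrightarrow> orth_proj P"
  by (auto simp: projs_def)

lemma projs_adj: "P \<in> projs \<Longrightarrow> cinner (P \<cdot> x) y = cinner x (P \<cdot> y)"
  by (simp add: orth_projD projs_orth_proj)

lemma projs_norm_le: "P \<in> projs \<Longrightarrow> norm (P \<cdot> x) \<le> norm x"
  by (simp add: orth_proj_norm_le projs_orth_proj)

lemma projs_idem: "P \<in> projs \<Longrightarrow> P * P = P"
  by (simp add: projs_def orth_proj_def)

lemma projs_commute: "P \<in> projs \<Longrightarrow> Q \<in> projs \<Longrightarrow> P * Q = Q * P"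
  by (simp add: D_commute projs_D)

lemma projs_1: "1 \<in> projs"
  unfolding projs_def using orth_proj_in_D[OF orth_proj_1] orth_proj_1 by simp

lemma projs_0: "0 \<in> projs"
  by (simp add: projs_def D_0 orth_proj_0)

lemma projs_compl: "P \<in> projs \<Longrightarrow> 1 - P \<in> projs"
  using projs_1 by (simp add: projs_def D_diff orth_proj_compl)

lemma projs_times: "P \<in> projs \<Longrightarrow> Q \<in> projs \<Longrightarrow> P * Q \<in> projs"
  by (simp add: projs_def D_times orth_proj_times D_commute)

lemma projs_add:
  assumes "P \<in> projs" "Q \<in> projs" "P * Q = 0"
  shows "P + Q \<in> projs"
proof -
  have "1 - (1 - P) * (1 - Q) \<in> projs" using assms by (intro projs_compl projs_times)
  then show ?thesis using assms by (simp add: algebra_simps)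
qed

text \<open>\<open>D\<close> contains adjoints, so it leaves the orthogonal complement of
  \<open>K\<close> invariant together with \<open>K\<close>. Hence the projection onto
  \<open>K\<close> commutes with \<open>D\<close> and belongs to it.\<close>

lemma projs_onto:
  assumes K: "csubspace K" "closed K" and inv: "\<And>T x. T \<in> D \<Longrightarrow> x \<in> K \<Longrightarrow> T \<cdot> x \<in> K"
  obtains P where "P \<in> projs" "\<And>x. P \<cdot> x \<in> K" "\<And>x. x \<in> K \<Longrightarrow> P \<cdot> x = x"
proof -
  obtain P where P: "orth_proj P" "\<And>x. P \<cdot> x \<in> K" "\<And>x. x \<in> K \<Longrightarrow> P \<cdot> x = x"
    using orth_proj_exists[OF K] by metis
  have "P * T = T * P" if T: "T \<in> D" for T
  proof (rule bop_eqI)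
    fix x
    obtain S where S: "S \<in> D" "is_adjoint S T" using D_adjoint[OF T] by blast
    have "P \<cdot> T \<cdot> (x - P \<cdot> x) = 0"
    proof (rule eq_of_cinner)
      fix z
      have "cinner (P \<cdot> T \<cdot> (x - P \<cdot> x)) z = cinner (x - P \<cdot> x) (P \<cdot> (S \<cdot> P \<cdot> z))"
        using P inv S by (simp add: orth_projD is_adjointD[OF S(2)])
      also have "\<dots> = 0"
        unfolding orth_projD[OF P(1), symmetric] by (simp add: bop_simps cinner_simps P)
      finally show "cinner (P \<cdot> T \<cdot> (x - P \<cdot> x)) z = cinner 0 z" by (simp add: cinner_simps)
    qed
    moreover have "P \<cdot> T \<cdot> P \<cdot> x = T \<cdot> P \<cdot> x" using P inv T by simp
    ultimately show "(P * T) \<cdot> x = (T * P) \<cdot> x" by (simp add: bop_simps)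
  qed
  then have "P \<in> projs" using P(1) orth_proj_in_D by (simp add: projs_def)
  then show ?thesis using that P by blast
qed

text \<open>\<open>S\<close> is \<open>F\<close> scaled to a contraction, \<open>G\<close> its
  absolute value, and \<open>E\<close> projects onto the kernel of \<open>G - S\<close>. There
  \<open>S\<close> agrees with \<open>G \<ge> 0\<close>. The range of \<open>G + S\<close> lies in
  that kernel, because \<open>(G - S) * (G + S) = 0\<close>; so \<open>G + S\<close> vanishes on the
  orthogonal complement, where \<open>S\<close> is therefore \<open>- G\<close>. This takes the
  place of a spectral theorem.\<close>

lemma spectral_split:
  assumes F: "F \<in> D" "is_adjoint F F"
  obtains E where "E \<in> projs" "\<And>x. E \<cdot> x = x \<Longrightarrow> 0 \<le> Re (cinner (F \<cdot> x) x)"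
    "\<And>x. E \<cdot> x = 0 \<Longrightarrow> Re (cinner (F \<cdot> x) x) \<le> 0"
proof -
  define r where "r = inverse (1 + norm F)"
  have r: "0 < r" unfolding r_def by (simp add: add_pos_nonneg)
  define S where "S = r *\<^sub>R F"
  have SD: "S \<in> D" unfolding S_def using D_scaleC[OF F(1), of "of_real r"] by (simp add: scaleC_of_real)
  have "norm S \<le> 1" unfolding S_def r_def by (simp add: field_simps add_pos_nonneg)
  then obtain G where G: "is_adjoint G G" "G * G = S * S" "\<And>C. C * S = S * C \<Longrightarrow> C * G = G * C"
    "\<And>x. 0 \<le> Re (cinner (G \<cdot> x) x)"
    using operator_abs_exists[OF is_adjoint_scaleR[OF F(2), of r, folded S_def]] by blast
  have GS: "G * S = S * G" using G(3)[of S] by simp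
  define K where "K = {x. (G - S) \<cdot> x = 0}"
  have "csubspace K" by (auto simp: K_def csubspace_def bop_apply_add bop_apply_scaleC bop_apply_0)
  moreover have "closed K"
    unfolding K_def by (intro closed_Collect_eq continuous_intros bounded_linear.continuous_on[OF bounded_linear_bop_apply])
  moreover have "T \<cdot> x \<in> K" if T: "T \<in> D" and x: "x \<in> K" for T x
  proof -
    have "T * (G - S) = (G - S) * T"
      using G(3)[OF D_commute[OF T SD]] D_commute[OF T SD] by (simp add: algebra_simps)
    then have "(G - S) \<cdot> T \<cdot> x = T \<cdot> (G - S) \<cdot> x" by (metis bop_times_apply)
    then show ?thesis using x by (simp add: K_def bop_apply_0)
  qed
  ultimately obtain E where E: "E \<in> projs" "\<And>x. E \<cdot> x \<in> K" "\<And>x. x \<in> K \<Longrightarrow> E \<cdot> x = x"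
    using projs_onto by metis
  have FS: "Re (cinner (F \<cdot> x) x) = Re (cinner (S \<cdot> x) x) / r" for x
    using r by (simp add: S_def bop_simps cinner_scaleR_left)
  show ?thesis
  proof (rule that)
    show "E \<in> projs" by fact
  next
    fix x assume "E \<cdot> x = x"
    then have "G \<cdot> x = S \<cdot> x" using E(2)[of x] by (simp add: K_def minus_bop_apply)
    then show "0 \<le> Re (cinner (F \<cdot> x) x)" using G(4)[of x] r by (simp add: FS)
  next
    fix x assume x: "E \<cdot> x = 0"
    have "(G + S) \<cdot> x = 0"
    proof (rule eq_of_cinner)
      fix z
      have "(G - S) * (G + S) = 0" using G(2) GS by (simp add: algebra_simps)
      then have "(G + S) \<cdot> z \<in> K" unfolding K_def by (metis (mono_tags) mem_Collect_eq bop_times_apply zero_bop_apply)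
      then have "E \<cdot> (G + S) \<cdot> z = (G + S) \<cdot> z" by (rule E(3))
      have "cinner ((G + S) \<cdot> x) z = cinner x ((G + S) \<cdot> z)"
        by (rule is_adjointD) (intro is_adjoint_add G(1) is_adjoint_scaleR[OF F(2), of r, folded S_def])
      also have "\<dots> = cinner (E \<cdot> x) ((G + S) \<cdot> z)"
        using \<open>E \<cdot> (G + S) \<cdot> z = _\<close> projs_adj[OF E(1)] by simp
      finally show "cinner ((G + S) \<cdot> x) z = cinner 0 z" by (simp add: x cinner_simps)
    qed
    then have "S \<cdot> x = - (G \<cdot> x)" by (simp add: plus_bop_apply eq_neg_iff_add_eq_0 add.commute)
    then show "Re (cinner (F \<cdot> x) x) \<le> 0" using G(4)[of x] r by (simp add: FS cinner_simps field_simps)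
  qed
qed

text \<open>Cells are nonzero so that each contains a unit vector, on which masks can be tested. The
  sum is left free, since exceptional sets will be dropped.\<close>

definition part :: "'h bop set \<Rightarrow> bool" where
  "part \<A> \<longleftrightarrow> finite \<A> \<and> \<A> \<subseteq> projs - {0} \<and> (\<forall>A\<in>\<A>. \<forall>B\<in>\<A>. A \<noteq> B \<longrightarrow> A * B = 0)"

definition refine :: "'h bop set \<Rightarrow> 'h bop set \<Rightarrow> 'h bop set" where
  "refine \<A> \<B> = (\<lambda>(A, B). A * B) ` (\<A> \<times> \<B>) - {0}"

lemma part_finite: "part \<A> \<Longrightarrow> finite \<A>"
  and part_projs: "part \<A> \<Longrightarrow> A \<in> \<A> \<Longrightarrow> A \<in> projs"
  and part_nonzero: "part \<A> \<Longrightarrow> A \<in> \<A> \<Longrightarrow> A \<noteq> 0"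
  and part_orth: "part \<A> \<Longrightarrow> A \<in> \<A> \<Longrightarrow> B \<in> \<A> \<Longrightarrow> A \<noteq> B \<Longrightarrow> A * B = 0"
  by (auto simp: part_def)

lemma part_subset: "part \<A> \<Longrightarrow> \<B> \<subseteq> \<A> \<Longrightarrow> part \<B>"
  by (auto simp: part_def intro: finite_subset)

text \<open>Cells are idempotent and mutually orthogonal. The purpose is to turn products of sums of
  cells into operations on finite sets.\<close>

lemma part_sum_times:
  assumes "part \<A>" "\<B> \<subseteq> \<A>" "\<C> \<subseteq> \<A>"
  shows "\<Sum>\<B> * \<Sum>\<C> = \<Sum>(\<B> \<inter> \<C>)"
proof -
  have fin: "finite \<B>" "finite \<C>" using assms part_finite finite_subset by blast+
  have "\<Sum>\<B> * \<Sum>\<C> = (\<Sum>B\<in>\<B>. \<Sum>C\<in>\<C>. B * C)" by (rule sum_product)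
  also have "\<dots> = (\<Sum>B\<in>\<B>. if B \<in> \<C> then B else 0)"
  proof (rule sum.cong)
    fix B assume B: "B \<in> \<B>"
    have "(\<Sum>C\<in>\<C>. B * C) = (\<Sum>C\<in>\<C>. if C = B then B else 0)"
      using assms B part_orth[OF assms(1)] projs_idem[OF part_projs[OF assms(1)]]
      by (intro sum.cong) auto
    then show "(\<Sum>C\<in>\<C>. B * C) = (if B \<in> \<C> then B else 0)" using fin by (simp add: sum.delta)
  qed simp
  also have "\<dots> = \<Sum>(\<B> \<inter> \<C>)" using fin by (simp add: sum.inter_restrict)
  finally show ?thesis .
qed

lemma part_sum_projs:
  assumes "part \<A>"
  shows "\<Sum>\<A> \<in> projs"
proof -
  have "finite \<A>" using assms by (rule part_finite)
  then show ?thesis using assms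
  proof (induction \<A> rule: finite_induct)
    case (insert A \<A>)
    have "A * \<Sum>\<A> = \<Sum>{A} * \<Sum>\<A>" by simp
    also have "\<dots> = \<Sum>({A} \<inter> \<A>)" by (rule part_sum_times[OF insert.prems]) auto
    finally have "A * \<Sum>\<A> = 0" using insert by simp
    then have "A + \<Sum>\<A> \<in> projs"
      using insert.IH part_subset[OF insert.prems] part_projs[OF insert.prems, of A]
      by (intro projs_add) blast+
    then show ?case using insert by simp
  qed (simp add: projs_0)
qed

lemma refine_cases:
  assumes "part \<A>" "part \<B>" "C \<in> refine \<A> \<B>"
  obtains A B where "A \<in> \<A>" "B \<in> \<B>" "C = A * B" "A * C = C" "C * A = C" "B * C = C" "C * B = C"
proof -
  obtain A B where AB: "A \<in> \<A>" "B \<in> \<B>" "C = A * B" using assms(3) by (auto simp: refine_def)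
  have "A * A = A" "B * B = B" "A * B = B * A"
    using projs_idem projs_commute part_projs[OF assms(1) AB(1)] part_projs[OF assms(2) AB(2)] by auto
  moreover from this have "A * (A * B) = A * B" "A * B * A = A * B" "B * (A * B) = A * B" "A * B * B = A * B"
    by (metis mult.assoc)+
  ultimately show ?thesis using that AB by simp
qed

lemma refine_part:
  assumes "part \<A>" "part \<B>"
  shows "part (refine \<A> \<B>)" "\<Sum>(refine \<A> \<B>) = \<Sum>\<A> * \<Sum>\<B>"
proof -
  have fin: "finite \<A>" "finite \<B>" using assms part_finite by auto
  have prod: "(A * B) * (A' * B') = (A * A') * (B * B')"
    if "A \<in> \<A>" "A' \<in> \<A>" "B \<in> \<B>" "B' \<in> \<B>" for A A' B B'
    using projs_commute[OF part_projs[OF assms(2) that(3)] part_projs[OF assms(1) that(2)]]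
    by (simp add: mult.assoc) (simp flip: mult.assoc)
  have orth: "(A * B) * (A' * B') = 0"
    if "A \<in> \<A>" "A' \<in> \<A>" "B \<in> \<B>" "B' \<in> \<B>" "(A, B) \<noteq> (A', B')" for A A' B B'
    using that prod[OF that(1-4)] part_orth[OF assms(1) that(1,2)] part_orth[OF assms(2) that(3,4)] by auto
  have projs: "A * B \<in> projs" if "A \<in> \<A>" "B \<in> \<B>" for A B
    using that assms part_projs projs_times by blast
  show "part (refine \<A> \<B>)"
    unfolding part_def
  proof (intro conjI ballI impI)
    show "finite (refine \<A> \<B>)" using fin by (simp add: refine_def)
    show "refine \<A> \<B> \<subseteq> projs - {0}" using projs by (auto simp: refine_def)
    show "C * C' = 0" if "C \<in> refine \<A> \<B>" "C' \<in> refine \<A> \<B>" "C \<noteq> C'" for C C'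
      using that orth by (auto simp: refine_def)
  qed
  \<comment> \<open>On pairs with nonzero product, the product determines the pair, because distinct
    pairs have orthogonal products. Only so can a sum over the set of products be read as a sum over
    pairs.\<close>
  let ?I = "{p \<in> \<A> \<times> \<B>. fst p * snd p \<noteq> 0}"
  have inj: "inj_on (\<lambda>p. fst p * snd p) ?I"
  proof (rule inj_onI)
    fix p q assume p: "p \<in> ?I" and q: "q \<in> ?I" and eq: "fst p * snd p = fst q * snd q"
    show "p = q"
    proof (rule ccontr)
      assume "p \<noteq> q"
      then have "(fst p * snd p) * (fst q * snd q) = 0"
        using p q by (intro orth) (auto simp: prod_eq_iff)
      moreover have "(fst p * snd p) * (fst p * snd p) = fst p * snd p"
        using p projs projs_idem by auto
      ultimately show False using p eq by simp
    qed
  qed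
  have "refine \<A> \<B> = (\<lambda>p. fst p * snd p) ` ?I" by (force simp: refine_def)
  then have "\<Sum>(refine \<A> \<B>) = (\<Sum>p\<in>?I. fst p * snd p)"
    using sum.reindex[OF inj, of "\<lambda>C. C"] by simp
  also have "\<dots> = (\<Sum>p\<in>\<A> \<times> \<B>. fst p * snd p)"
    using fin by (intro sum.mono_neutral_left) auto
  also have "\<dots> = \<Sum>\<A> * \<Sum>\<B>"
    by (simp add: sum_product sum.cartesian_product case_prod_beta)
  finally show "\<Sum>(refine \<A> \<B>) = \<Sum>\<A> * \<Sum>\<B>" .
qed

lemma part_binary:
  assumes "P \<in> projs"
  shows "part ({P, 1 - P} - {0})" "\<Sum>({P, 1 - P} - {0}) = 1"
proof -
  have PP: "P * P = P" using assms by (rule projs_idem)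
  show "part ({P, 1 - P} - {0})"
    using assms PP by (auto simp: part_def projs_compl algebra_simps)
  show "\<Sum>({P, 1 - P} - {0}) = 1"
  \<comment> \<open>The two cells can coincide only on the zero space: then
    \<open>P = P * P = P * (1 - P) = 0\<close> and \<open>1 = 0\<close>.\<close>
  proof (cases "P = 1 - P")
    case True
    then have "P * P = P * (1 - P)" by simp
    then have "P = 0" using PP by (simp add: algebra_simps)
    then have "(1::'h bop) = 0" using True by simp
    then show ?thesis using \<open>P = 0\<close> by simp
  next
    case False
    have "\<Sum>({P, 1 - P} - {0}) = \<Sum>{P, 1 - P}" by (rule sum.mono_neutral_left) auto
    then show ?thesis using False by simp
  qed
qed

lemma part_vector_sq:
  assumes "part \<A>" "\<Sum>\<A> = 1"
  shows "(norm x)\<^sup>2 = (\<Sum>A\<in>\<A>. (norm (A \<cdot> x))\<^sup>2)"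
proof -
  have "x = (\<Sum>A\<in>\<A>. A \<cdot> x)"
    using arg_cong[OF assms(2), of "\<lambda>T. T \<cdot> x"] by (simp add: sum_bop_apply)
  moreover have "(norm (\<Sum>A\<in>\<A>. A \<cdot> x))\<^sup>2 = (\<Sum>A\<in>\<A>. (norm (A \<cdot> x))\<^sup>2)"
  proof (rule norm_sum_orth)
    fix A B assume "A \<in> \<A>" "B \<in> \<A>" "A \<noteq> B"
    then have "A * B = 0" "orth_proj A" using assms part_orth part_projs projs_orth_proj by blast+
    then show "cinner (A \<cdot> x) (B \<cdot> x) = 0"
      by (metis orth_projD bop_times_apply zero_bop_apply cinner_zero_right)
  qed (use assms part_finite in auto)
  ultimately show ?thesis by simp
qed

end

section \<open>Exhaustion and the Chebyshev inequality\<close>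

text \<open>Polarization: the form at \<open>x + y\<close> minus the form at \<open>x - y\<close> is
  four times the real part at \<open>x\<close>, \<open>y\<close>. The vector \<open>y\<close> is
  \<open>G \<cdot> x\<close> rescaled to the norm of \<open>x\<close>, so the parallelogram law
  produces exactly the same factor 4 on the other side.\<close>

lemma selfadjoint_norm_le:
  assumes G: "is_adjoint G G" and bound: "\<And>x. \<bar>Re (cinner (G \<cdot> x) x)\<bar> \<le> e * (norm x)\<^sup>2" and "0 \<le> e"
  shows "norm G \<le> e"
proof (rule norm_bop_le)
  fix x
  show "norm (G \<cdot> x) \<le> e * norm x"
  proof (cases "G \<cdot> x = 0")
    case True
    then show ?thesis using \<open>0 \<le> e\<close> by simp
  next
    case False
    then have Gx: "0 < norm (G \<cdot> x)" by simp
    define y where "y = (norm x / norm (G \<cdot> x)) *\<^sub>R (G \<cdot> x)"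
    have ny: "norm y = norm x" using Gx by (simp add: y_def)
    have "Re (cinner (G \<cdot> y) x) = Re (cinner (G \<cdot> x) y)"
      by (simp add: is_adjointD[OF G] Re_cinner_commute[of y])
    then have "4 * Re (cinner (G \<cdot> x) y)
        = Re (cinner (G \<cdot> (x + y)) (x + y)) - Re (cinner (G \<cdot> (x - y)) (x - y))"
      by (simp add: bop_simps cinner_simps)
    also have "\<dots> \<le> e * (norm (x + y))\<^sup>2 + e * (norm (x - y))\<^sup>2"
      using bound[of "x + y"] bound[of "x - y"] by linarith
    also have "\<dots> = e * ((norm (x + y))\<^sup>2 + (norm (x - y))\<^sup>2)" by (simp add: distrib_left)
    also have "\<dots> = 4 * (e * (norm x)\<^sup>2)"
      unfolding parallelogram ny by simp
    also have "Re (cinner (G \<cdot> x) y) = norm x * norm (G \<cdot> x)"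
      using Gx by (simp add: y_def cinner_scaleR_right Re_cinner_self power2_eq_square)
    finally have "norm x * norm (G \<cdot> x) \<le> norm x * (e * norm x)" by (simp add: power2_eq_square mult_ac)
    moreover have "0 < norm x" using False by (auto simp: bop_apply_0)
    ultimately show ?thesis by simp
  qed
qed fact

lemma closure_sequenceI: "(\<And>n::nat. f n \<in> K) \<Longrightarrow> f \<longlonglongrightarrow> x \<Longrightarrow> x \<in> closure K"
  for x :: "'a::complex_normed_vector"
  unfolding closure_sequential by (rule exI[of _ f]) simp

lemma closure_csubspace:
  assumes "csubspace K"
  shows "csubspace (closure K)"
  unfolding csubspace_def
proof (intro conjI ballI allI)
  show "0 \<in> closure K" using assms closure_subset unfolding csubspace_def by blast
next
  fix x y assume "x \<in> closure K" "y \<in> closure K"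
  then obtain f g where "\<And>n. f n \<in> K" "f \<longlonglongrightarrow> x" "\<And>n. g n \<in> K" "g \<longlonglongrightarrow> y"
    unfolding closure_sequential by metis
  then show "x + y \<in> closure K"
    using assms by (intro closure_sequenceI[of "\<lambda>n. f n + g n"] tendsto_add) (auto simp: csubspace_def)
next
  fix c x assume "x \<in> closure K"
  then obtain f where "\<And>n. f n \<in> K" "f \<longlonglongrightarrow> x" unfolding closure_sequential by metis
  then show "c *\<^sub>C x \<in> closure K"
    using assms
    by (intro closure_sequenceI[of "\<lambda>n. c *\<^sub>C f n"] bounded_linear.tendsto[OF bounded_linear_scaleC])
      (auto simp: csubspace_def)
qed

lemma closure_invariant:
  assumes "\<And>x. x \<in> K \<Longrightarrow> T \<cdot> x \<in> K" "x \<in> closure K"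
  shows "T \<cdot> x \<in> closure K"
proof -
  obtain f where f: "\<And>n. f n \<in> K" "f \<longlonglongrightarrow> x" using assms(2) unfolding closure_sequential by metis
  then show ?thesis
    using assms(1)
    by (intro closure_sequenceI[of "\<lambda>n. T \<cdot> f n"] bounded_linear.tendsto[OF bounded_linear_bop_apply]) auto
qed

abbreviation sq_summable :: "(nat \<Rightarrow> 'a::real_normed_vector) \<Rightarrow> bool" where
  "sq_summable x \<equiv> summable (\<lambda>n. (norm (x n))\<^sup>2)"

abbreviation sq_sum :: "(nat \<Rightarrow> 'a::real_normed_vector) \<Rightarrow> real" where
  "sq_sum x \<equiv> (\<Sum>n. (norm (x n))\<^sup>2)"

lemma summable_l2_apply:
  fixes x :: "nat \<Rightarrow> 'h::chilbert_space"
  assumes "sq_summable x"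
  shows "sq_summable (\<lambda>n. T \<cdot> x n)"
proof (rule summable_comparison_test'[OF summable_mult[OF assms, of "(norm T)\<^sup>2"], of 0])
  fix n
  show "norm ((norm (T \<cdot> x n))\<^sup>2) \<le> (norm T)\<^sup>2 * (norm (x n))\<^sup>2"
    using power_mono[OF norm_bop_apply_le, of T "x n" 2] by (simp add: power_mult_distrib)
qed

text \<open>Exhaustion for orders in which only sequences are known to have upper bounds. Each step
  of the sequence realizes at least half of the increase of \<open>f\<close> that is still possible,
  so above an upper bound of the whole sequence no increase is left. The element found is maximal
  for the values of \<open>f\<close> only.\<close>

lemma sequentially_maximal_exists:
  fixes f :: "'a \<Rightarrow> real"
  assumes p0: "p0 \<in> S"
    and trans: "\<And>p q r. le p q \<Longrightarrow> le q r \<Longrightarrow> le p r"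
    and refl: "\<And>p. p \<in> S \<Longrightarrow> le p p"
    and mono: "\<And>p q. p \<in> S \<Longrightarrow> q \<in> S \<Longrightarrow> le p q \<Longrightarrow> f p \<le> f q"
    and bound: "\<And>p. p \<in> S \<Longrightarrow> f p \<le> M"
    and chain: "\<And>X :: nat \<Rightarrow> 'a. (\<And>n. X n \<in> S) \<Longrightarrow> (\<And>n. le (X n) (X (Suc n))) \<Longrightarrow> \<exists>p\<in>S. \<forall>n. le (X n) p"
  obtains p where "p \<in> S" "\<And>q. q \<in> S \<Longrightarrow> le p q \<Longrightarrow> f q \<le> f p"
proof -
  define U where "U p = f ` {q \<in> S. le p q}" for p
  have U: "f q \<le> Sup (U p)" if "q \<in> S" "le p q" for p q
    by (rule cSup_upper) (use that bound in \<open>auto simp: U_def bdd_above_def\<close>)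
  have "\<exists>q\<in>S. le p q \<and> Sup (U p) + f p \<le> 2 * f q" if "p \<in> S" for p
  proof (cases "Sup (U p) \<le> f p")
    case True
    then show ?thesis using refl that by (intro bexI[of _ p]) auto
  next
    case False
    moreover have "U p \<noteq> {}" using refl that by (auto simp: U_def)
    ultimately obtain t where "t \<in> U p" "(Sup (U p) + f p) / 2 < t"
      using less_cSupD[of "U p" "(Sup (U p) + f p) / 2"] by auto
    then show ?thesis by (auto simp: U_def intro!: bexI)
  qed
  then obtain g where g: "\<And>p. p \<in> S \<Longrightarrow> g p \<in> S \<and> le p (g p) \<and> Sup (U p) + f p \<le> 2 * f (g p)"
    by metis
  define X where "X n = (g ^^ n) p0" for n
  have X: "X n \<in> S" for n by (induction n) (auto simp: X_def p0 g)
  have step: "le (X n) (X (Suc n))" "Sup (U (X n)) + f (X n) \<le> 2 * f (X (Suc n))" for n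
    using g[OF X[of n]] by (simp_all add: X_def)
  obtain p where p: "p \<in> S" "\<And>n. le (X n) p" using chain[of X, OF X step(1)] by blast
  have "incseq (\<lambda>n. f (X n))" by (rule incseq_SucI) (rule mono[OF X X step(1)])
  then obtain L where L: "(\<lambda>n. f (X n)) \<longlonglongrightarrow> L"
    using incseq_convergent[of _ M] bound[OF X] by blast
  have Lp: "L \<le> f p" by (rule LIMSEQ_le_const2[OF L]) (use mono[OF X p(1) p(2)] in blast)
  show ?thesis
  proof (rule that[OF p(1)])
    fix q assume q: "q \<in> S" "le p q"
    have "f q \<le> 2 * f (X (Suc n)) - f (X n)" for n
      using U[OF q(1) trans[OF p(2) q(2)], of n] step(2)[of n] by linarith
    moreover have "(\<lambda>n. 2 * f (X (Suc n)) - f (X n)) \<longlonglongrightarrow> 2 * L - L"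
      by (intro tendsto_intros L LIMSEQ_Suc[OF L])
    ultimately have "f q \<le> 2 * L - L" using LIMSEQ_le_const by blast
    then show "f q \<le> f p" using Lp by simp
  qed
qed

context masa_algebra
begin

text \<open>\<open>Q\<close> projects onto the closure of the union of the ranges, which
  \<open>D\<close> leaves invariant. Strong convergence holds because a vector in the union is fixed
  by all late \<open>P m\<close>, and such vectors approximate \<open>Q \<cdot> x\<close>.\<close>

lemma projs_sup:
  assumes P: "\<And>n. P n \<in> projs" and inc: "\<And>n. P n * P (Suc n) = P n"
  obtains Q where "Q \<in> projs" "\<And>n. P n * Q = P n" "\<And>x. (\<lambda>n. P n \<cdot> x) \<longlonglongrightarrow> Q \<cdot> x"
proof -
  have le: "P n * P (n + k) = P n" for n k
    by (induction k) (simp_all add: projs_idem P, metis inc mult.assoc)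
  have le': "P m \<cdot> P n \<cdot> x = P n \<cdot> x" if "n \<le> m" for m n x
    using le[of n "m - n"] that projs_commute[OF P P] by (metis bop_times_apply le_add_diff_inverse)
  define U where "U = {x. \<exists>n. P n \<cdot> x = x}"
  have "csubspace U"
    unfolding csubspace_def
  proof (intro conjI ballI allI)
    show "0 \<in> U" by (simp add: U_def bop_apply_0)
    fix x y assume "x \<in> U" "y \<in> U"
    then obtain m n where mn: "P m \<cdot> x = x" "P n \<cdot> y = y" by (auto simp: U_def)
    have "P (max m n) \<cdot> x = x" "P (max m n) \<cdot> y = y"
      using le'[of m "max m n" x] le'[of n "max m n" y] by (simp_all add: mn)
    then have "P (max m n) \<cdot> (x + y) = x + y" by (simp add: bop_apply_add)
    then show "x + y \<in> U" unfolding U_def by blast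
  next
    fix c x assume "x \<in> U"
    then obtain n where "P n \<cdot> x = x" by (auto simp: U_def)
    then have "P n \<cdot> (c *\<^sub>C x) = c *\<^sub>C x" by (simp add: bop_apply_scaleC)
    then show "c *\<^sub>C x \<in> U" unfolding U_def by blast
  qed
  moreover have "T \<cdot> x \<in> U" if T: "T \<in> D" and x: "x \<in> U" for T x
  proof -
    obtain n where "P n \<cdot> x = x" using x by (auto simp: U_def)
    then have "P n \<cdot> T \<cdot> x = T \<cdot> x" using D_commute[OF projs_D[OF P] T, of n] by (metis bop_times_apply)
    then show ?thesis by (auto simp: U_def)
  qed
  ultimately obtain Q where Q: "Q \<in> projs" "\<And>x. Q \<cdot> x \<in> closure U" "\<And>x. x \<in> closure U \<Longrightarrow> Q \<cdot> x = x"
    using projs_onto[OF closure_csubspace closed_closure closure_invariant] by metis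
  have QP: "Q \<cdot> P n \<cdot> x = P n \<cdot> x" for n x
  proof (rule Q(3))
    have "P n \<cdot> x \<in> U" using projs_orth_proj[OF P] by (auto simp: U_def intro!: exI[of _ n])
    then show "P n \<cdot> x \<in> closure U" using closure_subset by blast
  qed
  have PQ: "P n * Q = P n" for n
    unfolding projs_commute[OF P Q(1)] by (rule bop_eqI) (simp add: bop_times_apply QP)
  have "(\<lambda>n. P n \<cdot> x) \<longlonglongrightarrow> Q \<cdot> x" for x
  proof (rule LIMSEQ_I)
    fix e :: real assume "0 < e"
    then obtain z where z: "z \<in> U" "dist z (Q \<cdot> x) < e / 2" using Q(2)[of x] closure_approachable[of "Q \<cdot> x" U] by (metis half_gt_zero)
    then obtain n where n: "P n \<cdot> z = z" by (auto simp: U_def)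
    have "norm (P m \<cdot> x - Q \<cdot> x) < e" if "n \<le> m" for m
    proof -
      have "P m \<cdot> z = z" using le'[OF that, of z] n by simp
      moreover have "P m \<cdot> x = P m \<cdot> Q \<cdot> x" using PQ by (metis bop_times_apply)
      ultimately have "P m \<cdot> x - Q \<cdot> x = P m \<cdot> (Q \<cdot> x - z) - (Q \<cdot> x - z)" by (simp add: bop_apply_diff)
      then have "norm (P m \<cdot> x - Q \<cdot> x) \<le> norm (Q \<cdot> x - z) + norm (Q \<cdot> x - z)"
        using norm_triangle_ineq4 projs_norm_le[OF P] by (smt (verit))
      then show ?thesis using z(2) by (simp add: dist_norm norm_minus_commute)
    qed
    then show "\<exists>no. \<forall>m\<ge>no. norm (P m \<cdot> x - Q \<cdot> x) < e" by blast
  qed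
  then show ?thesis using that Q(1) PQ by blast
qed

text \<open>\<open>\<nu>\<close> and \<open>C \<mapsto> (norm (C \<cdot> \<xi>))\<^sup>2\<close>
  behave as two measures on the projections, and \<open>B\<close> is where the density of the first
  against the second is at most \<open>d\<^sup>2\<close>. Its complement \<open>P\<close> is
  exhausted by projections with \<open>\<nu>\<close> at least \<open>d\<^sup>2\<close> times the
  second measure, which bounds the size of \<open>P\<close>. A projection below \<open>B\<close>
  that violates the bound could be added to \<open>P\<close> and would increase
  \<open>\<nu>\<close>.\<close>

lemma chebyshev_projection:
  fixes e :: "nat \<Rightarrow> 'h"
  assumes summ: "sq_summable e" and d: "0 < d"
  obtains B where "B \<in> projs" "d\<^sup>2 * (norm (\<xi> - B \<cdot> \<xi>))\<^sup>2 \<le> sq_sum e"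
    "\<And>C. C \<in> projs \<Longrightarrow> C * B = C \<Longrightarrow> sq_sum (\<lambda>n. C \<cdot> e n) \<le> d\<^sup>2 * (norm (C \<cdot> \<xi>))\<^sup>2"
proof -
  define \<nu> where "\<nu> C = sq_sum (\<lambda>n. C \<cdot> e n)" for C
  note sm = summable_l2_apply[OF summ]
  have le: "norm (P \<cdot> x) \<le> norm (Q \<cdot> x)" if "P \<in> projs" "Q \<in> projs" "P * Q = P" for P Q x
    using projs_norm_le[OF that(1), of "Q \<cdot> x"] that(3) by (metis bop_times_apply)
  have mono: "\<nu> P \<le> \<nu> Q" if "P \<in> projs" "Q \<in> projs" "P * Q = P" for P Q
    unfolding \<nu>_def using that by (intro suminf_le sm power_mono le) auto
  have one: "\<nu> 1 = sq_sum e" by (simp add: \<nu>_def)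
  define S where "S = {P \<in> projs. d\<^sup>2 * (norm (P \<cdot> \<xi>))\<^sup>2 \<le> \<nu> P}"
  have "0 \<in> S" by (simp add: S_def projs_0 zero_bop_apply \<nu>_def)
  obtain P where P: "P \<in> S" "\<And>Q. Q \<in> S \<Longrightarrow> P * Q = P \<Longrightarrow> \<nu> Q \<le> \<nu> P"
  proof (rule sequentially_maximal_exists[of 0 S "\<lambda>P Q. P * Q = P" \<nu> "\<nu> 1"])
    show "\<exists>Q\<in>S. \<forall>n. X n * Q = X n" if X: "\<And>n. X n \<in> S" "\<And>n. X n * X (Suc n) = X n" for X
    proof -
      have Xp: "X n \<in> projs" for n using X(1) by (simp add: S_def)
      obtain Q where Q: "Q \<in> projs" "\<And>n. X n * Q = X n" "\<And>x. (\<lambda>n. X n \<cdot> x) \<longlonglongrightarrow> Q \<cdot> x"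
        using projs_sup[of X, OF Xp X(2)] by blast
      have "d\<^sup>2 * (norm (X n \<cdot> \<xi>))\<^sup>2 \<le> \<nu> Q" for n
        using X(1)[of n] mono[OF Xp Q(1) Q(2)] by (auto simp: S_def intro: order_trans)
      moreover have "(\<lambda>n. d\<^sup>2 * (norm (X n \<cdot> \<xi>))\<^sup>2) \<longlonglongrightarrow> d\<^sup>2 * (norm (Q \<cdot> \<xi>))\<^sup>2"
        by (intro tendsto_intros Q)
      ultimately have "d\<^sup>2 * (norm (Q \<cdot> \<xi>))\<^sup>2 \<le> \<nu> Q" using LIMSEQ_le_const2 by blast
      then show ?thesis using Q by (auto simp: S_def)
    qed
  qed (use \<open>0 \<in> S\<close> mono projs_1 in \<open>auto simp: S_def projs_idem, metis mult.assoc\<close>)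
  have Pp: "P \<in> projs" using P(1) by (simp add: S_def)
  show ?thesis
  proof (rule that)
    show "1 - P \<in> projs" by (rule projs_compl[OF Pp])
    have "d\<^sup>2 * (norm (P \<cdot> \<xi>))\<^sup>2 \<le> \<nu> 1"
      using P(1) mono[OF Pp projs_1] by (auto simp: S_def intro: order_trans)
    then show "d\<^sup>2 * (norm (\<xi> - (1 - P) \<cdot> \<xi>))\<^sup>2 \<le> sq_sum e"
      by (simp add: bop_simps one)
  next
    fix C assume C: "C \<in> projs" "C * (1 - P) = C"
    then have CP: "C * P = 0" "P * C = 0" using projs_commute[OF C(1) Pp] by (auto simp: right_diff_distrib)
    have sq: "(norm ((P + C) \<cdot> x))\<^sup>2 = (norm (P \<cdot> x))\<^sup>2 + (norm (C \<cdot> x))\<^sup>2" for x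
      unfolding plus_bop_apply
    proof (rule norm_add_orth)
      have "P \<cdot> C \<cdot> x = 0" using CP(2) by (metis bop_times_apply zero_bop_apply)
      then show "cinner (P \<cdot> x) (C \<cdot> x) = 0" by (simp add: projs_adj[OF Pp] cinner_simps)
    qed
    have PC: "P + C \<in> projs" by (rule projs_add[OF Pp C(1) CP(2)])
    have \<nu>: "\<nu> (P + C) = \<nu> P + \<nu> C" unfolding \<nu>_def sq by (intro suminf_add[symmetric] sm)
    show "sq_sum (\<lambda>n. C \<cdot> e n) \<le> d\<^sup>2 * (norm (C \<cdot> \<xi>))\<^sup>2"
    proof (rule ccontr)
      assume "\<not> ?thesis"
      then have *: "d\<^sup>2 * (norm (C \<cdot> \<xi>))\<^sup>2 < \<nu> C" by (simp add: \<nu>_def)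
      then have "P + C \<in> S" using P(1) PC by (simp add: S_def \<nu> sq distrib_left)
      moreover have "P * (P + C) = P" using CP projs_idem[OF Pp] by (simp add: distrib_left)
      ultimately have "\<nu> C \<le> 0" using P(2) \<nu> by fastforce
      then show False using * by (smt (verit) zero_le_power2 mult_nonneg_nonneg)
    qed
  qed
qed

end

section \<open>Simple functions of the masa\<close>

context masa_algebra
begin

lemma D_scaleR: "T \<in> D \<Longrightarrow> r *\<^sub>R T \<in> D"
  using D_scaleC[of T "of_real r"] by (simp add: scaleC_of_real)

lemma D_1: "1 \<in> D"
  by (rule projs_D[OF projs_1])

lemma proj_below: "A * C = C \<Longrightarrow> C \<cdot> x = x \<Longrightarrow> A \<cdot> x = x" for A C :: "'h bop"
  by (metis bop_times_apply)

text \<open>The quadratic form on the range of \<open>B\<close> stands for the values of the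
  function \<open>F\<close> on the cell.\<close>

definition level_decided :: "'h bop \<Rightarrow> 'h bop \<Rightarrow> real \<Rightarrow> bool" where
  "level_decided F B r \<longleftrightarrow> (\<forall>x. B \<cdot> x = x \<longrightarrow> r * (norm x)\<^sup>2 \<le> Re (cinner (F \<cdot> x) x)) \<or>
    (\<forall>x. B \<cdot> x = x \<longrightarrow> Re (cinner (F \<cdot> x) x) \<le> r * (norm x)\<^sup>2)"

lemma spectral_levels:
  assumes F: "F \<in> D" "is_adjoint F F" and "finite R"
  shows "\<exists>\<B>. part \<B> \<and> \<Sum>\<B> = 1 \<and> (\<forall>B\<in>\<B>. \<forall>r\<in>R.
    level_decided F B r)"
  using \<open>finite R\<close>
proof (induction R rule: finite_induct)
  case empty
  show ?case using part_binary[OF projs_1] by blast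
next
  case (insert r R)
  then obtain \<B> where \<B>: "part \<B>" "\<Sum>\<B> = 1" and lev: "\<And>B s. B \<in> \<B> \<Longrightarrow> s \<in> R \<Longrightarrow>
    level_decided F B s" by blast
  have Re: "Re (cinner ((F - r *\<^sub>R 1) \<cdot> x) x) = Re (cinner (F \<cdot> x) x) - r * (norm x)\<^sup>2" for x
    by (simp add: bop_simps cinner_diff_left cinner_scaleR_left Re_cinner_self)
  obtain E where E: "E \<in> projs" "\<And>x. E \<cdot> x = x \<Longrightarrow> r * (norm x)\<^sup>2 \<le> Re (cinner (F \<cdot> x) x)"
    "\<And>x. E \<cdot> x = 0 \<Longrightarrow> Re (cinner (F \<cdot> x) x) \<le> r * (norm x)\<^sup>2"
    using spectral_split[of "F - r *\<^sub>R 1", unfolded Re diff_ge_0_iff_ge diff_le_0_iff_le]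
      F D_diff D_scaleR D_1 is_adjoint_diff is_adjoint_scaleR is_adjoint_1 by (metis (no_types, lifting))
  note bin = part_binary[OF E(1)]
  have "level_decided F C s"
    if C: "C \<in> refine \<B> ({E, 1 - E} - {0})" and s: "s \<in> insert r R" for C s
  proof -
    obtain A B where AB: "A \<in> \<B>" "B \<in> {E, 1 - E} - {0}" "A * C = C" "B * C = C"
      using refine_cases[OF \<B>(1) bin(1) C] by metis
    have "level_decided F C r"
    proof (cases "B = E")
      case True
      then show ?thesis unfolding level_decided_def using E(2) proj_below[OF AB(4)] by blast
    next
      case False
      then have "E \<cdot> x = 0" if "C \<cdot> x = x" for x
        using AB(2) proj_below[OF AB(4) that] by (simp add: minus_bop_apply)
      then show ?thesis unfolding level_decided_def using E(3) by blast
    qed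
    moreover have "level_decided F C s" if "s \<in> R"
      using lev[OF AB(1) that] proj_below[OF AB(3)] unfolding level_decided_def by blast
    ultimately show ?thesis using s by blast
  qed
  then show ?case
    using refine_part[OF \<B>(1) bin(1)] \<B>(2) bin(2) by (intro exI[of _ "refine \<B> ({E, 1 - E} - {0})"]) auto
qed

text \<open>The levels \<open>lev 0, ..., lev n\<close> cover the interval from
  \<open>- norm F\<close> to \<open>norm F\<close> in steps of \<open>e\<close>. A cell decided at
  every level lies between two consecutive ones, so on it \<open>F\<close> differs from the lower
  one by at most \<open>e\<close>.\<close>

lemma spectral_cells_selfadjoint:
  assumes F: "F \<in> D" "is_adjoint F F" and "0 < e"
  shows "\<exists>\<B>. part \<B> \<and> \<Sum>\<B> = 1 \<and> (\<forall>B\<in>\<B>. \<exists>r::real. norm ((F - r *\<^sub>R 1) * B) \<le> e)"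
proof -
  define lev where "lev i = real i * e - norm F" for i
  obtain n where n: "2 * norm F \<le> real n * e"
    using reals_Archimedean3[OF \<open>0 < e\<close>] less_imp_le by blast
  obtain \<B> where \<B>: "part \<B>" "\<Sum>\<B> = 1" and alt: "\<And>B i. B \<in> \<B> \<Longrightarrow> i \<le> n \<Longrightarrow> level_decided F B (lev i)"
    using spectral_levels[OF F, of "lev ` {..n}"] by auto
  have bd: "\<bar>Re (cinner (F \<cdot> x) x)\<bar> \<le> norm F * (norm x)\<^sup>2" for x
  proof -
    have "\<bar>Re (cinner (F \<cdot> x) x)\<bar> \<le> norm (F \<cdot> x) * norm x"
      using abs_Re_le_cmod cauchy_schwarz order_trans by blast
    also have "\<dots> \<le> norm F * norm x * norm x" by (intro mult_right_mono norm_bop_apply_le) simp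
    finally show ?thesis by (simp add: power2_eq_square mult_ac)
  qed
  have "\<exists>r. norm ((F - r *\<^sub>R 1) * B) \<le> e" if B: "B \<in> \<B>" for B
  proof -
    have Bp: "B \<in> projs" using B \<B>(1) part_projs by blast
    define P where "P i \<longleftrightarrow> (\<forall>x. B \<cdot> x = x \<longrightarrow> lev i * (norm x)\<^sup>2 \<le> Re (cinner (F \<cdot> x) x))" for i
    have "P 0" unfolding P_def lev_def using bd by (auto simp: abs_le_iff intro: order_trans) (smt (verit) bd)
    \<comment> \<open>The highest level below \<open>F\<close> on the cell; level 0 qualifies, being
      \<open>- norm F\<close>. The next level does not, so it is an upper bound, the cell being
      decided. For \<open>i = n\<close> the upper bound is
      \<open>norm F \<le> lev (Suc n)\<close>.\<close>
    define i where "i = (GREATEST i. i \<le> n \<and> P i)"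
    have i: "i \<le> n \<and> P i"
      unfolding i_def by (rule GreatestI_nat[of _ 0 n]) (use \<open>P 0\<close> in auto)
    have up: "Re (cinner (F \<cdot> x) x) \<le> lev (Suc i) * (norm x)\<^sup>2" if x: "B \<cdot> x = x" for x
    proof (cases "i = n")
      case True
      have "norm F \<le> lev (Suc n)" using n \<open>0 < e\<close> by (simp add: lev_def algebra_simps)
      then have "norm F * (norm x)\<^sup>2 \<le> lev (Suc n) * (norm x)\<^sup>2" by (simp add: mult_right_mono)
      then show ?thesis using order_trans[OF abs_le_D1[OF bd[of x]]] True by simp
    next
      case False
      then have "Suc i \<le> n" using i by simp
      moreover have "\<not> P (Suc i)"
        using Greatest_le_nat[of "\<lambda>i. i \<le> n \<and> P i" "Suc i" n] \<open>Suc i \<le> n\<close> unfolding i_def[symmetric] by auto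
      ultimately show ?thesis using alt[OF B] x unfolding P_def level_decided_def by blast
    qed
    have low: "lev i * (norm x)\<^sup>2 \<le> Re (cinner (F \<cdot> x) x)" if "B \<cdot> x = x" for x
      using i that by (auto simp: P_def)
    have BF: "B * F = F * B" by (rule D_commute[OF projs_D[OF Bp] F(1)])
    let ?G = "(F - lev i *\<^sub>R 1) * B"
    have "is_adjoint (B * (F - lev i *\<^sub>R 1)) ?G"
      using projs_orth_proj[OF Bp] F(2)
      by (intro is_adjoint_times is_adjoint_diff is_adjoint_scaleR is_adjoint_1) (auto simp: orth_proj_def)
    then have "is_adjoint ?G ?G" by (simp add: BF algebra_simps)
    moreover have "\<bar>Re (cinner (?G \<cdot> x) x)\<bar> \<le> e * (norm x)\<^sup>2" for x
    proof -
      define y where "y = B \<cdot> x"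
      have y: "B \<cdot> y = y" using projs_orth_proj[OF Bp] by (simp add: y_def)
      have "?G * B = ?G" using projs_idem[OF Bp] by (simp add: mult.assoc)
      then have "B * ?G = ?G" using BF by (simp add: algebra_simps) (metis mult.assoc)
      then have "?G \<cdot> x = B \<cdot> (F \<cdot> y - lev i *\<^sub>R y)"
        by (metis (no_types, lifting) y_def bop_times_apply minus_bop_apply scaleR_bop_apply bop_one_apply)
      then have "Re (cinner (?G \<cdot> x) x) = Re (cinner (F \<cdot> y) y) - lev i * (norm y)\<^sup>2"
        by (simp add: projs_adj[OF Bp] cinner_diff_left cinner_scaleR_left Re_cinner_self
            flip: y_def)
      then have "\<bar>Re (cinner (?G \<cdot> x) x)\<bar> \<le> e * (norm y)\<^sup>2"
        using low[OF y] up[OF y] by (simp add: lev_def algebra_simps)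
      also have "\<dots> \<le> e * (norm x)\<^sup>2"
        using \<open>0 < e\<close> projs_norm_le[OF Bp, of x]
        by (intro mult_left_mono power_mono) (auto simp: y_def)
      finally show ?thesis .
    qed
    ultimately have "norm ?G \<le> e" using \<open>0 < e\<close> by (intro selfadjoint_norm_le) auto
    then show ?thesis by blast
  qed
  then show ?thesis using \<B> by blast
qed

lemma spectral_cells:
  assumes F: "F \<in> D" and "0 < e"
  shows "\<exists>\<B>. part \<B> \<and> \<Sum>\<B> = 1 \<and> (\<forall>B\<in>\<B>. \<exists>c. norm ((F - c *\<^sub>C 1) * B) \<le> e)"
proof -
  obtain S where S: "S \<in> D" "is_adjoint S F" using D_adjoint[OF F] by blast
  \<comment> \<open>Real and imaginary part, each treated with the tolerance
    \<open>e / 2\<close>.\<close>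
  define F1 where "F1 = (1/2) *\<^sub>C (F + S)"
  define F2 where "F2 = (\<i>/2) *\<^sub>C (S - F)"
  have "is_adjoint F1 F1"
    using is_adjoint_scaleC[OF is_adjoint_add[OF S(2) is_adjoint_sym[OF S(2)]], of "1/2"]
    by (simp add: F1_def add.commute)
  have "is_adjoint F2 F2"
    using is_adjoint_scaleC[OF is_adjoint_diff[OF is_adjoint_sym[OF S(2)] S(2)], of "\<i>/2"]
      scaleC_minus_right[of "\<i>/2" "S - F"] by (simp add: F2_def scaleC_diff_right scaleC_minus_left)
  have FF: "F = F1 + \<i> *\<^sub>C F2"
  proof -
    have "\<i> *\<^sub>C F2 = (1/2) *\<^sub>C (F - S)"
      by (simp add: F2_def scaleC_scaleC scaleC_diff_right scaleC_minus_left)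
    then have "F1 + \<i> *\<^sub>C F2 = (1/2) *\<^sub>C F + (1/2) *\<^sub>C F" by (simp add: F1_def scaleC_add_right scaleC_diff_right)
    then show ?thesis by (simp add: scaleC_one flip: scaleC_add_left)
  qed
  have "F1 \<in> D" "F2 \<in> D" unfolding F1_def F2_def using F S(1) by (auto intro: D_scaleC D_add D_diff)
  obtain \<A> where \<A>: "part \<A>" "\<Sum>\<A> = 1" "\<And>B. B \<in> \<A> \<Longrightarrow> \<exists>r::real. norm ((F1 - r *\<^sub>R 1) * B) \<le> e / 2"
    using spectral_cells_selfadjoint[OF \<open>F1 \<in> D\<close> \<open>is_adjoint F1 F1\<close>, of "e/2"] \<open>0 < e\<close> by auto
  obtain \<B> where \<B>: "part \<B>" "\<Sum>\<B> = 1" "\<And>B. B \<in> \<B> \<Longrightarrow> \<exists>r::real. norm ((F2 - r *\<^sub>R 1) * B) \<le> e / 2"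
    using spectral_cells_selfadjoint[OF \<open>F2 \<in> D\<close> \<open>is_adjoint F2 F2\<close>, of "e/2"] \<open>0 < e\<close> by auto
  have "\<exists>c. norm ((F - c *\<^sub>C 1) * C) \<le> e" if C: "C \<in> refine \<A> \<B>" for C
  proof -
    obtain A B where AB: "A \<in> \<A>" "B \<in> \<B>" "A * C = C" "B * C = C"
      using refine_cases[OF \<A>(1) \<B>(1) C] by metis
    have "C \<in> projs" using C refine_part[OF \<A>(1) \<B>(1)] part_projs by blast
    have C1: "norm C \<le> 1"
      by (rule norm_bop_le) (use projs_norm_le[OF \<open>C \<in> projs\<close>] in auto)
    have small: "norm (X * C) \<le> e / 2" if "norm (X * P) \<le> e / 2" "P * C = C" for X P
    proof -
      have "norm (X * C) = norm ((X * P) * C)" using that(2) by (simp add: mult.assoc)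
      also have "\<dots> \<le> norm (X * P) * norm C" by (rule norm_mult_ineq)
      also have "\<dots> \<le> e / 2 * 1" using that(1) C1 \<open>0 < e\<close> by (intro mult_mono) auto
      finally show ?thesis by simp
    qed
    obtain r s :: real where r: "norm ((F1 - r *\<^sub>R 1) * A) \<le> e / 2" and s: "norm ((F2 - s *\<^sub>R 1) * B) \<le> e / 2"
      using \<A>(3)[OF AB(1)] \<B>(3)[OF AB(2)] by blast
    have "(F - (of_real r + \<i> * of_real s) *\<^sub>C 1) * C = (F1 - r *\<^sub>R 1) * C + \<i> *\<^sub>C ((F2 - s *\<^sub>R 1) * C)"
      by (simp add: FF algebra_simps scaleC_add_left scaleC_diff_right times_scaleC_left scaleC_of_real
          flip: scaleC_scaleC)
    then have "norm ((F - (of_real r + \<i> * of_real s) *\<^sub>C 1) * C) \<le> e / 2 + e / 2"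
      using norm_triangle_le small[OF r AB(3)] small[OF s AB(4)] by (simp add: norm_scaleC add_mono norm_triangle_le)
    then show ?thesis by (intro exI[of _ "of_real r + \<i> * of_real s"]) simp
  qed
  then show ?thesis using refine_part[OF \<A>(1) \<B>(1)] \<A>(2) \<B>(2) by (intro exI[of _ "refine \<A> \<B>"]) auto
qed

text \<open>Functions with finitely many values. Bounds that exhaustion gives for projections pass
  to them cell by cell, and they are norm dense in \<open>D\<close>, so they reach all vectors of a
  cyclic subspace.\<close>

definition simple :: "'h bop \<Rightarrow> bool" where
  "simple F \<longleftrightarrow> F \<in> D \<and> (\<exists>\<B>. part \<B> \<and> \<Sum>\<B> = 1 \<and> (\<forall>B\<in>\<B>. \<exists>c. F * B = c *\<^sub>C B))"

lemma simple_D: "simple F \<Longrightarrow> F \<in> D"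
  by (simp add: simple_def)

lemma simple_projs: "P \<in> projs \<Longrightarrow> simple P"
proof -
  assume P: "P \<in> projs"
  have "P * P = 1 *\<^sub>C P" "P * (1 - P) = 0 *\<^sub>C (1 - P)"
    using projs_idem[OF P] by (simp_all add: right_diff_distrib scaleC_one)
  then have "\<exists>c. P * B = c *\<^sub>C B" if "B \<in> {P, 1 - P} - {0}" for B
    using that by blast
  then show "simple P"
    unfolding simple_def using projs_D[OF P] part_binary[OF P] by blast
qed

lemma simple_times:
  assumes "simple F" "simple G"
  shows "simple (F * G)"
proof -
  obtain \<A> \<B> where \<A>: "part \<A>" "\<Sum>\<A> = 1" "\<And>B. B \<in> \<A> \<Longrightarrow> \<exists>c. F * B = c *\<^sub>C B"
    and \<B>: "part \<B>" "\<Sum>\<B> = 1" "\<And>B. B \<in> \<B> \<Longrightarrow> \<exists>c. G * B = c *\<^sub>C B"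
    using assms unfolding simple_def by metis
  have "\<exists>c. F * G * C = c *\<^sub>C C" if C: "C \<in> refine \<A> \<B>" for C
  proof -
    obtain A B where AB: "A \<in> \<A>" "B \<in> \<B>" "A * C = C" "B * C = C"
      using refine_cases[OF \<A>(1) \<B>(1) C] by metis
    obtain c d where c: "F * A = c *\<^sub>C A" and d: "G * B = d *\<^sub>C B" using \<A>(3)[OF AB(1)] \<B>(3)[OF AB(2)] by blast
    have "F * C = c *\<^sub>C C" by (metis AB(3) c mult.assoc times_scaleC_left)
    moreover have "G * C = d *\<^sub>C C" by (metis AB(4) d mult.assoc times_scaleC_left)
    ultimately have "F * G * C = (d * c) *\<^sub>C C" by (simp add: mult.assoc times_scaleC_right scaleC_scaleC)
    then show ?thesis by blast
  qed
  then show ?thesis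
    using refine_part[OF \<A>(1) \<B>(1)] \<A>(2) \<B>(2) assms D_times unfolding simple_def
    by (intro conjI exI[of _ "refine \<A> \<B>"]) auto
qed

lemma simple_common_partition:
  fixes F :: "nat \<Rightarrow> 'h bop"
  assumes "\<And>n. simple (F n)"
  shows "\<exists>\<B>. part \<B> \<and> \<Sum>\<B> = 1 \<and> (\<forall>B\<in>\<B>. \<forall>n<N. \<exists>c. F n * B = c *\<^sub>C B)"
proof (induction N)
  case 0
  then show ?case using part_binary[OF projs_1] by blast
next
  case (Suc N)
  obtain \<A> where \<A>: "part \<A>" "\<Sum>\<A> = 1" "\<And>B n. B \<in> \<A> \<Longrightarrow> n < N \<Longrightarrow> \<exists>c. F n * B = c *\<^sub>C B"
    using Suc by blast
  obtain \<B> where \<B>: "part \<B>" "\<Sum>\<B> = 1" "\<And>B. B \<in> \<B> \<Longrightarrow> \<exists>c. F N * B = c *\<^sub>C B"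
    using assms[of N] unfolding simple_def by metis
  have "\<exists>c. F n * C = c *\<^sub>C C" if C: "C \<in> refine \<A> \<B>" and n: "n < Suc N" for C n
  proof -
    obtain A B where AB: "A \<in> \<A>" "B \<in> \<B>" "A * C = C" "B * C = C"
      using refine_cases[OF \<A>(1) \<B>(1) C] by metis
    show ?thesis
    proof (cases "n = N")
      case True
      then show ?thesis using \<B>(3)[OF AB(2)] AB(4) by (metis mult.assoc times_scaleC_left)
    next
      case False
      then show ?thesis using \<A>(3)[OF AB(1), of n] n AB(3) by (metis less_antisym mult.assoc times_scaleC_left)
    qed
  qed
  then show ?case
    using refine_part[OF \<A>(1) \<B>(1)] \<A>(2) \<B>(2) by (intro exI[of _ "refine \<A> \<B>"]) auto
qed

text \<open>\<open>F - G\<close> commutes with the cells, so its norm is governed by the worst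
  single cell and the errors do not add up.\<close>

lemma simple_approx:
  assumes F: "F \<in> D" and e: "0 < e"
  obtains G where "simple G" "norm (F - G) \<le> e"
proof -
  obtain \<B> where \<B>: "part \<B>" "\<Sum>\<B> = 1" "\<And>B. B \<in> \<B> \<Longrightarrow> \<exists>c. norm ((F - c *\<^sub>C 1) * B) \<le> e"
    using spectral_cells[OF assms] by blast
  then obtain c where c: "\<And>B. B \<in> \<B> \<Longrightarrow> norm ((F - c B *\<^sub>C 1) * B) \<le> e" by metis
  define G where "G = (\<Sum>B\<in>\<B>. c B *\<^sub>C B)"
  have GD: "G \<in> D" unfolding G_def by (intro D_sum D_scaleC projs_D part_projs[OF \<B>(1)])
  have GB: "G * B = c B *\<^sub>C B" if B: "B \<in> \<B>" for B
  proof -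
    have "G * B = (\<Sum>A\<in>\<B>. if A = B then c B *\<^sub>C B else 0)"
      unfolding G_def sum_distrib_right
      using part_orth[OF \<B>(1) _ B] projs_idem[OF part_projs[OF \<B>(1) B]]
      by (intro sum.cong) (auto simp: times_scaleC_left)
    then show ?thesis using B part_finite[OF \<B>(1)] by simp
  qed
  have "norm (F - G) \<le> e"
  proof (rule norm_bop_le)
    fix x
    have "(norm ((F - G) \<cdot> x))\<^sup>2 = (\<Sum>B\<in>\<B>. (norm (B \<cdot> (F - G) \<cdot> x))\<^sup>2)" by (rule part_vector_sq[OF \<B>(1,2)])
    also have "\<dots> \<le> (\<Sum>B\<in>\<B>. e\<^sup>2 * (norm (B \<cdot> x))\<^sup>2)"
    proof (rule sum_mono)
      fix B assume B: "B \<in> \<B>"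
      then have Bp: "B \<in> projs" using \<B>(1) part_projs by blast
      have "B * (F - G) = (F - G) * B" by (rule D_commute[OF projs_D[OF Bp] D_diff[OF F GD]])
      also have "\<dots> = (F - c B *\<^sub>C 1) * B" by (simp add: left_diff_distrib GB[OF B] times_scaleC_left)
      also have "\<dots> = (F - c B *\<^sub>C 1) * B * B" using projs_idem[OF Bp] by (simp add: mult.assoc)
      finally have "B \<cdot> (F - G) \<cdot> x = ((F - c B *\<^sub>C 1) * B) \<cdot> B \<cdot> x" by (metis bop_times_apply)
      then have "norm (B \<cdot> (F - G) \<cdot> x) \<le> norm ((F - c B *\<^sub>C 1) * B) * norm (B \<cdot> x)"
        using norm_bop_apply_le by metis
      also have "\<dots> \<le> e * norm (B \<cdot> x)" by (rule mult_right_mono[OF c[OF B] norm_ge_zero])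
      finally show "(norm (B \<cdot> (F - G) \<cdot> x))\<^sup>2 \<le> e\<^sup>2 * (norm (B \<cdot> x))\<^sup>2"
        by (metis power_mono norm_ge_zero power_mult_distrib)
    qed
    also have "\<dots> = (e * norm x)\<^sup>2"
      by (simp add: power_mult_distrib part_vector_sq[OF \<B>(1,2), of x] sum_distrib_left)
    finally show "norm ((F - G) \<cdot> x) \<le> e * norm x" by (rule power2_le_imp_le) (use e in simp)
  qed (use e in simp)
  moreover have "simple G" unfolding simple_def using GD GB \<B>(1,2) by blast
  ultimately show ?thesis using that by blast
qed

text \<open>On a cell \<open>R\<close> where \<open>F\<close> is the scalar \<open>c R\<close>, both
  sides are \<open>(cmod (c R))\<^sup>2\<close> times those of the projection \<open>R * B\<close>.
  The inequality for projections is summed over the cells.\<close>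

lemma simple_chebyshev:
  fixes e :: "nat \<Rightarrow> 'h"
  assumes summ: "sq_summable e" and B: "B \<in> projs"
    and bound: "\<And>C. C \<in> projs \<Longrightarrow> C * B = C \<Longrightarrow> sq_sum (\<lambda>n. C \<cdot> e n) \<le> d * (norm (C \<cdot> \<xi>))\<^sup>2"
    and F: "simple F" "F * B = F"
  shows "sq_sum (\<lambda>n. F \<cdot> e n) \<le> d * (norm (F \<cdot> \<xi>))\<^sup>2"
proof -
  obtain \<R> where \<R>: "part \<R>" "\<Sum>\<R> = 1" "\<And>R. R \<in> \<R> \<Longrightarrow> \<exists>c. F * R = c *\<^sub>C R"
    using F(1) unfolding simple_def by metis
  then obtain c where c: "\<And>R. R \<in> \<R> \<Longrightarrow> F * R = c R *\<^sub>C R" by metis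
  have RB: "R * B \<in> projs" if "R \<in> \<R>" for R using that \<R>(1) B part_projs projs_times by blast
  have sq: "(norm (F \<cdot> x))\<^sup>2 = (\<Sum>R\<in>\<R>. (cmod (c R))\<^sup>2 * (norm ((R * B) \<cdot> x))\<^sup>2)" for x
    unfolding part_vector_sq[OF \<R>(1,2), of "F \<cdot> x"]
  proof (rule sum.cong)
    fix R assume R: "R \<in> \<R>"
    have "R * F = F * R" using D_commute part_projs[OF \<R>(1) R] projs_D simple_D[OF F(1)] by metis
    then have "R * F = c R *\<^sub>C (R * B)" using c[OF R] F(2) by (metis mult.assoc times_scaleC_left)
    then have "R \<cdot> F \<cdot> x = c R *\<^sub>C ((R * B) \<cdot> x)" by (metis bop_times_apply scaleC_bop_apply)
    then show "(norm (R \<cdot> F \<cdot> x))\<^sup>2 = (cmod (c R))\<^sup>2 * (norm ((R * B) \<cdot> x))\<^sup>2"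
      by (simp add: norm_scaleC power_mult_distrib)
  qed simp
  note sm = summable_l2_apply[OF summ]
  have "sq_sum (\<lambda>n. F \<cdot> e n) = (\<Sum>R\<in>\<R>. (cmod (c R))\<^sup>2 * sq_sum (\<lambda>n. (R * B) \<cdot> e n))"
    unfolding sq using sm by (subst suminf_sum) (auto intro!: sum.cong suminf_mult summable_mult)
  also have "\<dots> \<le> (\<Sum>R\<in>\<R>. (cmod (c R))\<^sup>2 * (d * (norm ((R * B) \<cdot> \<xi>))\<^sup>2))"
    using bound[OF RB] projs_idem[OF B] by (intro sum_mono mult_left_mono) (auto simp: mult.assoc)
  also have "\<dots> = d * (norm (F \<cdot> \<xi>))\<^sup>2" unfolding sq by (simp add: sum_distrib_left mult_ac)
  finally show ?thesis .
qed

end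

section \<open>Weak* continuous functionals\<close>

definition lin_functional :: "('h::complex_normed_vector bop \<Rightarrow> complex) \<Rightarrow> bool" where
  "lin_functional f \<longleftrightarrow> (\<forall>S T. f (S + T) = f S + f T) \<and> (\<forall>c T. f (c *\<^sub>C T) = c * f T)"

lemma lin_functional_diff: "lin_functional f \<Longrightarrow> f (S - T) = f S - f T"
  unfolding lin_functional_def by (metis add_diff_cancel_right' diff_add_cancel)

lemma lin_functional_scale: "lin_functional f \<Longrightarrow> f (c *\<^sub>C T) = c * f T"
  unfolding lin_functional_def by blast

text \<open>Cauchy-Schwarz twice, in the Hilbert space for each term and in \<ell>2 for the partial
  sums. The bounds \<open>s\<close>, \<open>t\<close> enter squared to match the estimates by
  exhaustion.\<close>

lemma l2_pairing:
  fixes a b :: "nat \<Rightarrow> 'h::chilbert_space"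
  assumes a: "sq_summable a" "sq_sum a \<le> s\<^sup>2" "0 \<le> s"
    and b: "sq_summable b" "sq_sum b \<le> t\<^sup>2" "0 \<le> t"
  shows "summable (\<lambda>n. cinner (T \<cdot> a n) (b n))"
    "cmod (\<Sum>n. cinner (T \<cdot> a n) (b n)) \<le> norm T * (s * t)"
proof -
  have term_le: "cmod (cinner (T \<cdot> a n) (b n)) \<le> norm T * (norm (a n) * norm (b n))" for n
    using order_trans[OF cauchy_schwarz mult_right_mono[OF norm_bop_apply_le norm_ge_zero]]
    by (simp add: mult.assoc)
  have part: "(\<Sum>n<N. norm (a n) * norm (b n)) \<le> s * t" for N
  proof -
    have "(\<Sum>n<N. norm (a n) * norm (b n)) \<le> L2_set (\<lambda>n. norm (a n)) {..<N} * L2_set (\<lambda>n. norm (b n)) {..<N}"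
      using L2_set_mult_ineq[of "\<lambda>n. norm (a n)" "\<lambda>n. norm (b n)" "{..<N}"] by simp
    also have "\<dots> \<le> s * t"
    proof (intro mult_mono L2_set_nonneg)
      show "L2_set (\<lambda>n. norm (a n)) {..<N} \<le> s"
        unfolding L2_set_def
        using order_trans[OF sum_le_suminf[OF a(1), of "{..<N}"] a(2)] a(3) by (intro real_le_lsqrt) (auto simp: sum_nonneg)
      show "L2_set (\<lambda>n. norm (b n)) {..<N} \<le> t"
        unfolding L2_set_def
        using order_trans[OF sum_le_suminf[OF b(1), of "{..<N}"] b(2)] b(3) by (intro real_le_lsqrt) (auto simp: sum_nonneg)
    qed (use a in auto)
    finally show ?thesis .
  qed
  have sm: "summable (\<lambda>n. norm (a n) * norm (b n))"
    by (rule summableI_nonneg_bounded[where x = "s * t"]) (use part in auto)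
  have smT: "summable (\<lambda>n. norm T * (norm (a n) * norm (b n)))" by (rule summable_mult[OF sm])
  have smc: "summable (\<lambda>n. cmod (cinner (T \<cdot> a n) (b n)))"
    by (rule summable_comparison_test'[OF smT, of 0]) (use term_le in simp)
  then show "summable (\<lambda>n. cinner (T \<cdot> a n) (b n))" by (rule summable_norm_cancel)
  have "cmod (\<Sum>n. cinner (T \<cdot> a n) (b n)) \<le> (\<Sum>n. cmod (cinner (T \<cdot> a n) (b n)))"
    by (rule summable_norm[OF smc])
  also have "\<dots> \<le> (\<Sum>n. norm T * (norm (a n) * norm (b n)))"
    by (rule suminf_le[OF term_le smc smT])
  also have "\<dots> = norm T * (\<Sum>n. norm (a n) * norm (b n))" by (rule suminf_mult[OF sm])
  also have "\<dots> \<le> norm T * (s * t)"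
    by (intro mult_left_mono suminf_le_const[OF sm] part) auto
  finally show "cmod (\<Sum>n. cinner (T \<cdot> a n) (b n)) \<le> norm T * (s * t)" .
qed

lemma l2_pairing_summable:
  fixes a b :: "nat \<Rightarrow> 'h::chilbert_space"
  assumes "sq_summable a" "sq_summable b"
  shows "summable (\<lambda>n. cinner (T \<cdot> a n) (b n))"
  by (rule l2_pairing[where s = "sqrt (sq_sum a)" and t = "sqrt (sq_sum b)"])
    (use assms in \<open>auto simp: suminf_nonneg\<close>)

lemma weak_star_functionalI:
  fixes x y :: "nat \<Rightarrow> 'h::chilbert_space"
  assumes "sq_summable x" "sq_summable y"
    and "\<And>T. f T = (\<Sum>n. cinner (T \<cdot> x n) (y n))"
  shows "f \<in> weak_star_functionals"
proof -
  have "f = (\<lambda>T. \<Sum>n. cinner (T \<cdot> x n) (y n))" using assms(3) by blast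
  then show ?thesis unfolding weak_star_functionals_def using assms(1,2) by blast
qed

lemma weak_star_functionalE:
  assumes "f \<in> weak_star_functionals"
  obtains x y :: "nat \<Rightarrow> 'h::chilbert_space"
  where "sq_summable x" "sq_summable y"
    "f = (\<lambda>T. \<Sum>n. cinner (T \<cdot> x n) (y n))"
  using assms unfolding weak_star_functionals_def by blast

lemma weak_star_functional_lin: "f \<in> weak_star_functionals \<Longrightarrow> lin_functional f"
  unfolding lin_functional_def
  by (elim weak_star_functionalE)
    (auto simp: bop_simps cinner_simps suminf_add[symmetric] suminf_mult[symmetric] l2_pairing_summable
      intro!: suminf_add[symmetric] suminf_mult)

lemma weak_star_functional_scale:
  assumes "f \<in> weak_star_functionals"
  shows "(\<lambda>T. c * f T) \<in> weak_star_functionals"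
proof -
  obtain x y where x: "sq_summable x" "sq_summable y"
    and f: "f = (\<lambda>T. \<Sum>n. cinner (T \<cdot> x n) (y n))" by (rule weak_star_functionalE[OF assms])
  show ?thesis
  proof (rule weak_star_functionalI)
    show "sq_summable (\<lambda>n. c *\<^sub>C x n)"
      using summable_mult[OF x(1), of "(cmod c)\<^sup>2"] by (simp add: norm_scaleC power_mult_distrib)
    show "c * f T = (\<Sum>n. cinner (T \<cdot> (c *\<^sub>C x n)) (y n))" for T
      unfolding f bop_apply_scaleC cinner_scaleC_left
      by (rule suminf_mult[symmetric]) (rule l2_pairing_summable[OF x])
  qed (fact x)
qed

lemma sums_if_complex:
  fixes f g :: "nat \<Rightarrow> complex"
  assumes "g sums x" "f sums y"
  shows "(\<lambda>n. if even n then f (n div 2) else g ((n - 1) div 2)) sums (x + y)"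
  using sums_if[of "\<lambda>n. Re (g n)" "Re x" "\<lambda>n. Re (f n)" "Re y"]
    sums_if[of "\<lambda>n. Im (g n)" "Im x" "\<lambda>n. Im (f n)" "Im y"] assms
  by (simp add: sums_complex_iff if_distrib)

text \<open>Interleaving keeps the format of one pair of square summable sequences: even indices
  carry \<open>f\<close>, odd ones carry \<open>g\<close>.\<close>

lemma weak_star_functional_add:
  assumes "f \<in> weak_star_functionals" "g \<in> weak_star_functionals"
  shows "(\<lambda>T. f T + g T) \<in> weak_star_functionals"
proof -
  obtain x y where x: "sq_summable x" "sq_summable y"
    and f: "f = (\<lambda>T. \<Sum>n. cinner (T \<cdot> x n) (y n))" by (rule weak_star_functionalE[OF assms(1)])
  obtain x' y' where x': "sq_summable x'" "sq_summable y'"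
    and g: "g = (\<lambda>T. \<Sum>n. cinner (T \<cdot> x' n) (y' n))" by (rule weak_star_functionalE[OF assms(2)])
  let ?mix = "\<lambda>u v n. if even n then v (n div 2) else u ((n - 1) div 2)"
  have sm: "sq_summable (\<lambda>n. ?mix u v n)"
    if "sq_summable u" "sq_summable v" for u v :: "nat \<Rightarrow> 'a"
  proof -
    have eq: "(\<lambda>n. (norm (?mix u v n))\<^sup>2) = ?mix (\<lambda>n. (norm (u n))\<^sup>2) (\<lambda>n. (norm (v n))\<^sup>2)"
      by (rule ext) simp
    show ?thesis
      unfolding eq
      by (rule sums_summable[OF sums_if[OF summable_sums[OF that(1)] summable_sums[OF that(2)]]])
  qed
  show ?thesis
  proof (rule weak_star_functionalI)
    show "sq_summable (\<lambda>n. ?mix x' x n)" by (rule sm[OF x'(1) x(1)])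
    show "sq_summable (\<lambda>n. ?mix y' y n)" by (rule sm[OF x'(2) x(2)])
    fix T
    have eq: "(\<lambda>n. cinner (T \<cdot> ?mix x' x n) (?mix y' y n))
        = ?mix (\<lambda>n. cinner (T \<cdot> x' n) (y' n)) (\<lambda>n. cinner (T \<cdot> x n) (y n))" by (rule ext) simp
    have "(\<lambda>n. cinner (T \<cdot> ?mix x' x n) (?mix y' y n)) sums (g T + f T)"
      unfolding f g eq by (intro sums_if_complex summable_sums l2_pairing_summable x x')
    then show "f T + g T = (\<Sum>n. cinner (T \<cdot> ?mix x' x n) (?mix y' y n))"
      by (simp only: sums_iff add.commute)
  qed
qed

lemma weak_star_functional_vector: "(\<lambda>T. cinner (T \<cdot> \<xi>) \<eta>) \<in> weak_star_functionals"
proof (rule weak_star_functionalI)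
  let ?x = "\<lambda>v n. if n = (0::nat) then v else 0"
  show "sq_summable (\<lambda>n. ?x \<xi> n)" "sq_summable (\<lambda>n. ?x \<eta> n)"
    by (rule summable_finite[of "{0}"]; simp)+
  show "cinner (T \<cdot> \<xi>) \<eta> = (\<Sum>n. cinner (T \<cdot> ?x \<xi> n) (?x \<eta> n))" for T
    by (subst suminf_finite[of "{0}"]) (auto simp: bop_apply_0 cinner_simps)
qed

text \<open>Such an \<open>f\<close> is a linear combination of the functionals in \<open>F\<close>.
  The coefficient of \<open>w\<close> is read off at some \<open>V\<close> that the other
  functionals kill and \<open>w\<close> does not; if there is no such \<open>V\<close>, then
  \<open>w\<close> vanishes on the common kernel of the others and can be left out.\<close>

lemma weak_star_functional_of_kernels:
  assumes "finite F" "F \<subseteq> weak_star_functionals" "lin_functional f" "\<And>T. (\<And>w. w \<in> F \<Longrightarrow> w T = 0) \<Longrightarrow> f T = 0"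
  shows "f \<in> weak_star_functionals"
  using assms
proof (induction F arbitrary: f rule: finite_induct)
  case empty
  then have "f = (\<lambda>T. 0 * cinner (T \<cdot> 0) 0)" by auto
  then show ?case using weak_star_functional_scale[OF weak_star_functional_vector] by metis
next
  case (insert w F)
  have w: "w \<in> weak_star_functionals" "lin_functional w" using insert weak_star_functional_lin by auto
  have lin: "lin_functional v" if "v \<in> F" for v using insert that weak_star_functional_lin by auto
  show ?case
  proof (cases "\<exists>V. (\<forall>v\<in>F. v V = 0) \<and> w V \<noteq> 0")
    case True
    then obtain V where V: "\<And>v. v \<in> F \<Longrightarrow> v V = 0" "w V \<noteq> 0" by blast
    define c where "c = f V / w V"
    have "(\<lambda>T. f T - c * w T) \<in> weak_star_functionals"
    proof (rule insert.IH)
      show "lin_functional (\<lambda>T. f T - c * w T)"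
        using insert.prems(2) w(2) by (simp add: lin_functional_def algebra_simps)
      fix T assume T: "\<And>v. v \<in> F \<Longrightarrow> v T = 0"
      have "f (T - (w T / w V) *\<^sub>C V) = 0"
      proof (rule insert.prems(3))
        fix v assume "v \<in> insert w F"
        then consider "v = w" | "v \<in> F" "v T = 0" "v V = 0" using T V by blast
        then show "v (T - (w T / w V) *\<^sub>C V) = 0"
          using V(2) lin w(2) by cases (simp_all add: lin_functional_diff lin_functional_scale)
      qed
      then show "f T - c * w T = 0"
        using insert.prems(2) by (simp add: lin_functional_diff lin_functional_scale c_def)
    qed (use insert.prems in auto)
    from weak_star_functional_add[OF this weak_star_functional_scale[OF w(1), of c]] show ?thesis by simp
  next
    case False
    show ?thesis
    proof (rule insert.IH)
      show "f T = 0" if "\<And>v. v \<in> F \<Longrightarrow> v T = 0" for T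
        using insert.prems(3)[of T] False that by blast
    qed (use insert.prems in auto)
  qed
qed

section \<open>Continuity in the weak* topology\<close>

lemma weak_star_neighbourhood:
  assumes "openin weak_star_topology V" "T0 \<in> V"
  shows "\<exists>F e. finite F \<and> F \<subseteq> weak_star_functionals \<and> 0 < e \<and> (\<forall>T. (\<forall>w\<in>F. dist (w T) (w T0) < e) \<longrightarrow> T \<in> V)"
proof -
  have "generate_topology_on {w -` U | w U. w \<in> weak_star_functionals \<and> open U} V"
    using assms(1) unfolding weak_star_topology_def openin_topology_generated_by_iff .
  then show ?thesis using assms(2)
  proof induction
    case (Int V W)
    obtain F e where F: "finite F" "F \<subseteq> weak_star_functionals" "0 < e"
      "\<forall>T. (\<forall>w\<in>F. dist (w T) (w T0) < e) \<longrightarrow> T \<in> V" using Int by auto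
    obtain G d where G: "finite G" "G \<subseteq> weak_star_functionals" "0 < d"
      "\<forall>T. (\<forall>w\<in>G. dist (w T) (w T0) < d) \<longrightarrow> T \<in> W" using Int by auto
    have "T \<in> V \<inter> W" if "\<forall>w\<in>F \<union> G. dist (w T) (w T0) < min e d" for T
      using that F(4) G(4) by simp
    then show ?case using F(1-3) G(1-3) by (intro exI[of _ "F \<union> G"] exI[of _ "min e d"]) simp
  next
    case (UN K)
    then obtain V where V: "V \<in> K" "T0 \<in> V" by blast
    show ?case using UN.IH[OF V] V(1) by blast
  next
    case (Basis V)
    then obtain w U where w: "w \<in> weak_star_functionals" "open U" "V = w -` U" by blast
    then obtain e where "0 < e" "\<forall>z. dist z (w T0) < e \<longrightarrow> z \<in> U" using Basis.prems unfolding open_dist by auto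
    then show ?case using w by (intro exI[of _ "{w}"] exI[of _ e]) auto
  qed simp
qed

lemma topspace_weak_star: "topspace weak_star_topology = UNIV"
proof -
  have "UNIV \<in> {w -` U | w U. w \<in> (weak_star_functionals :: ('a bop \<Rightarrow> complex) set) \<and> open U}"
    by (intro CollectI exI[of _ "\<lambda>T. cinner (T \<cdot> 0) 0"] exI[of _ UNIV])
      (simp add: weak_star_functional_vector)
  then show ?thesis unfolding weak_star_topology_def topology_generated_by_topspace by blast
qed

lemma weak_star_functional_continuous:
  assumes "w \<in> weak_star_functionals"
  shows "continuous_map weak_star_topology euclidean w"
  unfolding continuous_map_def topspace_weak_star
proof (intro conjI allI impI)
  fix U :: "complex set" assume "openin euclidean U"
  then have "w -` U \<in> {w -` U | w U. w \<in> weak_star_functionals \<and> open U}" using assms by auto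
  then have "openin weak_star_topology (w -` U)"
    unfolding weak_star_topology_def by (rule topology_generated_by_Basis)
  then show "openin weak_star_topology {x \<in> UNIV. w x \<in> U}" by (simp add: vimage_def)
qed simp

text \<open>Continuity at 0 gives finitely many pairings on whose common kernel \<open>f\<close> is
  less than 1 in modulus. That kernel is closed under scaling, so \<open>f\<close> vanishes on it
  and is a combination of these pairings.\<close>

lemma weak_star_functional_iff_continuous:
  "f \<in> weak_star_functionals \<longleftrightarrow> lin_functional f \<and> continuous_map weak_star_topology euclidean f"
proof (intro iffI conjI)
  assume f: "lin_functional f \<and> continuous_map weak_star_topology euclidean f"
  have f0: "f 0 = 0" using f lin_functional_diff[of f 0 0] by simp
  have "openin weak_star_topology {T \<in> topspace weak_star_topology. f T \<in> ball 0 1}"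
    using openin_continuous_map_preimage[OF conjunct2[OF f], of "ball 0 1"] by simp
  moreover have "0 \<in> {T \<in> topspace weak_star_topology. f T \<in> ball 0 1}" by (simp add: topspace_weak_star f0)
  ultimately obtain F e where F: "finite F" "F \<subseteq> weak_star_functionals" "0 < e"
    "\<And>T. (\<And>w. w \<in> F \<Longrightarrow> dist (w T) (w 0) < e) \<Longrightarrow> f T \<in> ball 0 1"
    using weak_star_neighbourhood by (smt (verit, del_insts) mem_Collect_eq)
  show "f \<in> weak_star_functionals"
  proof (rule weak_star_functional_of_kernels[OF F(1,2)])
    fix T assume T: "\<And>w. w \<in> F \<Longrightarrow> w T = 0"
    show "f T = 0"
    proof (rule ccontr)
      assume nz: "f T \<noteq> 0"
      have "f (inverse (f T) *\<^sub>C T) \<in> ball 0 1"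
      proof (rule F(4))
        fix w assume w: "w \<in> F"
        then have "lin_functional w" using F(2) weak_star_functional_lin by blast
        then show "dist (w (inverse (f T) *\<^sub>C T)) (w 0) < e"
          using T[OF w] F(3) lin_functional_diff[of w 0 0] by (simp add: lin_functional_def)
      qed
      then show False using f nz by (simp add: lin_functional_def)
    qed
  qed (use f in blast)
qed (simp_all add: weak_star_functional_lin weak_star_functional_continuous)

lemma continuous_map_into_weak_star:
  fixes g :: "'a \<Rightarrow> 'b::chilbert_space bop"
  shows "continuous_map X weak_star_topology g \<longleftrightarrow>
    (\<forall>w\<in>weak_star_functionals. continuous_map X euclidean (\<lambda>x. w (g x)))"
proof (intro iffI ballI)
  fix w :: "'b bop \<Rightarrow> complex"
  assume "continuous_map X weak_star_topology g" "w \<in> weak_star_functionals"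
  then show "continuous_map X euclidean (\<lambda>x. w (g x))"
    using continuous_map_compose[OF _ weak_star_functional_continuous] by (force simp: o_def)
next
  assume *: "\<forall>w\<in>weak_star_functionals. continuous_map X euclidean (\<lambda>x. w (g x))"
  show "continuous_map X weak_star_topology g"
    unfolding weak_star_topology_def
  proof (rule continuous_on_generated_topo)
    fix V :: "'b bop set" assume "V \<in> {w -` U | w U. w \<in> weak_star_functionals \<and> open U}"
    then obtain w U where w: "w \<in> weak_star_functionals" "open U" "V = w -` U" by blast
    have "openin X {x \<in> topspace X. w (g x) \<in> U}"
      using * w openin_continuous_map_preimage[of X euclidean "\<lambda>x. w (g x)" U] by auto
    then show "openin X (g -` V \<inter> topspace X)" by (simp add: w(3) vimage_def Int_def conj_commute)
  next
    have "g ` topspace X \<subseteq> topspace weak_star_topology" by (simp add: topspace_weak_star)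
    then show "g ` topspace X \<subseteq> \<Union> {w -` U | w U. w \<in> weak_star_functionals \<and> open U}"
      unfolding weak_star_topology_def topology_generated_by_topspace .
  qed
qed

text \<open>The form in which weak* continuity enters the analysis: a matrix coefficient of
  \<open>\<Phi> T\<close> is a trace pairing with \<open>T\<close>. The sequences depend on
  \<open>\<xi>\<close> and \<open>\<eta>\<close>.\<close>

lemma schur_multiplier_functional:
  assumes "schur_multiplier D \<Phi>"
  obtains x y :: "nat \<Rightarrow> 'h::chilbert_space"
  where "sq_summable x" "sq_summable y"
    "\<And>T. cinner (\<Phi> T \<cdot> \<xi>) \<eta> = (\<Sum>n. cinner (T \<cdot> x n) (y n))"
proof -
  have "lin_functional (\<lambda>T. cinner (\<Phi> T \<cdot> \<xi>) \<eta>)"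
    using assms by (simp add: schur_multiplier_def clinear_def lin_functional_def bop_simps cinner_simps)
  moreover have "continuous_map weak_star_topology euclidean (\<lambda>T. cinner (\<Phi> T \<cdot> \<xi>) \<eta>)"
    using assms bspec[OF _ weak_star_functional_vector[of \<xi> \<eta>]]
    unfolding schur_multiplier_def continuous_map_into_weak_star by auto
  ultimately have "(\<lambda>T. cinner (\<Phi> T \<cdot> \<xi>) \<eta>) \<in> weak_star_functionals"
    by (simp add: weak_star_functional_iff_continuous)
  then obtain x y where xy: "sq_summable x" "sq_summable y"
    "(\<lambda>T. cinner (\<Phi> T \<cdot> \<xi>) \<eta>) = (\<lambda>T. \<Sum>n. cinner (T \<cdot> x n) (y n))"
    by (rule weak_star_functionalE)
  show ?thesis by (rule that[OF xy(1,2) fun_cong[OF xy(3)]])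
qed

section \<open>Corners on which a Schur idempotent is trivial\<close>

lemma summable_l2_diff_finite:
  fixes x y :: "nat \<Rightarrow> 'h::chilbert_space"
  assumes "sq_summable x" "\<And>n. N \<le> n \<Longrightarrow> y n = 0"
  shows "sq_summable (\<lambda>n. x n - y n)"
proof -
  have "eventually (\<lambda>n. (norm (x n - y n))\<^sup>2 = (norm (x n))\<^sup>2) sequentially"
    using assms(2) unfolding eventually_sequentially by (intro exI[of _ N]) simp
  then show ?thesis using assms(1) summable_cong by fast
qed

lemma bounded_bilinear_cinner: "bounded_bilinear (cinner :: 'h::chilbert_space \<Rightarrow> 'h \<Rightarrow> complex)"
proof
  show "\<exists>K. \<forall>a b :: 'h. norm (cinner a b) \<le> norm a * norm b * K"
    using cauchy_schwarz by (metis mult.right_neutral)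
qed (simp_all add: cinner_simps cinner_scaleR_left cinner_scaleR_right scaleR_conv_of_real)

context masa_algebra
begin

text \<open>Formally its vectors are products of \<open>\<xi>\<close> with functions that may be
  unbounded; the closure is what admits those outside \<open>D\<close>.\<close>

definition cyclic :: "'h \<Rightarrow> 'h set" where "cyclic \<xi> = closure ((\<lambda>F. F \<cdot> \<xi>) ` D)"

lemma cyclic_projection:
  obtains Q where "Q \<in> projs" "Q \<cdot> \<xi> = \<xi>" "\<And>x. Q \<cdot> x \<in> cyclic \<xi>"
proof -
  let ?K = "(\<lambda>F. F \<cdot> \<xi>) ` D"
  have sub: "csubspace ?K"
    unfolding csubspace_def
  proof (intro conjI ballI allI)
    show "0 \<in> ?K" by (rule image_eqI[OF _ D_0]) (simp add: zero_bop_apply)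
    fix x y assume "x \<in> ?K" "y \<in> ?K"
    then obtain F G where "F \<in> D" "G \<in> D" "x + y = (F + G) \<cdot> \<xi>" by (auto simp: plus_bop_apply)
    then show "x + y \<in> ?K" by (intro image_eqI[of _ _ "F + G"] D_add)
  next
    fix c x assume "x \<in> ?K"
    then obtain F where "F \<in> D" "c *\<^sub>C x = (c *\<^sub>C F) \<cdot> \<xi>" by (auto simp: scaleC_bop_apply)
    then show "c *\<^sub>C x \<in> ?K" by (intro image_eqI[of _ _ "c *\<^sub>C F"] D_scaleC)
  qed
  have inv: "T \<cdot> x \<in> ?K" if T: "T \<in> D" and x: "x \<in> ?K" for T x
  proof -
    obtain F where "F \<in> D" "T \<cdot> x = (T * F) \<cdot> \<xi>" using x by (auto simp: bop_times_apply)
    then show ?thesis by (intro image_eqI[of _ _ "T * F"] D_times[OF T])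
  qed
  have inv': "T \<cdot> x \<in> closure ?K" if "T \<in> D" "x \<in> closure ?K" for T x
    by (rule closure_invariant[OF inv[OF that(1)] that(2)])
  show ?thesis
  proof (rule projs_onto[OF closure_csubspace[OF sub] closed_closure inv'])
    fix Q assume Q: "Q \<in> projs" "\<And>x. Q \<cdot> x \<in> closure ?K" "\<And>x. x \<in> closure ?K \<Longrightarrow> Q \<cdot> x = x"
    have "\<xi> \<in> ?K" by (rule image_eqI[OF _ D_1]) simp
    then have "Q \<cdot> \<xi> = \<xi>" by (intro Q(3) subsetD[OF closure_subset])
    then show ?thesis using that Q(1,2) unfolding cyclic_def by auto
  qed
qed

lemma cyclic_simple_approx:
  assumes "x \<in> cyclic \<xi>" "0 < e"
  obtains C where "simple C" "norm (x - C \<cdot> \<xi>) < e"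
proof -
  obtain F where F: "F \<in> D" "dist (F \<cdot> \<xi>) x < e / 2"
    using assms(1) half_gt_zero[OF assms(2)] unfolding cyclic_def closure_approachable by blast
  then have Fx: "norm (x - F \<cdot> \<xi>) < e / 2" by (simp add: dist_norm norm_minus_commute)
  have pos: "0 < e / (2 * (1 + norm \<xi>))" using assms(2) by (simp add: add_pos_nonneg)
  obtain C where C: "simple C" "norm (F - C) \<le> e / (2 * (1 + norm \<xi>))"
    using simple_approx[OF F(1) pos] by blast
  have "norm (F \<cdot> \<xi> - C \<cdot> \<xi>) \<le> norm (F - C) * norm \<xi>"
    using norm_bop_apply_le[of "F - C" \<xi>] by (simp add: minus_bop_apply)
  also have "\<dots> \<le> e / (2 * (1 + norm \<xi>)) * (1 + norm \<xi>)" using C(2) pos by (intro mult_mono) auto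
  also have "\<dots> = e / 2"
    using add_pos_nonneg[OF zero_less_one norm_ge_zero[of \<xi>]] by (simp add: field_simps)
  finally have "norm (x - C \<cdot> \<xi>) < e"
    using Fx norm_triangle_ineq[of "x - F \<cdot> \<xi>" "F \<cdot> \<xi> - C \<cdot> \<xi>"] by simp
  then show ?thesis using that C(1) by blast
qed

lemma cyclic_simple_sequence:
  assumes "x \<in> cyclic \<xi>" "B \<in> projs" "B \<cdot> x = x"
  obtains C where "\<And>n::nat. simple (C n)" "\<And>n. C n * B = C n" "(\<lambda>n. C n \<cdot> \<xi>) \<longlonglongrightarrow> x"
proof -
  have "\<exists>C. simple C \<and> norm (x - C \<cdot> \<xi>) < inverse (real (Suc n))" for n
    using cyclic_simple_approx[OF assms(1), of "inverse (real (Suc n))"] by auto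
  then obtain C where C: "\<And>n. simple (C n)" "\<And>n. norm (x - C n \<cdot> \<xi>) < inverse (real (Suc n))" by metis
  have "(\<lambda>n. C n \<cdot> \<xi>) \<longlonglongrightarrow> x"
  proof (rule LIMSEQ_I)
    fix r :: real assume "0 < r"
    then obtain N where N: "inverse (real (Suc N)) < r" using reals_Archimedean by blast
    have "norm (C n \<cdot> \<xi> - x) < r" if "N \<le> n" for n
    proof -
      have "inverse (real (Suc n)) \<le> inverse (real (Suc N))" using that by (simp add: field_simps)
      then have "norm (x - C n \<cdot> \<xi>) < r" using C(2)[of n] N by linarith
      then show ?thesis by (simp add: norm_minus_commute)
    qed
    then show "\<exists>N. \<forall>n\<ge>N. norm (C n \<cdot> \<xi> - x) < r" by blast
  qed
  then have "(\<lambda>n. (C n * B) \<cdot> \<xi>) \<longlonglongrightarrow> x"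
    using bounded_linear.tendsto[OF bounded_linear_bop_apply, of "\<lambda>n. C n \<cdot> \<xi>" x _ B] assms(3)
      D_commute[OF simple_D[OF C(1)] projs_D[OF assms(2)]]
    by (simp add: bop_times_apply)
  moreover have "C n * B * B = C n * B" for n using projs_idem[OF assms(2)] by (simp add: mult.assoc)
  moreover have "simple (C n * B)" for n by (intro simple_times C simple_projs assms)
  ultimately show ?thesis using that[of "\<lambda>n. C n * B"] by blast
qed

text \<open>Formally \<open>x n = b n \<cdot> \<xi>\<close> for unbounded functions \<open>b n\<close> of \<open>D\<close>.  Below a cell \<open>B\<close>, the
  \<open>\<ell>\<^sup>2\<close>-valued function \<open>b\<close> is bounded by \<open>N\<close> and within \<open>d\<close> of the constant \<open>\<beta>\<close>.\<close>

definition nearly_constant :: "'h \<Rightarrow> (nat \<Rightarrow> 'h) \<Rightarrow> real \<Rightarrow> real \<Rightarrow> 'h bop \<Rightarrow> bool" where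
  "nearly_constant \<xi> x N d B \<longleftrightarrow> (\<forall>v. B \<cdot> v \<in> cyclic \<xi>) \<and>
    (\<forall>F. simple F \<longrightarrow> F * B = F \<longrightarrow> sq_sum (\<lambda>n. F \<cdot> x n) \<le> N\<^sup>2 * (norm (F \<cdot> \<xi>))\<^sup>2) \<and>
    (\<exists>\<beta> K. (\<forall>n\<ge>K. \<beta> n = 0) \<and> (\<forall>F. simple F \<longrightarrow> F * B = F \<longrightarrow>
      sq_sum (\<lambda>n. F \<cdot> (x n - \<beta> n *\<^sub>C \<xi>)) \<le> d\<^sup>2 * (norm (F \<cdot> \<xi>))\<^sup>2))"

text \<open>Below \<open>B0\<close> the sequence is bounded by \<open>N\<close>. Simple functions
  replace its first \<open>K\<close> terms and 0 its tail, with an error \<open>z\<close> so small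
  in square sum that below \<open>B1\<close> it is bounded by \<open>d\<close>. On the cells in
  \<open>\<R>\<close> those simple functions are constant. Restricting to \<open>B0\<close> and to
  \<open>B1\<close> changes \<open>\<xi>\<close> by at most \<open>e\<close> each, whence the bound
  \<open>2 * e\<close>.\<close>

lemma nearly_constant_cells:
  fixes x :: "nat \<Rightarrow> 'h"
  assumes x: "sq_summable x" "\<And>n. x n \<in> cyclic \<xi>"
    and N: "0 < N" "sq_sum x \<le> (N * e)\<^sup>2" and d: "0 < d" and e: "0 < e"
  obtains \<B> where "part \<B>" "norm (\<xi> - \<Sum>\<B> \<cdot> \<xi>) \<le> 2 * e"
    "\<And>B. B \<in> \<B> \<Longrightarrow> nearly_constant \<xi> x N d B"
proof -
  obtain Q where Q: "Q \<in> projs" "Q \<cdot> \<xi> = \<xi>" "\<And>v. Q \<cdot> v \<in> cyclic \<xi>" using cyclic_projection by blast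
  obtain B0 where B0: "B0 \<in> projs" "N\<^sup>2 * (norm (\<xi> - B0 \<cdot> \<xi>))\<^sup>2 \<le> sq_sum x"
    "\<And>C. C \<in> projs \<Longrightarrow> C * B0 = C \<Longrightarrow> sq_sum (\<lambda>n. C \<cdot> x n) \<le> N\<^sup>2 * (norm (C \<cdot> \<xi>))\<^sup>2"
    using chebyshev_projection[OF x(1) N(1)] by blast
  have "(N * norm (\<xi> - B0 \<cdot> \<xi>))\<^sup>2 \<le> (N * e)\<^sup>2" using B0(2) N(2) by (simp add: power_mult_distrib)
  then have "N * norm (\<xi> - B0 \<cdot> \<xi>) \<le> N * e" by (rule power2_le_imp_le) (use N e in simp)
  then have close0: "norm (\<xi> - B0 \<cdot> \<xi>) \<le> e" using N(1) by simp
  \<comment> \<open>An error of square sum at most \<open>(d * e)\<^sup>2\<close> lets exhaustion at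
    height \<open>d\<close> discard a part of \<open>\<xi>\<close> of norm at most
    \<open>e\<close>.\<close>
  define t where "t = d * e"
  have t: "0 < t" using d e by (simp add: t_def)
  obtain K where K: "\<And>n. K \<le> n \<Longrightarrow> norm (\<Sum>i. (norm (x (i + n)))\<^sup>2) < t\<^sup>2 / 2"
    using suminf_exist_split[OF _ x(1), of "t\<^sup>2 / 2"] t by auto
  \<comment> \<open>Half of the square error is left to the tail, the other half is shared by the
    first \<open>K\<close> terms; \<open>Suc K\<close> avoids a zero denominator.\<close>
  have "\<exists>C. simple C \<and> (norm (x n - C \<cdot> \<xi>))\<^sup>2 \<le> t\<^sup>2 / (2 * real (Suc K))" for n
  proof -
    have pos: "0 < t\<^sup>2 / (2 * real (Suc K))" using t by simp
    obtain C where "simple C" "norm (x n - C \<cdot> \<xi>) < sqrt (t\<^sup>2 / (2 * real (Suc K)))"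
      using cyclic_simple_approx[OF x(2)[of n], of "sqrt (t\<^sup>2 / (2 * real (Suc K)))"] pos by auto
    moreover from this have "(norm (x n - C \<cdot> \<xi>))\<^sup>2 \<le> (sqrt (t\<^sup>2 / (2 * real (Suc K))))\<^sup>2"
      by (intro power_mono) auto
    ultimately show ?thesis using pos by (intro exI[of _ C]) simp
  qed
  then obtain C0 where C0: "\<And>n. simple (C0 n)" "\<And>n. (norm (x n - C0 n \<cdot> \<xi>))\<^sup>2 \<le> t\<^sup>2 / (2 * real (Suc K))" by metis
  define C where "C n = (if n < K then C0 n else 0)" for n
  have C: "simple (C n)" for n using C0(1) simple_projs[OF projs_0] by (simp add: C_def)
  define z where "z n = x n - C n \<cdot> \<xi>" for n
  have z: "sq_summable z"
    unfolding z_def by (rule summable_l2_diff_finite[OF x(1), of K]) (simp add: C_def zero_bop_apply)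
  have z_small: "sq_sum z \<le> t\<^sup>2"
  proof -
    have "sq_sum z = sq_sum (\<lambda>n. z (n + K)) + (\<Sum>n<K. (norm (z n))\<^sup>2)"
      by (rule suminf_split_initial_segment[OF z])
    moreover have "sq_sum (\<lambda>n. z (n + K)) \<le> t\<^sup>2 / 2"
      using K[of K] by (simp add: z_def C_def zero_bop_apply)
    moreover have "(\<Sum>n<K. (norm (z n))\<^sup>2) \<le> (\<Sum>n<K. t\<^sup>2 / (2 * real (Suc K)))"
      by (rule sum_mono) (use C0(2) in \<open>simp add: z_def C_def\<close>)
    moreover have "(\<Sum>n<K. t\<^sup>2 / (2 * real (Suc K))) \<le> t\<^sup>2 / 2" by (simp add: field_simps)
    ultimately show ?thesis by linarith
  qed
  obtain B1 where B1: "B1 \<in> projs" "d\<^sup>2 * (norm (\<xi> - B1 \<cdot> \<xi>))\<^sup>2 \<le> sq_sum z"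
    "\<And>C. C \<in> projs \<Longrightarrow> C * B1 = C \<Longrightarrow> sq_sum (\<lambda>n. C \<cdot> z n) \<le> d\<^sup>2 * (norm (C \<cdot> \<xi>))\<^sup>2"
    using chebyshev_projection[OF z d] by blast
  have "(d * norm (\<xi> - B1 \<cdot> \<xi>))\<^sup>2 \<le> (d * e)\<^sup>2" using B1(2) z_small by (simp add: power_mult_distrib t_def)
  then have "d * norm (\<xi> - B1 \<cdot> \<xi>) \<le> d * e" by (rule power2_le_imp_le) (use d e in simp)
  then have close1: "norm (\<xi> - B1 \<cdot> \<xi>) \<le> e" using d by simp
  obtain \<R> where \<R>: "part \<R>" "\<Sum>\<R> = 1" "\<And>R n. R \<in> \<R> \<Longrightarrow> n < K \<Longrightarrow> \<exists>c. C n * R = c *\<^sub>C R"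
    using simple_common_partition[of C K, OF C] by blast
  define P where "P = B1 * B0 * Q"
  have P: "P \<in> projs" unfolding P_def by (intro projs_times B0 B1 Q)
  have PQ: "P * Q = P" using projs_idem[OF Q(1)] by (simp add: P_def mult.assoc)
  have PB0: "P * B0 = P" using projs_idem[OF B0(1)] projs_commute[OF B0(1) Q(1)]
    unfolding P_def by (metis mult.assoc)
  have PB1: "P * B1 = P" using projs_idem[OF B1(1)] projs_commute[OF B1(1) P] unfolding P_def by (metis mult.assoc)
  have partP: "part ({P} - {0})" "\<Sum>({P} - {0}) = P" using P by (auto simp: part_def) (cases "P = 0"; simp)
  define \<B> where "\<B> = refine \<R> ({P} - {0})"
  have \<B>: "part \<B>" "\<Sum>\<B> = P" using refine_part[OF \<R>(1) partP(1)] \<R>(2) partP(2) by (simp_all add: \<B>_def)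
  show ?thesis
  proof (rule that[OF \<B>(1)])
    have "\<xi> - P \<cdot> \<xi> = (\<xi> - B1 \<cdot> \<xi>) + B1 \<cdot> (\<xi> - B0 \<cdot> \<xi>)" by (simp add: P_def bop_times_apply Q(2) bop_apply_diff)
    then have "norm (\<xi> - P \<cdot> \<xi>) \<le> norm (\<xi> - B1 \<cdot> \<xi>) + norm (B1 \<cdot> (\<xi> - B0 \<cdot> \<xi>))" by (metis norm_triangle_ineq)
    also have "\<dots> \<le> e + e"
      using close1 order_trans[OF projs_norm_le[OF B1(1)] close0] by (rule add_mono)
    finally show "norm (\<xi> - \<Sum>\<B> \<cdot> \<xi>) \<le> 2 * e" by (simp add: \<B>(2))
  next
    fix B assume B: "B \<in> \<B>"
    obtain R where R: "R \<in> \<R>" "R * B = B" and BP: "P * B = B" "B * P = B"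
      using refine_cases[OF \<R>(1) partP(1) B[unfolded \<B>_def]] by (metis Diff_iff singletonD)
    have Bp: "B \<in> projs" using B \<B>(1) part_projs by blast
    have le: "F * X = F" if "F * B = F" "P * X = P" for F X by (metis BP(2) mult.assoc that)
    obtain \<beta> where \<beta>: "\<And>n. n < K \<Longrightarrow> C n * R = \<beta> n *\<^sub>C R" using \<R>(3)[OF R(1)] by metis
    define b where "b n = (if n < K then \<beta> n else 0)" for n
    have CB: "C n * B = b n *\<^sub>C B" for n
      using \<beta>[of n] R(2) by (cases "n < K") (simp_all add: b_def C_def, metis mult.assoc times_scaleC_left)
    have "B \<cdot> v \<in> cyclic \<xi>" for v
    proof -
      have "Q * B = B" using projs_commute[OF Q(1) Bp] le[OF projs_idem[OF Bp] PQ] by simp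
      then show ?thesis using Q(3)[of "B \<cdot> v"] by (metis bop_times_apply)
    qed
    moreover have "sq_sum (\<lambda>n. F \<cdot> x n) \<le> N\<^sup>2 * (norm (F \<cdot> \<xi>))\<^sup>2" if "simple F" "F * B = F" for F
      by (rule simple_chebyshev[OF x(1) B0(1) B0(3) that(1) le[OF that(2) PB0]])
    moreover have "sq_sum (\<lambda>n. F \<cdot> (x n - b n *\<^sub>C \<xi>)) \<le> d\<^sup>2 * (norm (F \<cdot> \<xi>))\<^sup>2"
      if F: "simple F" "F * B = F" for F
    proof -
      have "F \<cdot> C n \<cdot> \<xi> = F \<cdot> (b n *\<^sub>C \<xi>)" for n
      proof -
        have "F * C n = F * (B * C n)" using F(2) by (metis mult.assoc)
        also have "B * C n = b n *\<^sub>C B" using CB D_commute[OF projs_D[OF Bp] simple_D[OF C]] by simp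
        finally have "F * C n = b n *\<^sub>C F" using F(2) by (simp add: times_scaleC_right)
        then show ?thesis by (metis bop_times_apply scaleC_bop_apply bop_apply_scaleC)
      qed
      then have "F \<cdot> (x n - b n *\<^sub>C \<xi>) = F \<cdot> z n" for n by (simp add: z_def bop_apply_diff)
      then show ?thesis
        using simple_chebyshev[OF z B1(1) B1(3) F(1) le[OF F(2) PB1]] by simp
    qed
    moreover have "\<forall>n\<ge>K. b n = 0" by (simp add: b_def)
    ultimately show "nearly_constant \<xi> x N d B" unfolding nearly_constant_def by blast
  qed
qed

section \<open>From nearly constant to trivial corners\<close>

lemma schur_bimodule:
  assumes "schur_multiplier D \<Phi>" "A \<in> D" "B \<in> D"
  shows "\<Phi> (A * T * B) = A * \<Phi> T * B"
  using assms by (simp add: schur_multiplier_def bop_comp_eq_times)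

definition schur_rectangle :: "('h bop \<Rightarrow> 'h bop) \<Rightarrow> 'h bop \<Rightarrow> 'h bop \<Rightarrow> bool" where
  "schur_rectangle \<Phi> A B \<longleftrightarrow> (\<forall>T. \<Phi> (A * T * B) = A * T * B) \<or> (\<forall>T. \<Phi> (A * T * B) = 0)"

lemma schur_idempotents_clinear:
  assumes "\<Phi> \<in> schur_idempotents D"
  shows "\<Phi> (S + T) = \<Phi> S + \<Phi> T" "\<Phi> (c *\<^sub>C T) = c *\<^sub>C \<Phi> T" "\<Phi> (S - T) = \<Phi> S - \<Phi> T" "\<Phi> 0 = 0"
    "\<Phi> (\<Phi> T) = \<Phi> T"
proof -
  have lin: "\<Phi> (S + T) = \<Phi> S + \<Phi> T" "\<Phi> (c *\<^sub>C T) = c *\<^sub>C \<Phi> T" for S T c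
    using assms by (auto simp: schur_idempotents_def schur_multiplier_def clinear_def)
  then show "\<Phi> (S + T) = \<Phi> S + \<Phi> T" "\<Phi> (c *\<^sub>C T) = c *\<^sub>C \<Phi> T" by auto
  show "\<Phi> (S - T) = \<Phi> S - \<Phi> T" using lin(1)[of "S - T" T] by simp
  show "\<Phi> 0 = 0" using lin(2)[of 0 0] by simp
  show "\<Phi> (\<Phi> T) = \<Phi> T" using assms by (metis (mono_tags, lifting) schur_idempotents_def comp_apply mem_Collect_eq)
qed

text \<open>On the corner between two cells, \<open>\<Phi>\<close> is close to a scalar; an idempotent close to a
  scalar is \<open>0\<close> or the identity.\<close>

lemma nearly_constant_rectangle:
  fixes x y :: "nat \<Rightarrow> 'h"
  assumes \<Phi>: "\<Phi> \<in> schur_idempotents D"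
    and x: "sq_summable x" and y: "sq_summable y"
    and rep: "\<And>T. cinner (\<Phi> T \<cdot> \<xi>) \<eta> = (\<Sum>n. cinner (T \<cdot> x n) (y n))"
    and A: "A \<in> projs" "nearly_constant \<eta> y N d A" and B: "B \<in> projs" "nearly_constant \<xi> x N d B"
    and d: "0 \<le> d" "0 \<le> N" "2 * N * d + d\<^sup>2 < 1 / 2"
  shows "schur_rectangle \<Phi> A B"
proof -
  have mult: "schur_multiplier D \<Phi>" using \<Phi> by (simp add: schur_idempotents_def)
  obtain \<beta> K where \<beta>: "\<And>n. K \<le> n \<Longrightarrow> \<beta> n = 0" and Bb:
    "\<And>F. simple F \<Longrightarrow> F * B = F \<Longrightarrow> sq_sum (\<lambda>n. F \<cdot> (x n - \<beta> n *\<^sub>C \<xi>)) \<le> d\<^sup>2 * (norm (F \<cdot> \<xi>))\<^sup>2"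
    using B(2) unfolding nearly_constant_def by blast
  obtain \<alpha> L where \<alpha>: "\<And>n. L \<le> n \<Longrightarrow> \<alpha> n = 0" and Aa:
    "\<And>F. simple F \<Longrightarrow> F * A = F \<Longrightarrow> sq_sum (\<lambda>n. F \<cdot> (y n - \<alpha> n *\<^sub>C \<eta>)) \<le> d\<^sup>2 * (norm (F \<cdot> \<eta>))\<^sup>2"
    using A(2) unfolding nearly_constant_def by blast
  define c where "c = (\<Sum>n<K. \<beta> n * cnj (\<alpha> n))"
  \<comment> \<open>Formally the constant \<open>c\<close> is \<langle>\<beta>, \<alpha>\<rangle>,
    and \<langle>b, a\<rangle> - \<langle>\<beta>, \<alpha>\<rangle> = \<langle>b - \<beta>,
    a\<rangle> + \<langle>b, a - \<alpha>\<rangle> - \<langle>b - \<beta>, a - \<alpha>\<rangle>.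
    The terms on the right are bounded by \<open>N * d\<close>, \<open>N * d\<close> and
    \<open>d\<^sup>2\<close>. This arrangement asks for no bound on the constants \<alpha> and
    \<beta>.\<close>
  define q where "q = 2 * N * d + d\<^sup>2"
  have key: "cmod (cinner ((\<Phi> T - c *\<^sub>C T) \<cdot> C \<cdot> \<xi>) (E \<cdot> \<eta>)) \<le> q * norm T * norm (C \<cdot> \<xi>) * norm (E \<cdot> \<eta>)"
    if C: "simple C" "C * B = C" and E: "simple E" "E * A = E" for T C E
  proof -
    let ?u = "\<lambda>n. C \<cdot> x n" and ?v = "\<lambda>n. E \<cdot> y n"
    let ?a = "\<lambda>n. C \<cdot> (x n - \<beta> n *\<^sub>C \<xi>)" and ?b = "\<lambda>n. E \<cdot> (y n - \<alpha> n *\<^sub>C \<eta>)"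
    let ?s = "norm (C \<cdot> \<xi>)" and ?t = "norm (E \<cdot> \<eta>)"
    have u: "sq_summable ?u" "sq_sum ?u \<le> (N * ?s)\<^sup>2" "0 \<le> N * ?s"
      using B(2) C d summable_l2_apply[OF x] by (auto simp: nearly_constant_def power_mult_distrib)
    have v: "sq_summable ?v" "sq_sum ?v \<le> (N * ?t)\<^sup>2" "0 \<le> N * ?t"
      using A(2) E d summable_l2_apply[OF y] by (auto simp: nearly_constant_def power_mult_distrib)
    have "sq_summable (\<lambda>n. x n - \<beta> n *\<^sub>C \<xi>)"
      by (rule summable_l2_diff_finite[OF x, of K]) (simp add: \<beta>)
    then have a: "sq_summable ?a" "sq_sum ?a \<le> (d * ?s)\<^sup>2" "0 \<le> d * ?s"
      using Bb[OF C] d summable_l2_apply by (auto simp: power_mult_distrib)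
    have "sq_summable (\<lambda>n. y n - \<alpha> n *\<^sub>C \<eta>)"
      by (rule summable_l2_diff_finite[OF y, of L]) (simp add: \<alpha>)
    then have b: "sq_summable ?b" "sq_sum ?b \<le> (d * ?t)\<^sup>2" "0 \<le> d * ?t"
      using Aa[OF E] d summable_l2_apply by (auto simp: power_mult_distrib)
    obtain E' where E': "E' \<in> D" "is_adjoint E' E" using D_adjoint[OF simple_D[OF E(1)]] by blast
    have adjE: "cinner (E' \<cdot> p) r = cinner p (E \<cdot> r)" for p r
      using is_adjointD[OF is_adjoint_sym[OF E'(2)]] by simp
    \<comment> \<open>By the bimodule property \<open>C\<close> and \<open>E\<close> pass through
      \<open>\<Phi>\<close> onto the representing sequences, which become
      \<open>C \<cdot> x n\<close> and \<open>E \<cdot> y n\<close>.\<close>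
    have "cinner (\<Phi> T \<cdot> C \<cdot> \<xi>) (E \<cdot> \<eta>) = cinner ((E' * \<Phi> T * C) \<cdot> \<xi>) \<eta>"
      by (simp add: bop_times_apply adjE)
    also have "\<dots> = cinner (\<Phi> (E' * T * C) \<cdot> \<xi>) \<eta>"
      using schur_bimodule[OF mult E'(1) simple_D[OF C(1)]] by simp
    also have "\<dots> = (\<Sum>n. cinner (T \<cdot> ?u n) (?v n))" unfolding rep by (simp add: bop_times_apply adjE)
    finally have main: "cinner (\<Phi> T \<cdot> C \<cdot> \<xi>) (E \<cdot> \<eta>) = (\<Sum>n. cinner (T \<cdot> ?u n) (?v n))" .
    have summand: "cinner (T \<cdot> ?u n) (?v n) - \<beta> n * cnj (\<alpha> n) * cinner (T \<cdot> C \<cdot> \<xi>) (E \<cdot> \<eta>)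
        = cinner (T \<cdot> ?a n) (?v n) + cinner (T \<cdot> ?u n) (?b n) - cinner (T \<cdot> ?a n) (?b n)" for n
      by (simp add: bop_simps cinner_simps algebra_simps)
    have fin: "(\<lambda>n. \<beta> n * cnj (\<alpha> n) * cinner (T \<cdot> C \<cdot> \<xi>) (E \<cdot> \<eta>)) sums (c * cinner (T \<cdot> C \<cdot> \<xi>) (E \<cdot> \<eta>))"
      using sums_finite[of "{..<K}" "\<lambda>n. \<beta> n * cnj (\<alpha> n) * cinner (T \<cdot> C \<cdot> \<xi>) (E \<cdot> \<eta>)"] \<beta>
      by (simp add: c_def sum_distrib_right not_less)
    have "cinner ((\<Phi> T - c *\<^sub>C T) \<cdot> C \<cdot> \<xi>) (E \<cdot> \<eta>)
        = (\<Sum>n. cinner (T \<cdot> ?u n) (?v n) - \<beta> n * cnj (\<alpha> n) * cinner (T \<cdot> C \<cdot> \<xi>) (E \<cdot> \<eta>))"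
      using suminf_diff[OF l2_pairing(1)[OF u v, of T] sums_summable[OF fin]] sums_unique[OF fin] main
      by (simp add: minus_bop_apply scaleC_bop_apply cinner_simps)
    also have "\<dots> = (\<Sum>n. cinner (T \<cdot> ?a n) (?v n)) + (\<Sum>n. cinner (T \<cdot> ?u n) (?b n)) - (\<Sum>n. cinner (T \<cdot> ?a n) (?b n))"
      unfolding summand
      by (intro sums_unique[symmetric] sums_add sums_diff summable_sums l2_pairing(1)[OF a v] l2_pairing(1)[OF u b]
          l2_pairing(1)[OF a b])
    finally have "cmod (cinner ((\<Phi> T - c *\<^sub>C T) \<cdot> C \<cdot> \<xi>) (E \<cdot> \<eta>))
        \<le> norm T * (d * ?s * (N * ?t)) + norm T * (N * ?s * (d * ?t)) + norm T * (d * ?s * (d * ?t))"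
      using l2_pairing(2)[OF a v, of T] l2_pairing(2)[OF u b, of T] l2_pairing(2)[OF a b, of T]
      by (smt (verit) norm_triangle_ineq norm_triangle_ineq4)
    also have "\<dots> = q * norm T * ?s * ?t" by (simp add: q_def power2_eq_square algebra_simps)
    finally show ?thesis .
  qed
  have near: "norm (\<Phi> S - c *\<^sub>C S) \<le> q * norm S" if S: "A * S * B = S" for S
  proof (rule norm_bop_le)
    have q0: "0 \<le> q" using d by (simp add: q_def)
    then show "0 \<le> q * norm S" by simp
    fix u
    show "norm ((\<Phi> S - c *\<^sub>C S) \<cdot> u) \<le> q * norm S * norm u"
    proof (rule norm_le_of_cinner)
      fix v
      have "\<Phi> S = A * \<Phi> S * B" using schur_bimodule[OF mult projs_D[OF A(1)] projs_D[OF B(1)], of S] S by simp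
      then have eq: "\<Phi> S - c *\<^sub>C S = A * (\<Phi> S - c *\<^sub>C S) * B"
        using S by (simp add: algebra_simps times_scaleC_left times_scaleC_right)
      \<comment> \<open>The range of \<open>B\<close> lies in the cyclic subspace of
        \<open>\<xi>\<close>, so its vectors are limits of \<open>C n \<cdot> \<xi>\<close> with
        \<open>C n\<close> simple and below \<open>B\<close>. The bound \<open>key\<close> thus
        extends to the whole corner.\<close>
      obtain C where C: "\<And>n::nat. simple (C n)" "\<And>n. C n * B = C n" "(\<lambda>n. C n \<cdot> \<xi>) \<longlonglongrightarrow> B \<cdot> u"
        using cyclic_simple_sequence[of "B \<cdot> u" \<xi> B] B projs_orth_proj[OF B(1)]
        by (auto simp: nearly_constant_def)
      obtain E where E: "\<And>n::nat. simple (E n)" "\<And>n. E n * A = E n" "(\<lambda>n. E n \<cdot> \<eta>) \<longlonglongrightarrow> A \<cdot> v"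
        using cyclic_simple_sequence[of "A \<cdot> v" \<eta> A] A projs_orth_proj[OF A(1)]
        by (auto simp: nearly_constant_def)
      have "(\<lambda>n. cmod (cinner ((\<Phi> S - c *\<^sub>C S) \<cdot> C n \<cdot> \<xi>) (E n \<cdot> \<eta>)))
          \<longlonglongrightarrow> cmod (cinner ((\<Phi> S - c *\<^sub>C S) \<cdot> B \<cdot> u) (A \<cdot> v))"
        by (intro tendsto_norm bounded_bilinear.tendsto[OF bounded_bilinear_cinner]
            bounded_linear.tendsto[OF bounded_linear_bop_apply] C E)
      moreover have "(\<lambda>n. q * norm S * norm (C n \<cdot> \<xi>) * norm (E n \<cdot> \<eta>))
          \<longlonglongrightarrow> q * norm S * norm (B \<cdot> u) * norm (A \<cdot> v)"
        by (intro tendsto_intros C E)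
      ultimately have "cmod (cinner ((\<Phi> S - c *\<^sub>C S) \<cdot> B \<cdot> u) (A \<cdot> v)) \<le> q * norm S * norm (B \<cdot> u) * norm (A \<cdot> v)"
        by (rule LIMSEQ_le) (use key[OF C(1,2) E(1,2)] in blast)
      also have "\<dots> \<le> q * norm S * norm u * norm v"
        using projs_norm_le[OF A(1)] projs_norm_le[OF B(1)] q0
        by (intro mult_mono mult_nonneg_nonneg) auto
      also have "cinner ((\<Phi> S - c *\<^sub>C S) \<cdot> B \<cdot> u) (A \<cdot> v) = cinner ((\<Phi> S - c *\<^sub>C S) \<cdot> u) v"
        by (subst (2) eq) (simp add: bop_times_apply projs_adj[OF A(1)])
      finally show "cmod (cinner ((\<Phi> S - c *\<^sub>C S) \<cdot> u) v) \<le> q * norm S * norm u * norm v" .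
    qed (use q0 in simp)
  qed
  have corner: "A * \<Phi> S * B = \<Phi> S" if "A * S * B = S" for S
    using schur_bimodule[OF mult projs_D[OF A(1)] projs_D[OF B(1)], of S] that by simp
  have ATB: "A * (A * T * B) * B = A * T * B" for T
    using projs_idem[OF A(1)] projs_idem[OF B(1)] by (metis mult.assoc)
  note lin = schur_idempotents_clinear[OF \<Phi>]
  have nz: "S = 0" if "cmod r * norm S \<le> q * norm S" "q < cmod r" for S :: "'h bop" and r
    using that by (metis mult_le_cancel_right norm_le_zero_iff not_le)
  show ?thesis
  \<comment> \<open>As \<open>q < 1 / 2\<close>, at least one of \<open>cmod c\<close> and
    \<open>cmod (1 - c)\<close> exceeds \<open>q\<close>. In the first case \<open>near\<close> is
    tested on \<open>S - \<Phi> S\<close>, which \<open>\<Phi>\<close> kills, in the second on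
    \<open>\<Phi> S\<close>, which it fixes; the tested operator must be 0.\<close>
  proof (cases "q < cmod c")
    case True
    have "\<Phi> S = S" if S: "A * S * B = S" for S
    proof -
      have "A * (S - \<Phi> S) * B = S - \<Phi> S" using S corner[OF S] by (simp add: algebra_simps)
      from near[OF this] have "cmod c * norm (S - \<Phi> S) \<le> q * norm (S - \<Phi> S)" by (simp add: lin norm_scaleC)
      from nz[OF this True] show ?thesis by simp
    qed
    then show ?thesis using ATB by (simp add: schur_rectangle_def)
  next
    case False
    then have "cmod c < 1 / 2" "q < 1 / 2" using d(3) by (auto simp: q_def)
    moreover have "1 - cmod c \<le> cmod (1 - c)" using norm_triangle_ineq2[of 1 c] by simp
    ultimately have q: "q < cmod (1 - c)" by simp
    have "\<Phi> S = 0" if S: "A * S * B = S" for S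
    proof -
      have "cmod (1 - c) * norm (\<Phi> S) \<le> q * norm (\<Phi> S)"
        using near[OF corner[OF S]] by (simp add: lin scaleC_diff_left scaleC_one flip: norm_scaleC)
      from nz[OF this q] show ?thesis .
    qed
    then show ?thesis using ATB by (simp add: schur_rectangle_def)
  qed
qed

end

section \<open>Schur masks and rectangles\<close>

text \<open>For fixed vectors \<open>u\<close>, \<open>v\<close> the coefficient of the bounded
  operator \<open>X\<close> changes little when they are replaced by \<open>Q \<cdot> u\<close> and
  \<open>P \<cdot> v\<close>, so projections that depend on the vectors suffice.\<close>

lemma norm_le_of_compressions:
  fixes X :: "'h::chilbert_space bop"
  assumes "\<And>\<xi> \<eta> e. 0 < e \<Longrightarrow> \<exists>P Q. orth_proj P \<and> orth_proj Q \<and> norm (\<eta> - P \<cdot> \<eta>) \<le> e \<and>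
      norm (\<xi> - Q \<cdot> \<xi>) \<le> e \<and> norm (P * X * Q) \<le> c"
    and "0 \<le> c"
  shows "norm X \<le> c"
proof (rule norm_bop_le)
  fix u
  show "norm (X \<cdot> u) \<le> c * norm u"
  proof (rule norm_le_of_cinner)
    fix v
    show "cmod (cinner (X \<cdot> u) v) \<le> c * norm u * norm v"
    proof (rule field_le_epsilon)
      fix e :: real assume "0 < e"
      \<comment> \<open>With the tolerance \<open>e / M\<close> the two replacement errors add up to
        \<open>e * ((M - 1) / M)\<close>; the summand 1 keeps \<open>M\<close> positive.\<close>
      define M where "M = 1 + norm X * (norm u + norm v)"
      have M: "0 < M" unfolding M_def by (intro add_pos_nonneg) auto
      obtain P Q where P: "orth_proj P" and Q: "orth_proj Q" and Pv: "norm (v - P \<cdot> v) \<le> e / M"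
        and Qu: "norm (u - Q \<cdot> u) \<le> e / M" and PXQ: "norm (P * X * Q) \<le> c"
        using assms(1)[of "e / M" v u] \<open>0 < e\<close> M by auto
      have "cinner (X \<cdot> u) v = cinner (X \<cdot> (u - Q \<cdot> u)) v + cinner (X \<cdot> Q \<cdot> u) (v - P \<cdot> v)
          + cinner ((P * X * Q) \<cdot> u) v"
        by (simp add: bop_simps cinner_simps orth_projD[OF P])
      also have "cmod \<dots> \<le> cmod (cinner (X \<cdot> (u - Q \<cdot> u)) v) + cmod (cinner (X \<cdot> Q \<cdot> u) (v - P \<cdot> v))
          + cmod (cinner ((P * X * Q) \<cdot> u) v)"
        by (intro norm_triangle_le add_mono norm_triangle_ineq order_refl)
      also have "\<dots> \<le> norm X * (e / M) * norm v + norm X * norm u * (e / M) + c * norm u * norm v"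
      proof (intro add_mono)
        have "cmod (cinner (X \<cdot> (u - Q \<cdot> u)) v) \<le> norm X * norm (u - Q \<cdot> u) * norm v"
          using order_trans[OF cauchy_schwarz mult_right_mono[OF norm_bop_apply_le norm_ge_zero]] .
        also have "\<dots> \<le> norm X * (e / M) * norm v" by (intro mult_right_mono mult_left_mono Qu) auto
        finally show "cmod (cinner (X \<cdot> (u - Q \<cdot> u)) v) \<le> norm X * (e / M) * norm v" .
        have "cmod (cinner (X \<cdot> Q \<cdot> u) (v - P \<cdot> v)) \<le> norm X * norm (Q \<cdot> u) * norm (v - P \<cdot> v)"
          using order_trans[OF cauchy_schwarz mult_right_mono[OF norm_bop_apply_le norm_ge_zero]] .
        also have "\<dots> \<le> norm X * norm u * (e / M)"
          by (intro mult_mono order_refl orth_proj_norm_le Q Pv mult_nonneg_nonneg) auto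
        finally show "cmod (cinner (X \<cdot> Q \<cdot> u) (v - P \<cdot> v)) \<le> norm X * norm u * (e / M)" .
        have "cmod (cinner ((P * X * Q) \<cdot> u) v) \<le> norm (P * X * Q) * norm u * norm v"
          using order_trans[OF cauchy_schwarz mult_right_mono[OF norm_bop_apply_le norm_ge_zero]] .
        also have "\<dots> \<le> c * norm u * norm v" by (intro mult_right_mono PXQ) auto
        finally show "cmod (cinner ((P * X * Q) \<cdot> u) v) \<le> c * norm u * norm v" .
      qed
      also have "norm X * (e / M) * norm v + norm X * norm u * (e / M) = e * ((M - 1) / M)"
      proof -
        have "norm X * (norm u + norm v) = M - 1" by (simp add: M_def)
        then have "(e / M) * (norm X * (norm u + norm v)) = e * ((M - 1) / M)" by simp
        then show ?thesis by (simp only: distrib_left mult_ac add_ac)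
      qed
      also have "e * ((M - 1) / M) \<le> e * 1"
        using M \<open>0 < e\<close> by (intro mult_left_mono) auto
      finally show "cmod (cinner (X \<cdot> u) v) \<le> c * norm u * norm v + e" by simp
    qed
  qed (use assms(2) in simp)
qed fact

text \<open>Toggling the membership of \<open>a\<close> exchanges the sets that separate
  \<open>a\<close> from \<open>b\<close> with those that do not.\<close>

lemma card_separating_sets:
  assumes "finite L" "a \<in> L" "a \<noteq> b"
  shows "2 * card {S \<in> Pow L. (a \<in> S) = (b \<notin> S)} = 2 ^ card L"
proof -
  let ?X = "{S \<in> Pow L. (a \<in> S) = (b \<notin> S)}" and ?Y = "{S \<in> Pow L. (a \<in> S) \<noteq> (b \<notin> S)}"
  let ?h = "\<lambda>S. if a \<in> S then S - {a} else insert a S"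
  have "bij_betw ?h ?X ?Y"
    by (rule bij_betw_byWitness[where f' = ?h]) (use assms in \<open>auto split: if_splits\<close>)
  then have "card ?X = card ?Y" by (rule bij_betw_same_card)
  moreover have "card (?X \<union> ?Y) = card ?X + card ?Y"
    using assms(1) by (intro card_Un_disjoint) auto
  moreover have "?X \<union> ?Y = Pow L" by auto
  ultimately show ?thesis using card_Pow[OF assms(1)] by simp
qed

context masa_algebra
begin

lemma schur_rectangle_mono:
  assumes "schur_rectangle \<Phi> A B" "A * A' = A'" "B' * B = B'"
  shows "schur_rectangle \<Phi> A' B'"
proof -
  have "A' * T * B' = A * (A' * T * B') * B" for T
    using assms(2,3) by (simp add: mult.assoc) (simp flip: mult.assoc)
  then show ?thesis using assms(1) unfolding schur_rectangle_def by metis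
qed

definition schur_partition :: "('h bop \<Rightarrow> 'h bop) set \<Rightarrow> 'h bop set \<Rightarrow> 'h bop set \<Rightarrow> bool" where
  "schur_partition F \<A> \<B> \<longleftrightarrow> part \<A> \<and> part \<B> \<and> (\<forall>\<Phi>\<in>F. \<forall>A\<in>\<A>. \<forall>B\<in>\<B>. schur_rectangle \<Phi> A B)"

lemma schur_partition_single:
  assumes \<Phi>: "\<Phi> \<in> schur_idempotents D" and e: "0 < e"
  shows "\<exists>\<A> \<B>. schur_partition {\<Phi>} \<A> \<B> \<and> norm (\<eta> - \<Sum>\<A> \<cdot> \<eta>) \<le> e \<and> norm (\<xi> - \<Sum>\<B> \<cdot> \<xi>) \<le> e"
proof -
  have mult: "schur_multiplier D \<Phi>" using \<Phi> by (simp add: schur_idempotents_def)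
  obtain x0 y0 where xy0: "sq_summable x0" "sq_summable y0"
    "\<And>T. cinner (\<Phi> T \<cdot> \<xi>) \<eta> = (\<Sum>n. cinner (T \<cdot> x0 n) (y0 n))"
    using schur_multiplier_functional[OF mult, of \<xi> \<eta>] by blast
  obtain Q where Q: "Q \<in> projs" "Q \<cdot> \<xi> = \<xi>" "\<And>v. Q \<cdot> v \<in> cyclic \<xi>" using cyclic_projection[of \<xi>] by blast
  obtain P where P: "P \<in> projs" "P \<cdot> \<eta> = \<eta>" "\<And>v. P \<cdot> v \<in> cyclic \<eta>" using cyclic_projection[of \<eta>] by blast
  \<comment> \<open>Moving the sequences into the cyclic subspaces keeps the representation, since
    \<open>Q\<close> fixes \<open>\<xi>\<close>, \<open>P\<close> fixes \<open>\<eta>\<close>, and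
    both pass through \<open>\<Phi>\<close>.\<close>
  define x where "x n = Q \<cdot> x0 n" for n
  define y where "y n = P \<cdot> y0 n" for n
  have x: "sq_summable x" "\<And>n. x n \<in> cyclic \<xi>"
    using summable_l2_apply[OF xy0(1)] Q(3) by (auto simp: x_def)
  have y: "sq_summable y" "\<And>n. y n \<in> cyclic \<eta>"
    using summable_l2_apply[OF xy0(2)] P(3) by (auto simp: y_def)
  have rep: "cinner (\<Phi> T \<cdot> \<xi>) \<eta> = (\<Sum>n. cinner (T \<cdot> x n) (y n))" for T
  proof -
    note P_adj = projs_adj[OF P(1)]
    have "cinner (\<Phi> T \<cdot> \<xi>) \<eta> = cinner ((P * \<Phi> T * Q) \<cdot> \<xi>) \<eta>" by (simp add: bop_times_apply Q(2) P_adj P(2))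
    also have "\<dots> = cinner (\<Phi> (P * T * Q) \<cdot> \<xi>) \<eta>"
      using schur_bimodule[OF mult projs_D[OF P(1)] projs_D[OF Q(1)]] by simp
    also have "\<dots> = (\<Sum>n. cinner (T \<cdot> x n) (y n))"
      unfolding xy0(3) by (simp add: bop_times_apply x_def y_def P_adj)
    finally show ?thesis .
  qed
  define s where "s = sq_sum x + sq_sum y"
  have s: "0 \<le> sq_sum x" "0 \<le> sq_sum y"
    by (rule suminf_nonneg[OF x(1)] suminf_nonneg[OF y(1)]; simp)+
  \<comment> \<open>Chosen so that \<open>N * (e / 2) = 1 + sqrt s\<close>, whose square dominates
    both square sums; the 1 keeps \<open>N\<close> positive.\<close>
  define N where "N = (1 + sqrt s) / (e / 2)"
  have N: "0 < N" using e s unfolding N_def s_def by (intro divide_pos_pos add_pos_nonneg) auto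
  have "s \<le> (1 + sqrt s)\<^sup>2"
    using s by (simp add: power2_sum s_def)
  then have Ne: "sq_sum x \<le> (N * (e / 2))\<^sup>2" "sq_sum y \<le> (N * (e / 2))\<^sup>2"
  proof -
    have N_eq: "N * (e / 2) = 1 + sqrt s" using e by (simp add: N_def)
    show "sq_sum x \<le> (N * (e / 2))\<^sup>2" "sq_sum y \<le> (N * (e / 2))\<^sup>2"
      unfolding N_eq using s \<open>s \<le> (1 + sqrt s)\<^sup>2\<close> s_def by linarith+
  qed
  \<comment> \<open>Both \<open>N * d\<close> and \<open>d\<close> are at most \<open>1 / 8\<close>,
    so \<open>2 * N * d + d\<^sup>2 \<le> 3 / 8\<close>, below the threshold that forces a corner to
    be trivial.\<close>
  define d where "d = 1 / (8 * (N + 1))"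
  have d: "0 < d" "2 * N * d + d\<^sup>2 < 1 / 2"
  proof -
    show "0 < d" using N by (simp add: d_def)
    have "N * d \<le> 1 / 8" "d \<le> 1 / 8" using N by (auto simp: d_def field_simps)
    moreover have "d\<^sup>2 \<le> d" using \<open>0 < d\<close> \<open>d \<le> 1 / 8\<close> by (simp add: power2_eq_square mult_left_le)
    ultimately show "2 * N * d + d\<^sup>2 < 1 / 2" by linarith
  qed
  have e2: "0 < e / 2" using e by simp
  obtain \<B> where \<B>: "part \<B>" "norm (\<xi> - \<Sum>\<B> \<cdot> \<xi>) \<le> 2 * (e / 2)" "\<And>B. B \<in> \<B> \<Longrightarrow> nearly_constant \<xi> x N d B"
    using nearly_constant_cells[OF x N Ne(1) d(1) e2] by blast
  obtain \<A> where \<A>: "part \<A>" "norm (\<eta> - \<Sum>\<A> \<cdot> \<eta>) \<le> 2 * (e / 2)" "\<And>A. A \<in> \<A> \<Longrightarrow> nearly_constant \<eta> y N d A"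
    using nearly_constant_cells[OF y N Ne(2) d(1) e2] by blast
  have "schur_rectangle \<Phi> A B" if "A \<in> \<A>" "B \<in> \<B>" for A B
    using nearly_constant_rectangle[OF \<Phi> x(1) y(1) rep] that \<A> \<B> part_projs d N less_imp_le by metis
  then show ?thesis using \<A>(1,2) \<B>(1,2) unfolding schur_partition_def
    by (intro exI[of _ \<A>] exI[of _ \<B>]) simp
qed

lemma refine_close:
  assumes "part \<A>" "part \<B>" "norm (\<xi> - \<Sum>\<A> \<cdot> \<xi>) \<le> e" "norm (\<xi> - \<Sum>\<B> \<cdot> \<xi>) \<le> d"
  shows "norm (\<xi> - \<Sum>(refine \<A> \<B>) \<cdot> \<xi>) \<le> e + d"
proof -
  have "\<xi> - \<Sum>(refine \<A> \<B>) \<cdot> \<xi> = (\<xi> - \<Sum>\<A> \<cdot> \<xi>) + \<Sum>\<A> \<cdot> (\<xi> - \<Sum>\<B> \<cdot> \<xi>)"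
    by (simp add: refine_part(2)[OF assms(1,2)] bop_times_apply bop_apply_diff)
  then have "norm (\<xi> - \<Sum>(refine \<A> \<B>) \<cdot> \<xi>) \<le> norm (\<xi> - \<Sum>\<A> \<cdot> \<xi>) + norm (\<Sum>\<A> \<cdot> (\<xi> - \<Sum>\<B> \<cdot> \<xi>))"
    by (metis norm_triangle_ineq)
  also have "\<dots> \<le> e + d"
    using order_trans[OF projs_norm_le[OF part_sum_projs[OF assms(1)]] assms(4)] assms(3)
    by (rule add_mono[rotated])
  finally show ?thesis .
qed

lemma schur_partition_exists:
  assumes "finite F" "F \<subseteq> schur_idempotents D" "0 < e"
  shows "\<exists>\<A> \<B>. schur_partition F \<A> \<B> \<and> norm (\<eta> - \<Sum>\<A> \<cdot> \<eta>) \<le> e \<and> norm (\<xi> - \<Sum>\<B> \<cdot> \<xi>) \<le> e"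
  using assms
proof (induction F arbitrary: e rule: finite_induct)
  case empty
  have "norm (\<xi> - \<Sum>({1, 1 - 1} - {0}) \<cdot> \<xi>) \<le> e" for \<xi> :: 'h
    unfolding part_binary(2)[OF projs_1] using empty by simp
  then show ?case using part_binary(1)[OF projs_1] unfolding schur_partition_def by blast
next
  case (insert \<Phi> F)
  have e2: "0 < e / 2" using insert.prems by simp
  obtain \<A> \<B> where \<A>: "schur_partition F \<A> \<B>" "norm (\<eta> - \<Sum>\<A> \<cdot> \<eta>) \<le> e / 2" "norm (\<xi> - \<Sum>\<B> \<cdot> \<xi>) \<le> e / 2"
    using insert.IH[OF _ e2] insert.prems by auto
  obtain \<A>' \<B>' where \<A>': "schur_partition {\<Phi>} \<A>' \<B>'" "norm (\<eta> - \<Sum>\<A>' \<cdot> \<eta>) \<le> e / 2" "norm (\<xi> - \<Sum>\<B>' \<cdot> \<xi>) \<le> e / 2"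
    using schur_partition_single[OF _ e2, of \<Phi> \<eta> \<xi>] insert.prems by auto
  have parts: "part \<A>" "part \<B>" "part \<A>'" "part \<B>'" using \<A>(1) \<A>'(1) by (auto simp: schur_partition_def)
  have "schur_partition (insert \<Phi> F) (refine \<A> \<A>') (refine \<B> \<B>')"
    unfolding schur_partition_def
  proof (intro conjI ballI refine_part parts)
    fix \<Psi> C E assume \<Psi>: "\<Psi> \<in> insert \<Phi> F" and C: "C \<in> refine \<A> \<A>'" and E: "E \<in> refine \<B> \<B>'"
    obtain A A' where A: "A \<in> \<A>" "A' \<in> \<A>'" "A * C = C" "A' * C = C" using refine_cases[OF parts(1,3) C] by metis
    obtain B B' where B: "B \<in> \<B>" "B' \<in> \<B>'" "E * B = E" "E * B' = E" using refine_cases[OF parts(2,4) E] by metis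
    show "schur_rectangle \<Psi> C E"
    proof (cases "\<Psi> \<in> F")
      case True
      then have "schur_rectangle \<Psi> A B" using \<A>(1) A(1) B(1) by (simp add: schur_partition_def)
      then show ?thesis using A(3) B(3) by (rule schur_rectangle_mono)
    next
      case False
      then have "schur_rectangle \<Psi> A' B'" using \<Psi> \<A>'(1) A(2) B(2) by (simp add: schur_partition_def)
      then show ?thesis using A(4) B(4) by (rule schur_rectangle_mono)
    qed
  qed
  moreover have "norm (\<eta> - \<Sum>(refine \<A> \<A>') \<cdot> \<eta>) \<le> e" "norm (\<xi> - \<Sum>(refine \<B> \<B>') \<cdot> \<xi>) \<le> e"
    using refine_close[OF parts(1,3) \<A>(2) \<A>'(2)] refine_close[OF parts(2,4) \<A>(3) \<A>'(3)] by simp_all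
  ultimately show ?case by blast
qed

text \<open>The passage from finite masks to operators. The partitions vary with the pair of
  vectors, so the bound \<open>c\<close> has to serve all of them at once.\<close>

lemma norm_le_of_schur_partitions:
  assumes "finite F" "F \<subseteq> schur_idempotents D" "0 \<le> c"
    and "\<And>\<A> \<B>. schur_partition F \<A> \<B> \<Longrightarrow> norm (\<Sum>\<A> * X * \<Sum>\<B>) \<le> c"
  shows "norm X \<le> c"
proof (rule norm_le_of_compressions)
  fix \<xi> \<eta> and e :: real assume "0 < e"
  obtain \<A> \<B> where "schur_partition F \<A> \<B>" "norm (\<eta> - \<Sum>\<A> \<cdot> \<eta>) \<le> e" "norm (\<xi> - \<Sum>\<B> \<cdot> \<xi>) \<le> e"
    using schur_partition_exists[OF assms(1,2) \<open>0 < e\<close>] by blast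
  moreover from this have "orth_proj (\<Sum>\<A>)" "orth_proj (\<Sum>\<B>)"
    using part_sum_projs projs_orth_proj by (auto simp: schur_partition_def)
  ultimately show "\<exists>P Q. orth_proj P \<and> orth_proj Q \<and> norm (\<eta> - P \<cdot> \<eta>) \<le> e \<and> norm (\<xi> - Q \<cdot> \<xi>) \<le> e \<and> norm (P * X * Q) \<le> c"
    using assms(4) by blast
qed fact

lemma sum_corner: "\<Sum>\<A> * T * \<Sum>\<B> = (\<Sum>A\<in>\<A>. \<Sum>B\<in>\<B>. A * T * B)" for T :: "'h bop"
  by (simp only: sum_distrib_right[of "\<lambda>A. A" \<A> T] sum_product)

lemma sum_sandwich: "P * (\<Sum>i\<in>I. \<Sum>j\<in>J. F i j) * Q = (\<Sum>i\<in>I. \<Sum>j\<in>J. P * F i j * Q)" for P Q :: "'h bop"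
  by (simp add: sum_distrib_right sum_distrib_left)

lemma additive_sum:
  fixes f :: "'h bop \<Rightarrow> 'h bop"
  assumes "\<And>S T. f (S + T) = f S + f T" "f 0 = 0"
  shows "f (\<Sum>i\<in>I. g i) = (\<Sum>i\<in>I. f (g i))"
  by (induction I rule: infinite_finite_induct) (simp_all add: assms)

text \<open>On a pair of cells both maps are 0 or the identity, so there they commute, and the bound
  0 on all compressions spreads this to every \<open>T\<close>. Commutation is what makes a
  composition idempotent.\<close>

lemma schur_idempotents_commute:
  assumes \<Phi>: "\<Phi> \<in> schur_idempotents D" and \<Psi>: "\<Psi> \<in> schur_idempotents D"
  shows "\<Phi> (\<Psi> T) = \<Psi> (\<Phi> T)"
proof -
  have "norm (\<Phi> (\<Psi> T) - \<Psi> (\<Phi> T)) \<le> 0"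
  proof (rule norm_le_of_schur_partitions[of "{\<Phi>, \<Psi>}"])
    fix \<A> \<B> assume AB: "schur_partition {\<Phi>, \<Psi>} \<A> \<B>"
    let ?P = "\<Sum>\<A>" and ?Q = "\<Sum>\<B>"
    have PQ: "?P \<in> D" "?Q \<in> D" using AB part_sum_projs projs_D by (auto simp: schur_partition_def)
    have mult: "schur_multiplier D \<Phi>" "schur_multiplier D \<Psi>" using \<Phi> \<Psi> by (auto simp: schur_idempotents_def)
    note lin = schur_idempotents_clinear[OF \<Phi>] schur_idempotents_clinear[OF \<Psi>]
    have "\<Phi> (\<Psi> (A * T * B)) = \<Psi> (\<Phi> (A * T * B))" if "A \<in> \<A>" "B \<in> \<B>" for A B
      using AB that unfolding schur_partition_def schur_rectangle_def by (auto simp: lin) (metis lin(4,9))+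
    then have "\<Phi> (\<Psi> (?P * T * ?Q)) = \<Psi> (\<Phi> (?P * T * ?Q))"
      unfolding sum_corner by (simp add: additive_sum[of \<Phi>] additive_sum[of \<Psi>] lin)
    then have "?P * \<Phi> (\<Psi> T) * ?Q = ?P * \<Psi> (\<Phi> T) * ?Q"
      using schur_bimodule[OF mult(1) PQ] schur_bimodule[OF mult(2) PQ] by simp
    then show "norm (?P * (\<Phi> (\<Psi> T) - \<Psi> (\<Phi> T)) * ?Q) \<le> 0" by (simp add: algebra_simps)
  qed (use assms in auto)
  then show ?thesis by simp
qed

section \<open>Schur products with finite 0-1 masks\<close>

definition mask_map :: "'h bop set \<Rightarrow> 'h bop set \<Rightarrow> ('h bop \<Rightarrow> 'h bop \<Rightarrow> bool) \<Rightarrow> 'h bop \<Rightarrow> 'h bop" where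
  "mask_map \<A> \<B> m T = (\<Sum>A\<in>\<A>. \<Sum>B\<in>\<B>. if m A B then A * T * B else 0)"

definition rectangles_bounded :: "'h bop set \<Rightarrow> 'h bop set \<Rightarrow> ('h bop \<Rightarrow> 'h bop \<Rightarrow> bool) \<Rightarrow> 'h bop \<Rightarrow> real \<Rightarrow> bool" where
  "rectangles_bounded \<A> \<B> m T c \<longleftrightarrow> (\<forall>\<A>' \<B>'. \<A>' \<subseteq> \<A> \<longrightarrow> \<B>' \<subseteq> \<B> \<longrightarrow> (\<forall>A\<in>\<A>'. \<forall>B\<in>\<B>'. m A B) \<longrightarrow>
    norm (\<Sum>\<A>' * T * \<Sum>\<B>') \<le> c)"

text \<open>\<open>T\<close> is measured by its rectangles inside the mask and not by
  \<open>norm T\<close>. In this form the estimate survives multiplication of masks, and rectangles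
  killed by an idempotent are what the distance to its range controls.\<close>

definition rectangle_controlled :: "'h bop set \<Rightarrow> 'h bop set \<Rightarrow> ('h bop \<Rightarrow> 'h bop \<Rightarrow> bool) \<Rightarrow> real \<Rightarrow> bool" where
  "rectangle_controlled \<A> \<B> m K \<longleftrightarrow>
    (\<forall>T c. rectangles_bounded \<A> \<B> m T c \<longrightarrow> norm (mask_map \<A> \<B> m T) \<le> K * c)"

lemma rectangles_boundedD:
  assumes "rectangles_bounded \<A> \<B> m T c" "\<A>' \<subseteq> \<A>" "\<B>' \<subseteq> \<B>"
    "\<And>A B. A \<in> \<A>' \<Longrightarrow> B \<in> \<B>' \<Longrightarrow> m A B"
  shows "norm (\<Sum>\<A>' * T * \<Sum>\<B>') \<le> c"
  using assms unfolding rectangles_bounded_def by simp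

lemma rectangles_bounded_nonneg: "rectangles_bounded \<A> \<B> m T c \<Longrightarrow> 0 \<le> c"
  unfolding rectangles_bounded_def by (metis empty_iff empty_subsetI norm_ge_zero order_trans)

lemma rectangle_controlled_mono: "rectangle_controlled \<A> \<B> m K \<Longrightarrow> K \<le> K' \<Longrightarrow> rectangle_controlled \<A> \<B> m K'"
  unfolding rectangle_controlled_def
  by (meson mult_right_mono order_trans rectangles_bounded_nonneg)

lemma rectangle_controlled_full: "rectangle_controlled \<A> \<B> (\<lambda>_ _. True) 1"
  unfolding rectangle_controlled_def rectangles_bounded_def mask_map_def by (simp add: sum_corner)

text \<open>Pythagoras twice: the values of the blocks are orthogonal, and so are the components of
  \<open>x\<close> on which they act. Block sums therefore cost no constant.\<close>

lemma norm_block_sum_le: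
  fixes P Q X :: "'l \<Rightarrow> 'h bop"
  assumes "finite L" and P: "\<And>l. l \<in> L \<Longrightarrow> orth_proj (P l)" and Q: "\<And>l. l \<in> L \<Longrightarrow> orth_proj (Q l)"
    and PP: "\<And>l k. l \<in> L \<Longrightarrow> k \<in> L \<Longrightarrow> l \<noteq> k \<Longrightarrow> P l * P k = 0"
    and QQ: "\<And>l k. l \<in> L \<Longrightarrow> k \<in> L \<Longrightarrow> l \<noteq> k \<Longrightarrow> Q l * Q k = 0"
    and sumQ: "orth_proj (\<Sum>l\<in>L. Q l)"
    and X: "\<And>l. l \<in> L \<Longrightarrow> P l * X l * Q l = X l" "\<And>l. l \<in> L \<Longrightarrow> norm (X l) \<le> c" and c: "0 \<le> c"
  shows "norm (\<Sum>l\<in>L. X l) \<le> c"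
proof (rule norm_bop_le)
  fix x
  have orth: "cinner (R l \<cdot> y) (R k \<cdot> z) = 0"
    if "\<And>l. l \<in> L \<Longrightarrow> orth_proj (R l)" "\<And>l k. l \<in> L \<Longrightarrow> k \<in> L \<Longrightarrow> l \<noteq> k \<Longrightarrow> R l * R k = 0" "l \<in> L" "k \<in> L" "l \<noteq> k"
    for R :: "'l \<Rightarrow> 'h bop" and l k y z
    using orth_projD[OF that(1)[OF that(3)], of y "R k \<cdot> z"] that(2)[OF that(3-5)]
    by (simp add: bop_times_apply[symmetric] zero_bop_apply cinner_simps del: bop_times_apply)
  have Xx: "X l \<cdot> x = P l \<cdot> X l \<cdot> Q l \<cdot> x" if "l \<in> L" for l using X(1)[OF that] by (metis bop_times_apply)
  have Xq: "X l \<cdot> x = X l \<cdot> Q l \<cdot> x" if "l \<in> L" for l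
    using Xx[OF that] X(1)[OF that] Q[OF that] by (metis bop_times_apply orth_proj_apply)
  have "(norm ((\<Sum>l\<in>L. X l) \<cdot> x))\<^sup>2 = (\<Sum>l\<in>L. (norm (X l \<cdot> x))\<^sup>2)"
    unfolding sum_bop_apply using \<open>finite L\<close>
    by (rule norm_sum_orth) (metis Xx orth[of P] P PP)
  also have "\<dots> \<le> (\<Sum>l\<in>L. c\<^sup>2 * (norm (Q l \<cdot> x))\<^sup>2)"
  proof (rule sum_mono)
    fix l assume l: "l \<in> L"
    have "norm (X l \<cdot> x) \<le> norm (X l) * norm (Q l \<cdot> x)" unfolding Xq[OF l] by (rule norm_bop_apply_le)
    also have "\<dots> \<le> c * norm (Q l \<cdot> x)" by (rule mult_right_mono[OF X(2)[OF l] norm_ge_zero])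
    finally show "(norm (X l \<cdot> x))\<^sup>2 \<le> c\<^sup>2 * (norm (Q l \<cdot> x))\<^sup>2"
      by (metis power_mono norm_ge_zero power_mult_distrib)
  qed
  also have "\<dots> = c\<^sup>2 * (norm ((\<Sum>l\<in>L. Q l) \<cdot> x))\<^sup>2"
    unfolding sum_bop_apply using norm_sum_orth[OF \<open>finite L\<close>, of "\<lambda>l. Q l \<cdot> x"] orth[of Q] Q QQ
    by (simp add: sum_distrib_left)
  also have "\<dots> \<le> (c * norm x)\<^sup>2"
    unfolding power_mult_distrib by (intro mult_left_mono power_mono orth_proj_norm_le sumQ) auto
  finally show "norm ((\<Sum>l\<in>L. X l) \<cdot> x) \<le> c * norm x" by (rule power2_le_imp_le) (use c in simp)
qed fact

text \<open>The mask splits into one block for each label \<open>l\<close>, between the rows and the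
  columns labelled \<open>l\<close>, and these blocks are orthogonal. Compressing \<open>T\<close>
  to a block turns every rectangle inside \<open>m\<close> into one inside the smaller mask, so the
  control by \<open>m\<close> applies to each block with the same \<open>c\<close>.\<close>

lemma rectangle_controlled_block:
  fixes f g :: "'h bop \<Rightarrow> 'l"
  assumes \<A>: "part \<A>" and \<B>: "part \<B>" and m: "rectangle_controlled \<A> \<B> m K" and K: "0 \<le> K"
  shows "rectangle_controlled \<A> \<B> (\<lambda>A B. m A B \<and> f A = g B) K"
  unfolding rectangle_controlled_def
proof (intro allI impI)
  fix T c assume T: "rectangles_bounded \<A> \<B> (\<lambda>A B. m A B \<and> f A = g B) T c"
  have c: "0 \<le> c" by (rule rectangles_bounded_nonneg[OF T])
  note fin = part_finite[OF \<A>] part_finite[OF \<B>]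
  define L where "L = f ` \<A> \<union> g ` \<B>"
  have L: "finite L" using fin by (simp add: L_def)
  define \<A>' where "\<A>' l = {A \<in> \<A>. f A = l}" for l
  define \<B>' where "\<B>' l = {B \<in> \<B>. g B = l}" for l
  let ?P = "\<lambda>l. \<Sum>(\<A>' l)" and ?Q = "\<lambda>l. \<Sum>(\<B>' l)"
  have sub: "\<A>' l \<subseteq> \<A>" "\<B>' l \<subseteq> \<B>" for l by (auto simp: \<A>'_def \<B>'_def)
  let ?X = "\<lambda>l. mask_map \<A> \<B> m (?P l * T * ?Q l)"
  have AP: "A * ?P l = (if f A = l then A else 0)" "?P l * A = (if f A = l then A else 0)" if "A \<in> \<A>" for A l
    using part_sum_times[OF \<A> _ sub(1), of "{A}" l] part_sum_times[OF \<A> sub(1), of "{A}" l] that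
    by (auto simp: \<A>'_def Int_absorb1 Int_absorb2)
  have QB: "?Q l * B = (if g B = l then B else 0)" "B * ?Q l = (if g B = l then B else 0)" if "B \<in> \<B>" for B l
    using part_sum_times[OF \<B> sub(2), of "{B}" l] part_sum_times[OF \<B> _ sub(2), of "{B}" l] that
    by (auto simp: \<B>'_def Int_absorb1 Int_absorb2)
  have X: "?X l = (\<Sum>A\<in>\<A>. \<Sum>B\<in>\<B>. if m A B \<and> f A = l \<and> g B = l then A * T * B else 0)" for l
    unfolding mask_map_def
  proof (intro sum.cong refl)
    fix A B assume AB: "A \<in> \<A>" "B \<in> \<B>"
    have "A * (?P l * T * ?Q l) * B = (A * ?P l) * T * (?Q l * B)" by (simp add: mult.assoc)
    then show "(if m A B then A * (?P l * T * ?Q l) * B else 0) = (if m A B \<and> f A = l \<and> g B = l then A * T * B else 0)"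
      using AP(1)[OF AB(1), of l] QB(1)[OF AB(2), of l] by auto
  qed
  have "mask_map \<A> \<B> (\<lambda>A B. m A B \<and> f A = g B) T = (\<Sum>l\<in>L. ?X l)"
  proof -
    have "(\<Sum>l\<in>L. ?X l) = (\<Sum>A\<in>\<A>. \<Sum>B\<in>\<B>. \<Sum>l\<in>L. if m A B \<and> f A = l \<and> g B = l then A * T * B else 0)"
      unfolding X by (subst sum.swap, rule sum.cong[OF refl], rule sum.swap)
    also have "\<dots> = (\<Sum>A\<in>\<A>. \<Sum>B\<in>\<B>. if m A B \<and> f A = g B then A * T * B else 0)"
    proof (intro sum.cong refl)
      fix A B assume AB: "A \<in> \<A>" "B \<in> \<B>"
      have "(\<Sum>l\<in>L. if m A B \<and> f A = l \<and> g B = l then A * T * B else 0)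
          = (\<Sum>l\<in>L. if l = f A then (if m A B \<and> f A = g B then A * T * B else 0) else 0)"
        by (intro sum.cong) auto
      then show "(\<Sum>l\<in>L. if m A B \<and> f A = l \<and> g B = l then A * T * B else 0)
          = (if m A B \<and> f A = g B then A * T * B else 0)"
        using L AB by (simp add: L_def)
    qed
    finally show ?thesis by (simp add: mask_map_def)
  qed
  also have "norm \<dots> \<le> K * c"
  proof (rule norm_block_sum_le[OF L])
    show "orth_proj (?P l)" for l
      by (rule projs_orth_proj[OF part_sum_projs[OF part_subset[OF \<A> sub(1)]]])
    show "orth_proj (?Q l)" for l
      by (rule projs_orth_proj[OF part_sum_projs[OF part_subset[OF \<B> sub(2)]]])
    show "?P l * ?P k = 0" "?Q l * ?Q k = 0" if "l \<noteq> k" for l k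
    proof -
      have "\<A>' l \<inter> \<A>' k = {}" "\<B>' l \<inter> \<B>' k = {}" using that by (auto simp: \<A>'_def \<B>'_def)
      then show "?P l * ?P k = 0" "?Q l * ?Q k = 0"
        using part_sum_times[OF \<A> sub(1) sub(1)] part_sum_times[OF \<B> sub(2) sub(2)] by simp_all
    qed
    have "(\<Sum>l\<in>L. ?Q l) = \<Sum>\<B>"
      unfolding \<B>'_def by (rule sum.group[OF fin(2) L]) (simp add: L_def)
    then show "orth_proj (\<Sum>l\<in>L. ?Q l)" using part_sum_projs[OF \<B>] projs_orth_proj by simp
    show "?P l * ?X l * ?Q l = ?X l" for l
      unfolding X sum_sandwich
    proof (intro sum.cong refl)
      fix A B assume AB: "A \<in> \<A>" "B \<in> \<B>"
      have "?P l * (A * T * B) * ?Q l = (?P l * A) * T * (B * ?Q l)" by (simp add: mult.assoc)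
      then show "?P l * (if m A B \<and> f A = l \<and> g B = l then A * T * B else 0) * ?Q l
          = (if m A B \<and> f A = l \<and> g B = l then A * T * B else 0)"
        using AP(2)[OF AB(1), of l] QB(2)[OF AB(2), of l] by auto
    qed
    show "norm (?X l) \<le> K * c" for l
    proof -
      have "rectangles_bounded \<A> \<B> m (?P l * T * ?Q l) c"
        unfolding rectangles_bounded_def
      proof (intro allI impI)
        fix \<A>1 \<B>1 assume 1: "\<A>1 \<subseteq> \<A>" "\<B>1 \<subseteq> \<B>" "\<forall>A\<in>\<A>1. \<forall>B\<in>\<B>1. m A B"
        have "\<Sum>\<A>1 * (?P l * T * ?Q l) * \<Sum>\<B>1 = (\<Sum>\<A>1 * ?P l) * T * (?Q l * \<Sum>\<B>1)" by (simp add: mult.assoc)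
        also have "\<dots> = \<Sum>(\<A>1 \<inter> \<A>' l) * T * \<Sum>(\<B>' l \<inter> \<B>1)"
          using part_sum_times[OF \<A> 1(1) sub(1)] part_sum_times[OF \<B> sub(2) 1(2)] by simp
        finally have eq: "\<Sum>\<A>1 * (?P l * T * ?Q l) * \<Sum>\<B>1 = \<Sum>(\<A>1 \<inter> \<A>' l) * T * \<Sum>(\<B>' l \<inter> \<B>1)" .
        show "norm (\<Sum>\<A>1 * (?P l * T * ?Q l) * \<Sum>\<B>1) \<le> c"
          unfolding eq by (rule rectangles_boundedD[OF T]) (use 1 in \<open>auto simp: \<A>'_def \<B>'_def\<close>)
      qed
      then show ?thesis using m by (simp add: rectangle_controlled_def)
    qed
  qed (use K c in simp)
  finally show "norm (mask_map \<A> \<B> (\<lambda>A B. m A B \<and> f A = g B) T) \<le> K * c" .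
qed

text \<open>Averaging over the sets \<open>S\<close> of labels: two distinct labels are separated by exactly half of
  the sets \<open>S\<close>, and the pairs separated by \<open>S\<close> form two blocks.\<close>

lemma rectangle_controlled_block_compl:
  fixes f g :: "'h bop \<Rightarrow> 'l"
  assumes \<A>: "part \<A>" and \<B>: "part \<B>" and m: "rectangle_controlled \<A> \<B> m K" and K: "0 \<le> K"
  shows "rectangle_controlled \<A> \<B> (\<lambda>A B. m A B \<and> f A \<noteq> g B) (2 * K)"
  unfolding rectangle_controlled_def
proof (intro allI impI)
  fix T c assume T: "rectangles_bounded \<A> \<B> (\<lambda>A B. m A B \<and> f A \<noteq> g B) T c"
  define L where "L = f ` \<A> \<union> g ` \<B>"
  have L: "finite L" using part_finite[OF \<A>] part_finite[OF \<B>] by (simp add: L_def)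
  \<comment> \<open>Separation by \<open>S\<close> is written as equality of two Boolean labels, so
    the estimate for blocks applies with the constant \<open>K\<close>. Separated labels differ, so
    the rectangles of \<open>?m S\<close> lie inside the original mask.\<close>
  let ?m = "\<lambda>S A B. m A B \<and> (f A \<in> S) = (g B \<notin> S)"
  let ?M = "mask_map \<A> \<B> (\<lambda>A B. m A B \<and> f A \<noteq> g B) T"
  have le: "norm (mask_map \<A> \<B> (?m S) T) \<le> K * c" for S
  proof -
    have "rectangles_bounded \<A> \<B> (?m S) T c"
      unfolding rectangles_bounded_def
    proof (intro allI impI)
      fix \<A>' \<B>' assume 1: "\<A>' \<subseteq> \<A>" "\<B>' \<subseteq> \<B>" "\<forall>A\<in>\<A>'. \<forall>B\<in>\<B>'. ?m S A B"
      then have "m A B \<and> f A \<noteq> g B" if "A \<in> \<A>'" "B \<in> \<B>'" for A B using that by fastforce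
      then show "norm (\<Sum>\<A>' * T * \<Sum>\<B>') \<le> c"
        by (intro rectangles_boundedD[OF T 1(1,2)])
    qed
    then show ?thesis using rectangle_controlled_block[OF \<A> \<B> m K, of "\<lambda>A. f A \<in> S" "\<lambda>B. g B \<notin> S"]
      by (simp add: rectangle_controlled_def)
  qed
  have "2 *\<^sub>R (\<Sum>S\<in>Pow L. mask_map \<A> \<B> (?m S) T)
      = (\<Sum>A\<in>\<A>. \<Sum>B\<in>\<B>. 2 *\<^sub>R (\<Sum>S\<in>Pow L. if ?m S A B then A * T * B else 0))"
    unfolding mask_map_def scaleR_sum_right by (subst sum.swap, rule sum.cong[OF refl], rule sum.swap)
  also have "\<dots> = (\<Sum>A\<in>\<A>. \<Sum>B\<in>\<B>. (2 ^ card L) *\<^sub>R (if m A B \<and> f A \<noteq> g B then A * T * B else 0))"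
  proof (intro sum.cong refl)
    fix A B assume AB: "A \<in> \<A>" "B \<in> \<B>"
    let ?n = "card {S \<in> Pow L. (f A \<in> S) = (g B \<notin> S)}"
    have "(\<Sum>S\<in>Pow L. if ?m S A B then A * T * B else 0)
        = (\<Sum>S\<in>{S \<in> Pow L. (f A \<in> S) = (g B \<notin> S)}. if m A B then A * T * B else 0)"
      using L by (subst sum.inter_filter) (auto intro!: sum.cong)
    also have "\<dots> = real ?n *\<^sub>R (if m A B then A * T * B else 0)" by (rule sum_constant_scaleR)
    finally have "2 *\<^sub>R (\<Sum>S\<in>Pow L. if ?m S A B then A * T * B else 0) = real (2 * ?n) *\<^sub>R (if m A B then A * T * B else 0)"
      by simp
    also have "\<dots> = (2 ^ card L) *\<^sub>R (if m A B \<and> f A \<noteq> g B then A * T * B else 0)"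
    proof (cases "f A = g B")
      case False
      then have "2 * ?n = 2 ^ card L" using AB L by (intro card_separating_sets) (auto simp: L_def)
      then have "real (2 * ?n) = 2 ^ card L" by simp
      then show ?thesis using False by (simp only: simp_thms)
    qed simp
    finally show "2 *\<^sub>R (\<Sum>S\<in>Pow L. if ?m S A B then A * T * B else 0)
      = (2 ^ card L) *\<^sub>R (if m A B \<and> f A \<noteq> g B then A * T * B else 0)" .
  qed
  also have "\<dots> = (2 ^ card L) *\<^sub>R ?M" unfolding mask_map_def scaleR_sum_right ..
  finally have "norm (2 *\<^sub>R (\<Sum>S\<in>Pow L. mask_map \<A> \<B> (?m S) T)) = norm ((2 ^ card L) *\<^sub>R ?M)" by simp
  then have "2 ^ card L * norm ?M = norm (2 *\<^sub>R (\<Sum>S\<in>Pow L. mask_map \<A> \<B> (?m S) T))"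
    unfolding norm_scaleR by simp
  also have "\<dots> \<le> 2 * (\<Sum>S\<in>Pow L. norm (mask_map \<A> \<B> (?m S) T))"
    by (simp add: norm_sum)
  also have "\<dots> \<le> 2 * (\<Sum>S\<in>Pow L. K * c)" by (intro mult_left_mono sum_mono le) simp
  also have "\<dots> = 2 ^ card L * (2 * K * c)" using L by (simp add: card_Pow)
  finally show "norm ?M \<le> 2 * K * c" by simp
qed

end

section \<open>Contractive idempotents and the lattice they generate\<close>

lemma rank_one_exists: "\<exists>R. \<forall>x. R \<cdot> x = cinner x v *\<^sub>C (u::'h::chilbert_space)"
proof -
  have "clinear (\<lambda>x. cinner x v *\<^sub>C u)"
    by (simp add: clinear_def cinner_simps scaleC_add_left scaleC_scaleC)
  moreover have "norm (cinner x v *\<^sub>C u) \<le> (norm v * norm u) * norm x" for x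
    using mult_right_mono[OF cauchy_schwarz[of x v] norm_ge_zero[of u]] by (simp add: norm_scaleC mult_ac)
  ultimately show ?thesis using bop_of_clinear[of "\<lambda>x. cinner x v *\<^sub>C u"] by metis
qed

lemma orth_proj_unit_vector:
  assumes "orth_proj P" "P \<noteq> 0"
  obtains u where "P \<cdot> u = u" "norm u = 1"
proof -
  obtain x where x: "P \<cdot> x \<noteq> 0" using assms(2) bop_eqI[of P 0] by (metis zero_bop_apply)
  show ?thesis
    by (rule that[of "(1 / norm (P \<cdot> x)) *\<^sub>R (P \<cdot> x)"]) (use x in \<open>simp_all add: bop_apply_scaleR assms(1)\<close>)
qed

context masa_algebra
begin

text \<open>A contractive idempotent mask contains no \<open>2 \<times> 2\<close> block with exactly one zero: the matrix
  with rows \<open>(1, 1)\<close>, \<open>(1, -1)\<close> has norm \<open>\<surd>2\<close>, but replacing \<open>-1\<close> by \<open>0\<close> gives norm at least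
  \<open>\<surd>(13/5)\<close>, as is seen on the vector \<open>(2, 1)\<close>.\<close>

lemma contractive_pattern:
  assumes \<Phi>: "\<Phi> \<in> schur_idempotents D" "\<And>T. norm (\<Phi> T) \<le> norm T"
    and A: "A1 \<in> projs" "A2 \<in> projs" "A1 \<noteq> 0" "A2 \<noteq> 0" "A1 * A2 = 0"
    and B: "B1 \<in> projs" "B2 \<in> projs" "B1 \<noteq> 0" "B2 \<noteq> 0" "B1 * B2 = 0"
    and one: "\<And>T. \<Phi> (A1 * T * B1) = A1 * T * B1" "\<And>T. \<Phi> (A1 * T * B2) = A1 * T * B2"
      "\<And>T. \<Phi> (A2 * T * B1) = A2 * T * B1" and zero: "\<And>T. \<Phi> (A2 * T * B2) = 0"
  shows False
proof -
  note lin = schur_idempotents_clinear[OF \<Phi>(1)]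
  obtain a1 a2 b1 b2 where v: "A1 \<cdot> a1 = a1" "norm a1 = 1" "A2 \<cdot> a2 = a2" "norm a2 = 1"
    "B1 \<cdot> b1 = b1" "norm b1 = 1" "B2 \<cdot> b2 = b2" "norm b2 = 1"
    using A B projs_orth_proj orth_proj_unit_vector by metis
  have orth: "cinner u w = 0" if "P \<in> projs" "P * Q = 0" "P \<cdot> u = u" "Q \<cdot> w = w" for P Q u w
    using projs_adj[OF that(1), of u w] that(2-4)
    by (metis bop_times_apply zero_bop_apply cinner_zero_right)
  have a12: "cinner a1 a2 = 0" and b12: "cinner b1 b2 = 0" using orth A B v by metis+
  obtain R where R: "\<And>u w x. R u w \<cdot> x = cinner x w *\<^sub>C (u::'h)" using rank_one_exists by metis
  have corner: "P * R u w * Q = R u w" if "P \<in> projs" "Q \<in> projs" "P \<cdot> u = u" "Q \<cdot> w = w" for P Q u w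
    using that by (intro bop_eqI)
      (simp add: bop_times_apply R bop_apply_scaleC projs_adj[OF that(2)])
  define T where "T = R a1 b1 + R a1 b2 + R a2 b1 - R a2 b2"
  have \<Phi>T: "\<Phi> T = R a1 b1 + R a1 b2 + R a2 b1"
    unfolding T_def lin
    using one(1)[of "R a1 b1"] one(2)[of "R a1 b2"] one(3)[of "R a2 b1"] zero[of "R a2 b2"] v A B
    by (simp add: corner)
  have sq: "(norm (p *\<^sub>C a1 + q *\<^sub>C a2))\<^sup>2 = (cmod p)\<^sup>2 + (cmod q)\<^sup>2" for p q
    using norm_add_orth[of "p *\<^sub>C a1" "q *\<^sub>C a2"] by (simp add: cinner_simps a12 norm_scaleC v)
  have "norm T \<le> sqrt 2"
  proof (rule norm_bop_le)
    fix x
    let ?s = "cinner x b1" and ?t = "cinner x b2"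
    have "T \<cdot> x = (?s + ?t) *\<^sub>C a1 + (?s - ?t) *\<^sub>C a2"
      by (simp add: T_def bop_simps R scaleC_add_left scaleC_diff_left)
    then have "(norm (T \<cdot> x))\<^sup>2 = (cmod (?s + ?t))\<^sup>2 + (cmod (?s - ?t))\<^sup>2" by (simp add: sq)
    also have "\<dots> = 2 * ((cmod ?s)\<^sup>2 + (cmod ?t)\<^sup>2)"
      unfolding cmod_power2 by (simp add: power2_eq_square algebra_simps)
    also have "\<dots> \<le> 2 * (norm x)\<^sup>2"
    proof -
      have coeff: "cmod (cinner x w) \<le> norm (P \<cdot> x)" if "P \<in> projs" "P \<cdot> w = w" "norm w = 1" for P w
        using cauchy_schwarz[of "P \<cdot> x" w] that projs_adj[OF that(1), of x w] by simp
      have "cmod ?s \<le> norm (B1 \<cdot> x)" "cmod ?t \<le> norm (B2 \<cdot> x)" using coeff B v by auto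
      then have "(cmod ?s)\<^sup>2 + (cmod ?t)\<^sup>2 \<le> (norm (B1 \<cdot> x))\<^sup>2 + (norm (B2 \<cdot> x))\<^sup>2"
        by (intro add_mono power_mono) auto
      also have "\<dots> = (norm ((B1 + B2) \<cdot> x))\<^sup>2"
      proof -
        have "cinner (B1 \<cdot> x) (B2 \<cdot> x) = 0"
          using orth[OF B(1) B(5)] B projs_orth_proj by simp
        then show ?thesis by (simp add: plus_bop_apply norm_add_orth)
      qed
      also have "\<dots> \<le> (norm x)\<^sup>2"
        using projs_norm_le[OF projs_add[OF B(1,2,5)]] by (intro power_mono) auto
      finally show ?thesis by simp
    qed
    finally have "(norm (T \<cdot> x))\<^sup>2 \<le> (sqrt 2 * norm x)\<^sup>2" by (simp add: power_mult_distrib)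
    then show "norm (T \<cdot> x) \<le> sqrt 2 * norm x" by (rule power2_le_imp_le) simp
  qed simp
  then have \<Phi>_le: "norm (\<Phi> T) \<le> sqrt 2" using \<Phi>(2)[of T] by simp
  define x where "x = 2 *\<^sub>C b1 + b2"
  have "cinner b2 b1 = 0" using b12 cinner_commute by (metis complex_cnj_zero)
  moreover have "cinner b1 b1 = 1" "cinner b2 b2 = 1" using v by (simp_all add: cinner_self)
  ultimately have "\<Phi> T \<cdot> x = 3 *\<^sub>C a1 + 2 *\<^sub>C a2"
    using scaleC_add_left[of 2 1 a1]
    by (simp add: \<Phi>T x_def bop_simps R cinner_simps b12 scaleC_one scaleC_add_right)
  then have "(norm (\<Phi> T \<cdot> x))\<^sup>2 = 13" by (simp add: sq)
  moreover have "(norm x)\<^sup>2 = 5"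
    unfolding x_def using norm_add_orth[of "2 *\<^sub>C b1" b2] by (simp add: cinner_simps b12 norm_scaleC v)
  moreover have "(norm (\<Phi> T \<cdot> x))\<^sup>2 \<le> (sqrt 2 * norm x)\<^sup>2"
    using order_trans[OF norm_bop_apply_le mult_right_mono[OF \<Phi>_le norm_ge_zero]] by (intro power_mono) auto
  ultimately show False by (simp add: power_mult_distrib)
qed

text \<open>The forbidden pattern says that two rows sharing one column share all their columns. So
  the sets \<open>row A\<close> are equal or disjoint, and can serve as labels.\<close>

lemma contractive_labels:
  assumes \<Phi>: "\<Phi> \<in> schur_idempotents D" "\<And>T. norm (\<Phi> T) \<le> norm T"
    and AB: "schur_partition F \<A> \<B>" "\<Phi> \<in> F"
  shows "\<exists>f g :: 'h bop \<Rightarrow> 'h bop set option.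
    \<forall>A\<in>\<A>. \<forall>B\<in>\<B>. \<forall>T. \<Phi> (A * T * B) = (if f A = g B then A * T * B else 0)"
proof -
  have parts: "part \<A>" "part \<B>" using AB(1) by (auto simp: schur_partition_def)
  define one where "one A B \<longleftrightarrow> (\<forall>T. \<Phi> (A * T * B) = A * T * B)" for A B
  have zero: "\<Phi> (A * T * B) = 0" if "A \<in> \<A>" "B \<in> \<B>" "\<not> one A B" for A B T
    using AB that unfolding schur_partition_def schur_rectangle_def one_def by blast
  have pattern: "one A2 B2"
    if "A1 \<in> \<A>" "A2 \<in> \<A>" "B1 \<in> \<B>" "B2 \<in> \<B>" "one A1 B1" "one A1 B2" "one A2 B1" for A1 A2 B1 B2
  proof (rule ccontr)
    assume not: "\<not> one A2 B2"
    then have "A1 \<noteq> A2" "B1 \<noteq> B2" using that by auto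
    then show False
      using that(5-7) zero[OF that(2,4) not] parts that part_projs part_nonzero part_orth unfolding one_def
      by (intro contractive_pattern[OF \<Phi>, of A1 A2 B1 B2]) auto
  qed
  define row where "row A = {B \<in> \<B>. one A B}" for A
  define f where "f A = Some (row A)" for A
  define rep where "rep B = (SOME A. A \<in> \<A> \<and> one A B)" for B
  \<comment> \<open>A column takes the label of any row that meets it. A column that meets no row
    gets \<open>None\<close>, which is no row label; the label \<open>Some {}\<close> of an empty
    row is taken by no column of \<open>\<B>\<close>.\<close>
  define g where "g B = (if \<exists>A\<in>\<A>. one A B then Some (row (rep B)) else None)" for B
  have iff: "f A = g B \<longleftrightarrow> one A B" if A: "A \<in> \<A>" and B: "B \<in> \<B>" for A B
  proof
    assume eq: "f A = g B"
    then have "\<exists>A\<in>\<A>. one A B" by (auto simp: f_def g_def split: if_splits)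
    then have "rep B \<in> \<A> \<and> one (rep B) B" unfolding rep_def by (intro someI_ex[of "\<lambda>A. A \<in> \<A> \<and> one A B"]) blast
    then have "B \<in> row (rep B)" using B by (simp add: row_def)
    moreover have "row A = row (rep B)" using eq by (simp add: f_def g_def split: if_splits)
    ultimately have "B \<in> row A" by simp
    then show "one A B" by (simp add: row_def)
  next
    assume 1: "one A B"
    then have rep: "rep B \<in> \<A>" "one (rep B) B"
      unfolding rep_def using someI_ex[of "\<lambda>A. A \<in> \<A> \<and> one A B"] A by blast+
    have "row A = row (rep B)"
      using pattern[OF A rep(1) B] pattern[OF rep(1) A B] 1 rep(2) by (auto simp: row_def)
    then show "f A = g B" using A 1 by (auto simp: f_def g_def)
  qed
  show ?thesis
  proof (intro exI ballI allI)
    fix A B T assume AB: "A \<in> \<A>" "B \<in> \<B>"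
    show "\<Phi> (A * T * B) = (if f A = g B then A * T * B else 0)"
    proof (cases "one A B")
      case True
      then have "\<Phi> (A * T * B) = A * T * B" unfolding one_def by blast
      then show ?thesis using True iff[OF AB] by simp
    next
      case False
      then show ?thesis using zero[OF AB False] iff[OF AB] by simp
    qed
  qed
qed

section \<open>Words in contractive idempotents and their complements\<close>

fun literal_product :: "(('h bop \<Rightarrow> 'h bop) \<times> bool) list \<Rightarrow> 'h bop \<Rightarrow> 'h bop" where
  "literal_product [] T = T"
| "literal_product ((\<Phi>, True) # w) T = \<Phi> (literal_product w T)"
| "literal_product ((\<Phi>, False) # w) T = literal_product w T - \<Phi> (literal_product w T)"

lemma contractiveD:
  assumes "\<Phi> \<in> contractive_schur_idempotents D"
  shows "\<Phi> \<in> schur_idempotents D" "norm (\<Phi> T) \<le> norm T"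
proof -
  show \<Phi>: "\<Phi> \<in> schur_idempotents D" using assms by (simp add: contractive_schur_idempotents_def)
  have le1: "norm (\<Phi> S) \<le> 1" if "norm S \<le> 1" for S
  proof -
    have "ennreal (norm (\<Phi> S)) \<le> map_norm \<Phi>" unfolding map_norm_def by (rule SUP_upper) (simp add: that)
    also have "\<dots> \<le> 1" using assms by (simp add: contractive_schur_idempotents_def)
    finally show ?thesis by simp
  qed
  show "norm (\<Phi> T) \<le> norm T"
  proof (cases "T = 0")
    case True
    then show ?thesis by (simp add: schur_idempotents_clinear[OF \<Phi>])
  next
    case False
    have "norm (\<Phi> (of_real (1 / norm T) *\<^sub>C T)) \<le> 1" by (rule le1) (simp add: norm_scaleC norm_divide False)
    then show ?thesis using False by (simp add: schur_idempotents_clinear[OF \<Phi>] norm_scaleC norm_divide field_simps)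
  qed
qed

definition contractive_word :: "(('h bop \<Rightarrow> 'h bop) \<times> bool) list \<Rightarrow> bool" where
  "contractive_word w \<longleftrightarrow> fst ` set w \<subseteq> contractive_schur_idempotents D"

lemma literal_product_add:
  "contractive_word w \<Longrightarrow> literal_product w (S + T) = literal_product w S + literal_product w T"
proof (induction w)
  case (Cons l w)
  obtain \<Phi> b where l: "l = (\<Phi>, b)" by (cases l)
  have "\<Phi> \<in> contractive_schur_idempotents D" "contractive_word w"
    using Cons.prems by (auto simp: l contractive_word_def)
  then show ?case
    using Cons.IH by (cases b) (simp_all add: l schur_idempotents_clinear[OF contractiveD(1)])
qed simp

lemma literal_product_0: "contractive_word w \<Longrightarrow> literal_product w 0 = 0"
  using literal_product_add[of w 0 0] by simp

lemma literal_product_append: "literal_product (v @ w) T = literal_product v (literal_product w T)"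
  by (induction v T rule: literal_product.induct) simp_all

text \<open>A further literal intersects the mask with the equality of labels or with its negation,
  as the flag \<open>b\<close> selects. The former costs no factor and the latter a factor 2; the
  larger one is used for both, so that only the length of a word counts.\<close>

lemma literal_product_Cons_mask:
  assumes "\<Phi> \<in> contractive_schur_idempotents D" "schur_partition F \<A> \<B>" "\<Phi> \<in> F"
    and "rectangle_controlled \<A> \<B> m K" "0 \<le> K"
    and m: "\<forall>A\<in>\<A>. \<forall>B\<in>\<B>. \<forall>T. literal_product w (A * T * B) = (if m A B then A * T * B else 0)"
  shows "\<exists>m. rectangle_controlled \<A> \<B> m (2 * K) \<and>
    (\<forall>A\<in>\<A>. \<forall>B\<in>\<B>. \<forall>T. literal_product ((\<Phi>, b) # w) (A * T * B) = (if m A B then A * T * B else 0))"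
proof -
  have parts: "part \<A>" "part \<B>" using assms(2) by (auto simp: schur_partition_def)
  note lin = schur_idempotents_clinear[OF contractiveD(1)[OF assms(1)]]
  obtain f g :: "'h bop \<Rightarrow> 'h bop set option"
    where fg: "\<forall>A\<in>\<A>. \<forall>B\<in>\<B>. \<forall>T. \<Phi> (A * T * B) = (if f A = g B then A * T * B else 0)"
    using contractive_labels[OF contractiveD[OF assms(1)] assms(2,3)] by (elim exE)
  have "rectangle_controlled \<A> \<B> (\<lambda>A B. m A B \<and> f A = g B) (2 * K)"
    by (rule rectangle_controlled_mono[OF rectangle_controlled_block[OF parts assms(4,5)]]) (use assms(5) in simp)
  moreover have "rectangle_controlled \<A> \<B> (\<lambda>A B. m A B \<and> f A \<noteq> g B) (2 * K)"
    by (rule rectangle_controlled_block_compl[OF parts assms(4,5)])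
  ultimately show ?thesis
    using m fg by (intro exI[of _ "\<lambda>A B. m A B \<and> (f A = g B) = b"]) (cases b; simp add: lin)
qed

lemma literal_product_mask:
  assumes "contractive_word w" "schur_partition F \<A> \<B>" "fst ` set w \<subseteq> F"
  shows "\<exists>m. rectangle_controlled \<A> \<B> m (2 ^ length w) \<and>
    (\<forall>A\<in>\<A>. \<forall>B\<in>\<B>. \<forall>T. literal_product w (A * T * B) = (if m A B then A * T * B else 0))"
  using assms(1,3)
proof (induction w)
  case Nil
  show ?case by (rule exI[of _ "\<lambda>_ _. True"]) (simp add: rectangle_controlled_full)
next
  case (Cons l w)
  obtain \<Phi> b where l: "l = (\<Phi>, b)" by (cases l)
  have \<Phi>: "\<Phi> \<in> contractive_schur_idempotents D" "contractive_word w" "\<Phi> \<in> F" "fst ` set w \<subseteq> F"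
    using Cons.prems by (auto simp: l contractive_word_def)
  obtain m where m: "rectangle_controlled \<A> \<B> m (2 ^ length w)"
    "\<forall>A\<in>\<A>. \<forall>B\<in>\<B>. \<forall>T. literal_product w (A * T * B) = (if m A B then A * T * B else 0)"
    using Cons.IH[OF \<Phi>(2,4)] by blast
  show ?case
    unfolding l length_Cons power_Suc
    by (rule literal_product_Cons_mask[OF \<Phi>(1) assms(2) \<Phi>(3) m(1) _ m(2)]) simp
qed

text \<open>A list admits repeated words, so the coefficients are nonnegative integers; negative
  ones are excluded on purpose.\<close>

definition sum_of_literal_products :: "('h bop \<Rightarrow> 'h bop) \<Rightarrow> bool" where
  "sum_of_literal_products \<Theta> \<longleftrightarrow> (\<exists>ws. (\<forall>w\<in>set ws. contractive_word w) \<and>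
    (\<forall>T. \<Theta> T = (\<Sum>w\<leftarrow>ws. literal_product w T)))"

lemma sum_of_literal_products_add:
  assumes "sum_of_literal_products \<Theta>" "sum_of_literal_products \<Psi>"
  shows "sum_of_literal_products (\<lambda>T. \<Theta> T + \<Psi> T)"
proof -
  obtain vs ws where "\<forall>w\<in>set vs. contractive_word w" "\<forall>T. \<Theta> T = (\<Sum>w\<leftarrow>vs. literal_product w T)"
    "\<forall>w\<in>set ws. contractive_word w" "\<forall>T. \<Psi> T = (\<Sum>w\<leftarrow>ws. literal_product w T)"
    using assms unfolding sum_of_literal_products_def by metis
  then show ?thesis unfolding sum_of_literal_products_def by (intro exI[of _ "vs @ ws"]) auto
qed

lemma sum_of_literal_products_comp:
  assumes "sum_of_literal_products \<Theta>" "sum_of_literal_products \<Psi>"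
  shows "sum_of_literal_products (\<lambda>T. \<Theta> (\<Psi> T))"
proof -
  obtain vs ws where vs: "\<And>w. w \<in> set vs \<Longrightarrow> contractive_word w" "\<And>T. \<Theta> T = (\<Sum>w\<leftarrow>vs. literal_product w T)"
    and ws: "\<And>w. w \<in> set ws \<Longrightarrow> contractive_word w" "\<And>T. \<Psi> T = (\<Sum>w\<leftarrow>ws. literal_product w T)"
    using assms unfolding sum_of_literal_products_def by metis
  have dist: "literal_product v (\<Sum>w\<leftarrow>us. literal_product w T) = (\<Sum>w\<leftarrow>us. literal_product (v @ w) T)"
    if "v \<in> set vs" for v us T
    by (induction us) (simp_all add: literal_product_0 literal_product_add vs(1) that literal_product_append)
  have "\<Theta> (\<Psi> T) = (\<Sum>u\<leftarrow>concat (map (\<lambda>v. map (\<lambda>w. v @ w) ws) vs). literal_product u T)" for T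
  proof -
    have "\<Theta> (\<Psi> T) = (\<Sum>v\<leftarrow>vs. \<Sum>w\<leftarrow>ws. literal_product (v @ w) T)"
      unfolding vs(2) ws(2) by (rule arg_cong[of _ _ sum_list], rule map_cong) (simp_all add: dist)
    also have "\<dots> = (\<Sum>u\<leftarrow>concat (map (\<lambda>v. map (\<lambda>w. v @ w) ws) vs). literal_product u T)"
      by (induction vs) (simp_all add: o_def)
    finally show ?thesis .
  qed
  moreover have "contractive_word u" if u: "u \<in> set (concat (map (\<lambda>v. map (\<lambda>w. v @ w) ws) vs))" for u
  proof -
    obtain v w where "v \<in> set vs" "w \<in> set ws" "u = v @ w" using u by auto
    then show ?thesis using vs(1)[of v] ws(1)[of w] by (simp add: contractive_word_def image_Un)
  qed
  ultimately show ?thesis unfolding sum_of_literal_products_def by blast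
qed

lemma schur_idempotentsI:
  assumes "\<And>S T. \<Phi> (S + T) = \<Phi> S + \<Phi> T" "\<And>c T. \<Phi> (c *\<^sub>C T) = c *\<^sub>C \<Phi> T"
    and "\<And>w. w \<in> weak_star_functionals \<Longrightarrow> continuous_map weak_star_topology euclidean (\<lambda>T. w (\<Phi> T))"
    and "\<And>A B T. A \<in> D \<Longrightarrow> B \<in> D \<Longrightarrow> \<Phi> (A * T * B) = A * \<Phi> T * B" "\<And>T. \<Phi> (\<Phi> T) = \<Phi> T"
  shows "\<Phi> \<in> schur_idempotents D"
  using assms unfolding schur_idempotents_def schur_multiplier_def clinear_def bop_comp_eq_times
    continuous_map_into_weak_star by (auto simp: fun_eq_iff)

lemma schur_idempotents_compl:
  assumes "\<Phi> \<in> schur_idempotents D"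
  shows "schur_compl \<Phi> \<in> schur_idempotents D"
proof (rule schur_idempotentsI)
  note lin = schur_idempotents_clinear[OF assms]
  have mult: "schur_multiplier D \<Phi>" using assms by (simp add: schur_idempotents_def)
  show "schur_compl \<Phi> (S + T) = schur_compl \<Phi> S + schur_compl \<Phi> T" for S T by (simp add: schur_compl_def lin)
  show "schur_compl \<Phi> (c *\<^sub>C T) = c *\<^sub>C schur_compl \<Phi> T" for c T
    by (simp add: schur_compl_def lin scaleC_diff_right)
  show "schur_compl \<Phi> (A * T * B) = A * schur_compl \<Phi> T * B" if "A \<in> D" "B \<in> D" for A B T
    using schur_bimodule[OF mult that] by (simp add: schur_compl_def algebra_simps)
  show "schur_compl \<Phi> (schur_compl \<Phi> T) = schur_compl \<Phi> T" for T by (simp add: schur_compl_def lin)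
  fix w assume w: "w \<in> (weak_star_functionals :: ('h bop \<Rightarrow> complex) set)"
  have "continuous_map weak_star_topology euclidean (\<lambda>T. w T - w (\<Phi> T))"
    using w mult unfolding schur_multiplier_def continuous_map_into_weak_star
    by (intro continuous_map_diff weak_star_functional_continuous[OF w]) blast
  then show "continuous_map weak_star_topology euclidean (\<lambda>T. w (schur_compl \<Phi> T))"
    using w by (simp add: schur_compl_def lin_functional_diff weak_star_functional_lin)
qed

lemma schur_idempotents_meet:
  assumes \<Phi>: "\<Phi> \<in> schur_idempotents D" and \<Psi>: "\<Psi> \<in> schur_idempotents D"
  shows "schur_meet \<Phi> \<Psi> \<in> schur_idempotents D"
proof (rule schur_idempotentsI)
  note lin = schur_idempotents_clinear[OF \<Phi>] schur_idempotents_clinear[OF \<Psi>]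
  have mult: "schur_multiplier D \<Phi>" "schur_multiplier D \<Psi>" using assms by (simp_all add: schur_idempotents_def)
  show "schur_meet \<Phi> \<Psi> (S + T) = schur_meet \<Phi> \<Psi> S + schur_meet \<Phi> \<Psi> T" for S T by (simp add: schur_meet_def lin)
  show "schur_meet \<Phi> \<Psi> (c *\<^sub>C T) = c *\<^sub>C schur_meet \<Phi> \<Psi> T" for c T by (simp add: schur_meet_def lin)
  show "schur_meet \<Phi> \<Psi> (A * T * B) = A * schur_meet \<Phi> \<Psi> T * B" if "A \<in> D" "B \<in> D" for A B T
    using schur_bimodule[OF mult(1) that] schur_bimodule[OF mult(2) that] by (simp add: schur_meet_def)
  show "schur_meet \<Phi> \<Psi> (schur_meet \<Phi> \<Psi> T) = schur_meet \<Phi> \<Psi> T" for T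
    by (simp add: schur_meet_def lin schur_idempotents_commute[OF \<Psi> \<Phi>])
  fix w assume w: "w \<in> (weak_star_functionals :: ('h bop \<Rightarrow> complex) set)"
  have "continuous_map weak_star_topology weak_star_topology (\<Phi> \<circ> \<Psi>)"
    using mult unfolding schur_multiplier_def by (intro continuous_map_compose[of _ weak_star_topology]) auto
  then show "continuous_map weak_star_topology euclidean (\<lambda>T. w (schur_meet \<Phi> \<Psi> T))"
    using w unfolding continuous_map_into_weak_star schur_meet_def by blast
qed

text \<open>The element and its complement go through the induction together, because avoiding signs
  mixes them: the complement of a meet is \<Phi>' + \<Phi> \<Psi>' and a join is \<Phi> + \<Phi>'
  \<Psi>, where the prime denotes complements. Both are sums over disjoint masks.\<close>

lemma contractive_lattice_sum:
  assumes "\<Theta> \<in> contractive_lattice D"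
  shows "\<Theta> \<in> schur_idempotents D \<and> sum_of_literal_products \<Theta> \<and> sum_of_literal_products (schur_compl \<Theta>)"
  using assms
proof induction
  case (contractive \<Phi>)
  have "contractive_word [(\<Phi>, b)]" for b using contractive by (simp add: contractive_word_def)
  then have "sum_of_literal_products \<Phi>" "sum_of_literal_products (schur_compl \<Phi>)"
    unfolding sum_of_literal_products_def schur_compl_def
    by (intro exI[of _ "[[(\<Phi>, True)]]"] exI[of _ "[[(\<Phi>, False)]]"]; simp)+
  then show ?case using contractiveD(1)[OF contractive] by blast
next
  case (meet \<Phi> \<Psi>)
  note lin = schur_idempotents_clinear[OF conjunct1[OF meet.IH(1)]]
  have "schur_compl (schur_meet \<Phi> \<Psi>) = (\<lambda>T. schur_compl \<Phi> T + \<Phi> (schur_compl \<Psi> T))"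
    by (simp add: fun_eq_iff schur_compl_def schur_meet_def lin)
  moreover have "schur_meet \<Phi> \<Psi> = (\<lambda>T. \<Phi> (\<Psi> T))" by (simp add: fun_eq_iff schur_meet_def)
  ultimately show ?case
    using meet.IH schur_idempotents_meet[of \<Phi> \<Psi>] sum_of_literal_products_comp[of \<Phi> \<Psi>]
      sum_of_literal_products_add[OF _ sum_of_literal_products_comp, of "schur_compl \<Phi>" \<Phi> "schur_compl \<Psi>"]
    by (metis (no_types, lifting))
next
  case (join \<Phi> \<Psi>)
  note lin = schur_idempotents_clinear[OF conjunct1[OF join.IH(1)]]
  have "schur_join \<Phi> \<Psi> = (\<lambda>T. \<Phi> T + schur_compl \<Phi> (\<Psi> T))"
    by (simp add: fun_eq_iff schur_compl_def schur_join_def)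
  moreover have "schur_compl (schur_join \<Phi> \<Psi>) = (\<lambda>T. schur_compl \<Phi> (schur_compl \<Psi> T))"
    by (simp add: fun_eq_iff schur_compl_def schur_join_def lin algebra_simps)
  \<comment> \<open>De Morgan: joins of Schur idempotents are Schur idempotents because complements
    and meets are.\<close>
  moreover have "schur_join \<Phi> \<Psi> = schur_compl (schur_meet (schur_compl \<Phi>) (schur_compl \<Psi>))"
    by (simp add: fun_eq_iff schur_compl_def schur_join_def schur_meet_def lin algebra_simps)
  ultimately show ?case
    using join.IH schur_idempotents_compl schur_idempotents_meet
      sum_of_literal_products_comp[of "schur_compl \<Phi>" "schur_compl \<Psi>"]
      sum_of_literal_products_add[OF _ sum_of_literal_products_comp, of \<Phi> "schur_compl \<Phi>" \<Psi>]
    by (metis (no_types, lifting))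
next
  case (compl \<Phi>)
  have "schur_compl (schur_compl \<Phi>) = \<Phi>" by (simp add: fun_eq_iff schur_compl_def)
  then show ?case using compl.IH schur_idempotents_compl by simp
qed

section \<open>From vanishing corners to the distance estimate\<close>

lemma norm_corner_le_alpha:
  assumes P: "orth_proj P" and Q: "orth_proj Q" and ann: "\<And>X. X \<in> \<X> \<Longrightarrow> P * X * Q = 0"
    and c: "alpha T \<X> = ennreal c" "0 \<le> c"
  shows "norm (P * T * Q) \<le> c"
proof (rule norm_bop_le)
  fix u
  show "norm ((P * T * Q) \<cdot> u) \<le> c * norm u"
  proof (cases "Q \<cdot> u = 0")
    case True
    then show ?thesis using c(2) by (simp add: bop_simps)
  next
    case False
    define \<xi> where "\<xi> = (1 / norm (Q \<cdot> u)) *\<^sub>R (Q \<cdot> u)"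
    have \<xi>: "norm \<xi> = 1" "Q \<cdot> \<xi> = \<xi>" using False Q by (simp_all add: \<xi>_def bop_apply_scaleR)
    \<comment> \<open>\<open>\<xi>\<close> is a unit vector in the range of \<open>Q\<close>, so
      \<open>P\<close> kills every \<open>X \<cdot> \<xi>\<close>. Subtracting it from
      \<open>T \<cdot> \<xi>\<close> does not change the image under \<open>P\<close>, whose norm is
      thus at most the distance in \<alpha>.\<close>
    have "ennreal (norm (P \<cdot> T \<cdot> \<xi>)) \<le> (INF X\<in>\<X>. ennreal (norm (T \<cdot> \<xi> - X \<cdot> \<xi>)))"
    proof (rule INF_greatest)
      fix X assume "X \<in> \<X>"
      then have "P \<cdot> X \<cdot> \<xi> = 0" using ann[of X] \<xi>(2) by (metis bop_times_apply zero_bop_apply)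
      then have "P \<cdot> T \<cdot> \<xi> = P \<cdot> (T \<cdot> \<xi> - X \<cdot> \<xi>)" by (simp add: bop_apply_diff)
      then show "ennreal (norm (P \<cdot> T \<cdot> \<xi>)) \<le> ennreal (norm (T \<cdot> \<xi> - X \<cdot> \<xi>))"
        using orth_proj_norm_le[OF P] by (simp add: ennreal_leI)
    qed
    also have "\<dots> \<le> alpha T \<X>" unfolding alpha_def by (rule SUP_upper) (simp add: \<xi>)
    finally have le: "norm (P \<cdot> T \<cdot> \<xi>) \<le> c" using c by simp
    have "(P * T * Q) \<cdot> u = norm (Q \<cdot> u) *\<^sub>R (P \<cdot> T \<cdot> \<xi>)"
      using False by (simp add: \<xi>_def bop_simps)
    then have "norm ((P * T * Q) \<cdot> u) = norm (Q \<cdot> u) * norm (P \<cdot> T \<cdot> \<xi>)" by simp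
    also have "\<dots> \<le> norm u * c" using le c(2) orth_proj_norm_le[OF Q] by (intro mult_mono) auto
    finally show ?thesis by (simp add: mult.commute)
  qed
qed (rule c(2))

lemma sum_list_if_scaleR:
  "(\<Sum>w\<leftarrow>ws. if P w then S else 0) = real (length (filter P ws)) *\<^sub>R (S :: 'h bop)"
  by (induction ws) (simp_all add: algebra_simps)

lemma contractive_lattice_estimate:
  assumes \<Theta>: "\<Theta> \<in> schur_idempotents D"
    and ws: "\<And>w. w \<in> set ws \<Longrightarrow> contractive_word w" "\<And>T. schur_compl \<Theta> T = (\<Sum>w\<leftarrow>ws. literal_product w T)"
    and c: "alpha T (range \<Theta>) = ennreal c" "0 \<le> c"
  shows "norm (schur_compl \<Theta> T) \<le> (\<Sum>w\<leftarrow>ws. 2 ^ length w) * c"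
proof -
  \<comment> \<open>\<open>\<Theta>\<close> is included so that it, too, is 0 or the identity on
    each pair of cells; the words alone would only show that its complement acts as an
    integer.\<close>
  define F where "F = insert \<Theta> (\<Union>w\<in>set ws. fst ` set w)"
  have F: "finite F" "F \<subseteq> schur_idempotents D"
    using ws(1) \<Theta> contractiveD(1) by (auto simp: F_def contractive_word_def)
  note lin = schur_idempotents_clinear[OF \<Theta>]
  have mult: "schur_multiplier D \<Theta>" using \<Theta> by (simp add: schur_idempotents_def)
  show ?thesis
  proof (rule norm_le_of_schur_partitions[OF F])
    fix \<A> \<B> assume AB: "schur_partition F \<A> \<B>"
    then have parts: "part \<A>" "part \<B>" by (auto simp: schur_partition_def)
    have "\<exists>m. rectangle_controlled \<A> \<B> m (2 ^ length w) \<and>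
      (\<forall>A\<in>\<A>. \<forall>B\<in>\<B>. \<forall>T. literal_product w (A * T * B) = (if m A B then A * T * B else 0))" if "w \<in> set ws" for w
      by (rule literal_product_mask[OF ws(1)[OF that] AB]) (use that in \<open>auto simp: F_def\<close>)
    then obtain m where m: "\<And>w. w \<in> set ws \<Longrightarrow> rectangle_controlled \<A> \<B> (m w) (2 ^ length w)"
      "\<And>w A B T. w \<in> set ws \<Longrightarrow> A \<in> \<A> \<Longrightarrow> B \<in> \<B> \<Longrightarrow> literal_product w (A * T * B) = (if m w A B then A * T * B else 0)"
      by metis
    \<comment> \<open>On this pair of cells the complement of \<open>\<Theta>\<close> multiplies by
      the number of words whose mask contains the pair, which is at least 1. If
      \<open>\<Theta>\<close> fixes the corner \<open>A * S * B\<close>, the complement is 0 on it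
      and so the corner itself is 0; either way its image under \<open>\<Theta>\<close> is
      0.\<close>
    have vanish: "\<Theta> (A * S * B) = 0" if w: "w \<in> set ws" "m w A B" and A: "A \<in> \<A>" and B: "B \<in> \<B>" for w A B S
    proof -
      have "schur_compl \<Theta> (A * S * B) = (\<Sum>v\<leftarrow>ws. if m v A B then A * S * B else 0)"
        unfolding ws(2) by (rule arg_cong[of _ _ sum_list], rule map_cong) (simp_all add: m(2) A B)
      then have *: "schur_compl \<Theta> (A * S * B) = real (length (filter (\<lambda>v. m v A B) ws)) *\<^sub>R (A * S * B)"
        by (simp only: sum_list_if_scaleR)
      have "filter (\<lambda>v. m v A B) ws \<noteq> []" using w by (auto simp: filter_empty_conv)
      moreover have "\<Theta> (A * S * B) = A * S * B \<or> \<Theta> (A * S * B) = 0"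
        using AB A B unfolding schur_partition_def schur_rectangle_def F_def by blast
      ultimately show ?thesis using * by (auto simp: schur_compl_def)
    qed
    have rect: "rectangles_bounded \<A> \<B> (m w) T c" if w: "w \<in> set ws" for w
      unfolding rectangles_bounded_def
    proof (intro allI impI)
      fix \<A>' \<B>' assume 1: "\<A>' \<subseteq> \<A>" "\<B>' \<subseteq> \<B>" "\<forall>A\<in>\<A>'. \<forall>B\<in>\<B>'. m w A B"
      show "norm (\<Sum>\<A>' * T * \<Sum>\<B>') \<le> c"
      proof (rule norm_corner_le_alpha[OF _ _ _ c])
        show "orth_proj (\<Sum>\<A>')" "orth_proj (\<Sum>\<B>')"
          by (rule projs_orth_proj[OF part_sum_projs[OF part_subset[OF parts(1) 1(1)]]])
            (rule projs_orth_proj[OF part_sum_projs[OF part_subset[OF parts(2) 1(2)]]])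
        fix X assume "X \<in> range \<Theta>"
        then have X: "\<Theta> X = X" by (auto simp: lin)
        have "A * X * B = 0" if "A \<in> \<A>'" "B \<in> \<B>'" for A B
        proof -
          have AB': "A \<in> \<A>" "B \<in> \<B>" using that 1 by auto
          have "A \<in> D" "B \<in> D" using AB' parts part_projs projs_D by blast+
          then have "A * X * B = \<Theta> (A * X * B)" using schur_bimodule[OF mult, of A B X] X by simp
          also have "\<dots> = 0" by (rule vanish[OF w _ AB']) (use 1 that in auto)
          finally show ?thesis .
        qed
        then show "\<Sum>\<A>' * X * \<Sum>\<B>' = 0" unfolding sum_corner by (intro sum.neutral) auto
      qed
    qed
    have PQ: "\<Sum>\<A> \<in> D" "\<Sum>\<B> \<in> D" using part_sum_projs parts projs_D by blast+
    have "\<Sum>\<A> * schur_compl \<Theta> T * \<Sum>\<B> = schur_compl \<Theta> (\<Sum>\<A> * T * \<Sum>\<B>)"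
      using schur_bimodule[OF mult PQ, of T] by (simp add: schur_compl_def algebra_simps)
    also have "\<dots> = (\<Sum>w\<leftarrow>ws. literal_product w (\<Sum>\<A> * T * \<Sum>\<B>))" by (rule ws(2))
    also have "\<dots> = (\<Sum>w\<leftarrow>ws. mask_map \<A> \<B> (m w) T)"
    proof (rule arg_cong[of _ _ sum_list], rule map_cong[OF refl])
      fix w assume w: "w \<in> set ws"
      note add = literal_product_add[OF ws(1)[OF w]] literal_product_0[OF ws(1)[OF w]]
      have "literal_product w (\<Sum>\<A> * T * \<Sum>\<B>) = (\<Sum>A\<in>\<A>. \<Sum>B\<in>\<B>. literal_product w (A * T * B))"
        unfolding sum_corner by (simp add: additive_sum[of "literal_product w"] add)
      also have "\<dots> = mask_map \<A> \<B> (m w) T"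
        unfolding mask_map_def by (intro sum.cong refl m(2)[OF w])
      finally show "literal_product w (\<Sum>\<A> * T * \<Sum>\<B>) = mask_map \<A> \<B> (m w) T" .
    qed
    also have "norm \<dots> \<le> (\<Sum>w\<leftarrow>ws. 2 ^ length w * c)"
    proof -
      have "norm (\<Sum>w\<leftarrow>vs. mask_map \<A> \<B> (m w) T) \<le> (\<Sum>w\<leftarrow>vs. 2 ^ length w * c)" if "set vs \<subseteq> set ws" for vs
        using that
      proof (induction vs)
        case (Cons v vs)
        then have "norm (mask_map \<A> \<B> (m v) T) \<le> 2 ^ length v * c"
          using m(1)[of v] rect[of v] by (simp add: rectangle_controlled_def)
        then show ?case using Cons norm_triangle_mono by fastforce
      qed simp
      then show ?thesis by blast
    qed
    also have "\<dots> = (\<Sum>w\<leftarrow>ws. 2 ^ length w) * c" by (simp add: sum_list_mult_const)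
    finally show "norm (\<Sum>\<A> * schur_compl \<Theta> T * \<Sum>\<B>) \<le> (\<Sum>w\<leftarrow>ws. 2 ^ length w) * c" .
  qed (use c(2) in \<open>auto intro!: mult_nonneg_nonneg sum_list_nonneg\<close>)
qed

lemma contractive_lattice_hyperreflexive: "contractive_lattice D \<subseteq> hyperreflexive_schur_idempotents D"
proof
  fix \<Theta> assume "\<Theta> \<in> contractive_lattice D"
  then have \<Theta>: "\<Theta> \<in> schur_idempotents D" and "sum_of_literal_products (schur_compl \<Theta>)"
    using contractive_lattice_sum by blast+
  then obtain ws where ws: "\<And>w. w \<in> set ws \<Longrightarrow> contractive_word w"
    "\<And>T. schur_compl \<Theta> T = (\<Sum>w\<leftarrow>ws. literal_product w T)" unfolding sum_of_literal_products_def by blast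
  \<comment> \<open>The summand 1 keeps \<open>l\<close> positive when the list of words is
    empty.\<close>
  define l :: real where "l = 1 + (\<Sum>w\<leftarrow>ws. 2 ^ length w)"
  have "0 \<le> (\<Sum>w\<leftarrow>ws. 2 ^ length w :: real)" by (rule sum_list_nonneg) auto
  then have l: "0 < l" "(\<Sum>w\<leftarrow>ws. 2 ^ length w) \<le> l" by (simp_all add: l_def)
  have "ennreal (norm (schur_compl \<Theta> T)) \<le> ennreal l * alpha T (range \<Theta>)" for T
  proof (cases "alpha T (range \<Theta>)")
    case (real c)
    then have "norm (schur_compl \<Theta> T) \<le> (\<Sum>w\<leftarrow>ws. 2 ^ length w) * c"
      by (intro contractive_lattice_estimate[OF \<Theta> ws])
    also have "\<dots> \<le> l * c" by (rule mult_right_mono[OF l(2) real(1)])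
    finally show ?thesis using real l by (simp add: ennreal_mult[symmetric] ennreal_leI)
  next
    case top
    then show ?thesis using l(1) by (simp add: ennreal_mult_top)
  qed
  then show "\<Theta> \<in> hyperreflexive_schur_idempotents D"
    unfolding hyperreflexive_schur_idempotents_def using \<Theta> l(1) by blast
qed

end

theorem corollary3p12:
  fixes D :: "'h::chilbert_space bop set"
  assumes "separable_space (euclidean :: 'h topology)"
    and "masa D"
  shows "contractive_lattice D \<subseteq> hyperreflexive_schur_idempotents D"
  by (rule masa_algebra.contractive_lattice_hyperreflexive) (rule masa_algebra.intro[OF assms(2)])

end
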